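(* Let $1<p<\infty$, $0<\tau<p$. Assume that condition $\operatorname{BI}(\mathscr A,S,p,\tau)$ is satisfied and set $\beta=1/\tau-1/p$. Let $0<\gamma<\alpha<\beta$, $0<\kappa\le\infty$, $0<\rho\le\infty$, let $\sigma$ be given by $\alpha=1/\sigma-1/p$, write $\mathcal A_\rho^\alpha=\mathcal A_\rho^\alpha(L^p(S),\Phi)$, and let $f\in L^p(S)$. Then the following are equivalent: (1) $\{2^{n\gamma}K(f,2^{-n\alpha},L^p(S),\mathcal A_\rho^\alpha):n\ge0\}\in\ell^\kappa$, (2) $\{2^{n\gamma}(\|f-\mathscr G_{2^n}f\|_p+2^{-n\alpha}\|\mathscr G_{2^n}f\|_{\mathcal A_\rho^\alpha}):n\ge0\}\in\ell^\kappa$, (3) $\{2^{n\gamma}K(f,2^{-n\alpha},L^p(S),V_{\sigma,p}):n\ge0\}\in\ell^\kappa$, (4) $\{2^{n\gamma}(\|f-\mathscr G_{2^n}f\|_p+2^{-n\alpha}\|\mathscr G_{2^n}f\|_{V_{\sigma,p}}):n\ge0\}\in\ell^\kappa$.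
   Context: Setting. $(\Omega,\mathscr F,|\cdot|)$ is a probability space, $\nu\ge 2$ an integer, and $(\mathscr F_n)_{n\ge 0}$ a $\nu$-ary filtration: an increasing sequence of finite sub-$\sigma$-algebras of $\mathscr F$ with $\mathscr F_0=\{\emptyset,\Omega\}$, such that for each $n\ge1$ each atom of $\mathscr F_{n-1}$ is a union of at most $\nu$ atoms of $\mathscr F_n$; all atoms have positive measure. $\mathscr A_n$ is the set of atoms of $\mathscr F_n$ and $\mathscr A=\bigcup_n\mathscr A_n$. Elements of $\mathscr A$ are called atoms; nonempty differences $A\setminus B$ with $A,B\in\mathscr A$, $B\subsetneq A$, are called rings. $S$ is a finite-dimensional linear space of bounded $\mathscr F$-measurable scalar-valued functions on $\Omega$ for which there are constants $c_1,c_2\in(0,1]$ with $|\{\omega\in A:|f(\omega)|\ge c_1\|f\|_A\}|\ge c_2|A|$ for all $A\in\mathscr A$, $f\in S$, where $\|f\|_A$ is the $L^\infty$-norm of $f$ on $A$. For $R\in\mathscr F$, $S_R=\{f\mathbf 1_R:f\in S\}$. $\mathcal C=\{f\mathbf 1_A:f\in S,A\in\mathscr A\}$ and $L^p(S)$ is the closure of $\operatorname{span}\mathcal C$ in $L^p(\Omega)$. Local orthonormal system. $S_n$ is the space of functions coinciding on each atom of $\mathscr F_n$ with some element of $S$; $P_n$ is the orthogonal projection onto $S_n$ in $L^2$, $P_{-1}=0$. $\Phi=\bigcup_{n\ge0}\Phi_n$, where $\Phi_n$ is an orthonormal basis of the range of $P_n-P_{n-1}$, each element of $\Phi_n$ ($n\ge1$)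 being supported in a single atom of $\mathscr F_{n-1}$ (so that each element of $\Phi$ is a sum of at most $\nu$ elements of $\mathcal C$). It is assumed that for each $1<p<\infty$ the $L^p$-normalization of $\Phi$ is a greedy basis of $L^p(S)$ (i.e. $\|f-\mathscr G_mf\|_p$ is, up to a uniform constant, the best $m$-term approximation error) satisfying the $p$-Temlyakov property: $\|\sum_{n\in\Lambda}\psi_n\|_p\simeq(\operatorname{card}\Lambda)^{1/p}$ uniformly over finite index sets $\Lambda$, $(\psi_n)$ being the normalized system. Here $\mathscr G_mf=\sum_{j=1}^m c_{k_j}\psi_{k_j}$, where $f=\sum_jc_j\psi_j$ is the expansion of $f$ in the $L^p$-normalized system and $(k_j)$ is a chosen ordering of the indices with $|c_{k_1}|\ge|c_{k_2}|\ge\cdots$. Approximation space: for a linearly dense subset $\mathcal D\subset L^p(S)$, $\Sigma_n^{\mathcal D}$ is the set of linear combinations of $n$ elements of $\mathcal D$, $\sigma_n(f,\mathcal D)=\inf\{\|f-g\|_p:g\in\Sigma_n^{\mathcal D}\}$, and $\mathcal A_q^\alpha(L^p(S),\mathcal D)=\{f\in L^p(S):\|f\|_p+\|(2^{n\alpha}\sigma_{2^n}(f,\mathcal D))_{n\ge0}\|_{\ell^q}<\infty\}$ with this expression as quasi-norm. Variation space: $E_p(f,R)=\inf\{\|f-g\|_{L^p(R)}:g\in S_R\}$, $|f|_{V_{\sigma,p}}=\sup_\Pi\big(\sum_{R\in\Pi}E_p(f,R)^\sigma\big)^{1/\sigma}$, supremum over all finite collections $\Pi$ of pairwise disjoint atoms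 or rings; $V_{\sigma,p}=\{f\in L^p(S):\|f\|_{V_{\sigma,p}}:=\|f\|_p+|f|_{V_{\sigma,p}}<\infty\}$. K-functional: $K(f,t,\mathcal X,\mathcal Y)=\inf\{\|f-g\|_{\mathcal X}+t\|g\|_{\mathcal Y}:g\in\mathcal Y\}$. Bernstein inequality: $\operatorname{BI}(\mathscr A,S,p,\tau)$ is satisfied if, with $\beta=1/\tau-1/p$, there is a constant $C$ such that for all positive integers $n$ and all $f\in\Sigma_{2^n}^{\mathcal C}$ one has $\|f\|_{\mathcal A_\tau^\beta(L^p(S),\Phi)}\le C2^{n\beta}\|f\|_p$. *)

theory Defs
  imports "HOL-Probability.Probability" "HOL-Library.Function_Algebras"
begin

text \<open>
  Scalars range over a type \<open>'k :: {real_normed_field, euclidean_space}\<close>, which covers both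
  the real and the complex case.  There is no conjugation in these classes; it is recovered from
  the identity $\bar z = |z|^2 / z$ (with value \<open>0\<close> at \<open>0\<close>), cf. the two lemmas below.
\<close>

definition sconj :: "'k::real_normed_field \<Rightarrow> 'k" where
  "sconj z = of_real ((norm z)\<^sup>2) / z"

lemma sconj_complex: "sconj z = cnj z"
proof (cases "z = 0")
  case False
  then show ?thesis
    by (simp add: sconj_def complex_norm_square field_simps del: of_real_power)
qed (simp add: sconj_def)

lemma sconj_real: "sconj (x::real) = x"
  by (simp add: sconj_def power2_eq_square)

definition fscale :: "'k \<Rightarrow> ('a \<Rightarrow> 'k) \<Rightarrow> 'a \<Rightarrow> 'k::field" where
  "fscale c f = (\<lambda>x. c * f x)"

interpretation fun_space: vector_space "fscale :: 'k::field \<Rightarrow> ('a \<Rightarrow> 'k) \<Rightarrow> 'a \<Rightarrow> 'k"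
  by unfold_locales (auto simp: fscale_def fun_eq_iff algebra_simps)

text \<open>Power with a positive real exponent; only used for \<open>r > 0\<close>.\<close>

definition epowr :: "ennreal \<Rightarrow> real \<Rightarrow> ennreal" where
  "epowr x r = (if x = \<infinity> then \<infinity> else ennreal (enn2real x powr r))"

definition Lp_norm :: "'a measure \<Rightarrow> real \<Rightarrow> ('a \<Rightarrow> 'k::real_normed_vector) \<Rightarrow> ennreal" where
  "Lp_norm M p f = epowr (\<integral>\<^sup>+\<omega>. ennreal (norm (f \<omega>) powr p) \<partial>M) (1 / p)"

text \<open>Spaces of functions are sets of representatives; a.e. equal functions are not identified.\<close>

definition Lp :: "'a measure \<Rightarrow> real \<Rightarrow> ('a \<Rightarrow> 'k::real_normed_vector) set" where
  "Lp M p = {f \<in> borel_measurable M. Lp_norm M p f < \<infinity>}"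

definition Linf_norm_on :: "'a measure \<Rightarrow> 'a set \<Rightarrow> ('a \<Rightarrow> 'k::real_normed_vector) \<Rightarrow> ereal" where
  "Linf_norm_on M A f = esssup (restrict_space M A) (\<lambda>\<omega>. ereal (norm (f \<omega>)))"

definition lq_norm :: "ennreal \<Rightarrow> (nat \<Rightarrow> ennreal) \<Rightarrow> ennreal" where
  "lq_norm q a = (if q = \<infinity> then (SUP n. a n)
                  else epowr (\<Sum>n. epowr (a n) (enn2real q)) (1 / enn2real q))"

definition in_lq :: "ennreal \<Rightarrow> (nat \<Rightarrow> ennreal) \<Rightarrow> bool" where
  "in_lq q a \<longleftrightarrow> lq_norm q a < \<infinity>"

definition L2_inner ::
    "'a measure \<Rightarrow> ('a \<Rightarrow> 'k) \<Rightarrow> ('a \<Rightarrow> 'k) \<Rightarrow> 'k::{real_normed_field, euclidean_space}" where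
  "L2_inner M f g = (LINT \<omega>|M. f \<omega> * sconj (g \<omega>))"

definition atoms_of :: "'a measure \<Rightarrow> 'a set set" where
  "atoms_of N = {A \<in> sets N. A \<noteq> {} \<and> (\<forall>B \<in> sets N. B \<subseteq> A \<longrightarrow> B = {} \<or> B = A)}"

definition all_atoms :: "(nat \<Rightarrow> 'a measure) \<Rightarrow> 'a set set" where
  "all_atoms F = (\<Union>n. atoms_of (F n))"

definition rings :: "(nat \<Rightarrow> 'a measure) \<Rightarrow> 'a set set" where
  "rings F = {A - B | A B. A \<in> all_atoms F \<and> B \<in> all_atoms F \<and> B \<subset> A}"

text \<open>The sub-\<open>\<sigma>\<close>-algebras are given by the \<open>sets\<close> of \<open>F n\<close>; the measure stored in
  \<open>F n\<close> is irrelevant.\<close>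

locale nuary_filtration = prob_space M + filtration "space M" F
  for M :: "'a measure" and F :: "nat \<Rightarrow> 'a measure" +
  fixes \<nu> :: nat
  assumes nu_ge_2: "\<nu> \<ge> 2"
    and subalg: "\<And>n. subalgebra M (F n)"
    and finite_F: "\<And>n. finite (sets (F n))"
    and F_0: "sets (F 0) = {{}, space M}"
    and refine: "\<And>n A. A \<in> atoms_of (F n) \<Longrightarrow>
        \<exists>U \<subseteq> atoms_of (F (Suc n)). finite U \<and> card U \<le> \<nu> \<and> A = \<Union>U"
    and atoms_pos: "\<And>A. A \<in> all_atoms F \<Longrightarrow> measure M A > 0"

definition restrict_fun :: "('a \<Rightarrow> 'k) \<Rightarrow> 'a set \<Rightarrow> 'a \<Rightarrow> 'k::real_normed_field" where
  "restrict_fun f R = (\<lambda>\<omega>. f \<omega> * indicator R \<omega>)"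

definition admissible_space :: "'a measure \<Rightarrow> (nat \<Rightarrow> 'a measure) \<Rightarrow>
    ('a \<Rightarrow> 'k::{real_normed_field, euclidean_space}) set \<Rightarrow> bool" where
  "admissible_space M F S \<longleftrightarrow>
     (\<exists>B. finite B \<and> S = fun_space.span B) \<and>
     (\<forall>f\<in>S. f \<in> borel_measurable M \<and> bounded (f ` space M)) \<and>
     (\<exists>c1 c2 :: real. 0 < c1 \<and> c1 \<le> 1 \<and> 0 < c2 \<and> c2 \<le> 1 \<and>
        (\<forall>A\<in>all_atoms F. \<forall>f\<in>S.
           measure M {\<omega>\<in>A. ereal (norm (f \<omega>)) \<ge> ereal c1 * Linf_norm_on M A f}
             \<ge> c2 * measure M A))"

definition restricted_space ::
    "('a \<Rightarrow> 'k::real_normed_field) set \<Rightarrow> 'a set \<Rightarrow> ('a \<Rightarrow> 'k) set" where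
  "restricted_space S R = {restrict_fun f R | f. f \<in> S}"

definition C_dict ::
    "(nat \<Rightarrow> 'a measure) \<Rightarrow> ('a \<Rightarrow> 'k::real_normed_field) set \<Rightarrow> ('a \<Rightarrow> 'k) set" where
  "C_dict F S = {restrict_fun f A | f A. f \<in> S \<and> A \<in> all_atoms F}"

definition LpS :: "'a measure \<Rightarrow> (nat \<Rightarrow> 'a measure) \<Rightarrow>
    ('a \<Rightarrow> 'k::real_normed_field) set \<Rightarrow> real \<Rightarrow> ('a \<Rightarrow> 'k) set" where
  "LpS M F S p = {f \<in> Lp M p.
     \<forall>\<epsilon>>0. \<exists>g \<in> fun_space.span (C_dict F S). Lp_norm M p (f - g) < ennreal \<epsilon>}"

definition piecewise_space :: "(nat \<Rightarrow> 'a measure) \<Rightarrow>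
    ('a \<Rightarrow> 'k) set \<Rightarrow> nat \<Rightarrow> ('a \<Rightarrow> 'k) set" where
  "piecewise_space F S n = {g. \<forall>A\<in>atoms_of (F n). \<exists>f\<in>S. \<forall>\<omega>\<in>A. g \<omega> = f \<omega>}"

text \<open>The orthogonal projection is determined up to a.e. equality only.\<close>

definition orth_proj :: "'a measure \<Rightarrow> ('a \<Rightarrow> 'k::{real_normed_field, euclidean_space}) set \<Rightarrow>
    ('a \<Rightarrow> 'k) \<Rightarrow> 'a \<Rightarrow> 'k" where
  "orth_proj M V f = (SOME g. g \<in> V \<and> (\<forall>h\<in>V. L2_inner M (f - g) h = 0))"

definition proj_diff :: "'a measure \<Rightarrow> (nat \<Rightarrow> 'a measure) \<Rightarrow>
    ('a \<Rightarrow> 'k::{real_normed_field, euclidean_space}) set \<Rightarrow> nat \<Rightarrow> ('a \<Rightarrow> 'k) \<Rightarrow> 'a \<Rightarrow> 'k" where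
  "proj_diff M F S n f =
     (case n of
        0 \<Rightarrow> orth_proj M (piecewise_space F S 0) f
      | Suc m \<Rightarrow> orth_proj M (piecewise_space F S (Suc m)) f
                 - orth_proj M (piecewise_space F S m) f)"

text \<open>Closed under a.e. equality, as the range of an operator on the Hilbert space \<open>L\<^sup>2\<close>.\<close>

definition proj_diff_range :: "'a measure \<Rightarrow> (nat \<Rightarrow> 'a measure) \<Rightarrow>
    ('a \<Rightarrow> 'k::{real_normed_field, euclidean_space}) set \<Rightarrow> nat \<Rightarrow> ('a \<Rightarrow> 'k) set" where
  "proj_diff_range M F S n =
     {u \<in> Lp M 2. \<exists>f \<in> Lp M 2. AE \<omega> in M. u \<omega> = proj_diff M F S n f \<omega>}"

definition orthonormal_basis :: "'a measure \<Rightarrow>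
    ('a \<Rightarrow> 'k::{real_normed_field, euclidean_space}) set \<Rightarrow> ('a \<Rightarrow> 'k) set \<Rightarrow> bool" where
  "orthonormal_basis M V B \<longleftrightarrow>
     finite B \<and> B \<subseteq> V \<and>
     (\<forall>b\<in>B. \<forall>b'\<in>B. L2_inner M b b' = (if b = b' then 1 else 0)) \<and>
     (\<forall>u\<in>V. \<exists>v\<in>fun_space.span B. AE \<omega> in M. u \<omega> = v \<omega>)"

definition local_orthonormal_system :: "'a measure \<Rightarrow> (nat \<Rightarrow> 'a measure) \<Rightarrow>
    ('a \<Rightarrow> 'k::{real_normed_field, euclidean_space}) set \<Rightarrow> (nat \<Rightarrow> ('a \<Rightarrow> 'k) set) \<Rightarrow> bool" where
  "local_orthonormal_system M F S \<Phi> \<longleftrightarrow>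
     (\<forall>n. orthonormal_basis M (proj_diff_range M F S n) (\<Phi> n)) \<and>
     (\<forall>n. \<forall>\<phi>\<in>\<Phi> (Suc n). \<exists>A\<in>atoms_of (F n). AE \<omega> in M. \<omega> \<notin> A \<longrightarrow> \<phi> \<omega> = 0)"

text \<open>
  A countable system \<open>X\<close>, possibly finite, is enumerated by the initial segment
  \<open>index_set X\<close> of the natural numbers.
\<close>

definition index_set :: "'b set \<Rightarrow> nat set" where
  "index_set X = {j. finite X \<longrightarrow> j < card X}"

definition enumerates :: "(nat \<Rightarrow> 'b) \<Rightarrow> 'b set \<Rightarrow> bool" where
  "enumerates e X \<longleftrightarrow> countable X \<and> bij_betw e (index_set X) X"

definition Lp_normalize :: "'a measure \<Rightarrow> real \<Rightarrow>
    (nat \<Rightarrow> 'a \<Rightarrow> 'k::real_normed_field) \<Rightarrow> nat \<Rightarrow> 'a \<Rightarrow> 'k" where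
  "Lp_normalize M p e j = fscale (of_real (1 / enn2real (Lp_norm M p (e j)))) (e j)"

definition expansion :: "'a measure \<Rightarrow> real \<Rightarrow> nat set \<Rightarrow>
    (nat \<Rightarrow> 'a \<Rightarrow> 'k::real_normed_field) \<Rightarrow> ('a \<Rightarrow> 'k) \<Rightarrow> (nat \<Rightarrow> 'k) \<Rightarrow> bool" where
  "expansion M p J \<psi> f c \<longleftrightarrow>
     (\<lambda>n. Lp_norm M p (f - (\<Sum>j \<in> J \<inter> {..<n}. fscale (c j) (\<psi> j)))) \<longlonglongrightarrow> 0"

definition schauder_basis :: "'a measure \<Rightarrow> real \<Rightarrow> nat set \<Rightarrow>
    (nat \<Rightarrow> 'a \<Rightarrow> 'k::real_normed_field) \<Rightarrow> ('a \<Rightarrow> 'k) set \<Rightarrow> bool" where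
  "schauder_basis M p J \<psi> X \<longleftrightarrow>
     (\<forall>j\<in>J. \<psi> j \<in> X) \<and>
     (\<forall>f\<in>X. (\<exists>c. expansion M p J \<psi> f c) \<and>
        (\<forall>c c'. expansion M p J \<psi> f c \<longrightarrow> expansion M p J \<psi> f c' \<longrightarrow> (\<forall>j\<in>J. c j = c' j)))"

definition basis_coeffs :: "'a measure \<Rightarrow> real \<Rightarrow> nat set \<Rightarrow>
    (nat \<Rightarrow> 'a \<Rightarrow> 'k::real_normed_field) \<Rightarrow> ('a \<Rightarrow> 'k) \<Rightarrow> nat \<Rightarrow> 'k" where
  "basis_coeffs M p J \<psi> f = (SOME c. expansion M p J \<psi> f c)"

text \<open>
  An ordering \<open>k\<close> of the indices by decreasing modulus of the coefficients.  If infinitely many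
  coefficients are nonzero then indices of vanishing coefficients cannot all be listed, so \<open>k\<close> is
  only required to be injective and to choose at each step an index whose coefficient has maximal
  modulus among the remaining ones.  It is numbered from \<open>0\<close>.
\<close>

definition greedy_ordering :: "nat set \<Rightarrow> (nat \<Rightarrow> 'k::real_normed_vector) \<Rightarrow> (nat \<Rightarrow> nat) \<Rightarrow> bool" where
  "greedy_ordering J c k \<longleftrightarrow>
     inj_on k J \<and> k ` J \<subseteq> J \<and>
     (\<forall>j\<in>J. \<forall>i \<in> J - k ` {..j}. norm (c i) \<le> norm (c (k j)))"

definition greedy_approx :: "'a measure \<Rightarrow> real \<Rightarrow> nat set \<Rightarrow>
    (nat \<Rightarrow> 'a \<Rightarrow> 'k::real_normed_field) \<Rightarrow> (('a \<Rightarrow> 'k) \<Rightarrow> nat \<Rightarrow> nat) \<Rightarrow> nat \<Rightarrow> ('a \<Rightarrow> 'k) \<Rightarrow> 'a \<Rightarrow> 'k"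
  where
  "greedy_approx M p J \<psi> k m f =
     (\<Sum>j \<in> J \<inter> {..<m}. fscale (basis_coeffs M p J \<psi> f (k f j)) (\<psi> (k f j)))"

definition Sigma_n :: "('a \<Rightarrow> 'k::field) set \<Rightarrow> nat \<Rightarrow> ('a \<Rightarrow> 'k) set" where
  "Sigma_n D n = (\<Union>T \<in> {T. T \<subseteq> D \<and> finite T \<and> card T \<le> n}. fun_space.span T)"

definition sigma_n :: "'a measure \<Rightarrow> real \<Rightarrow>
    ('a \<Rightarrow> 'k::real_normed_field) set \<Rightarrow> nat \<Rightarrow> ('a \<Rightarrow> 'k) \<Rightarrow> ennreal" where
  "sigma_n M p D n f = (INF g \<in> Sigma_n D n. Lp_norm M p (f - g))"

definition greedy_basis :: "'a measure \<Rightarrow> real \<Rightarrow> nat set \<Rightarrow> (nat \<Rightarrow> 'a \<Rightarrow> 'k::real_normed_field) \<Rightarrow>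
    (('a \<Rightarrow> 'k) \<Rightarrow> nat \<Rightarrow> nat) \<Rightarrow> ('a \<Rightarrow> 'k) set \<Rightarrow> bool" where
  "greedy_basis M p J \<psi> k X \<longleftrightarrow>
     schauder_basis M p J \<psi> X \<and>
     (\<forall>f\<in>X. greedy_ordering J (basis_coeffs M p J \<psi> f) (k f)) \<and>
     (\<exists>C::real. \<forall>f\<in>X. \<forall>m.
        Lp_norm M p (f - greedy_approx M p J \<psi> k m f) \<le> ennreal C * sigma_n M p (\<psi> ` J) m f)"

definition temlyakov_property :: "'a measure \<Rightarrow> real \<Rightarrow> nat set \<Rightarrow>
    (nat \<Rightarrow> 'a \<Rightarrow> 'k::real_normed_field) \<Rightarrow> bool" where
  "temlyakov_property M p J \<psi> \<longleftrightarrow>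
     (\<exists>c C :: real. c > 0 \<and> C > 0 \<and> (\<forall>\<Lambda> \<subseteq> J. finite \<Lambda> \<longrightarrow>
        ennreal (c * real (card \<Lambda>) powr (1 / p)) \<le> Lp_norm M p (\<Sum>n\<in>\<Lambda>. \<psi> n) \<and>
        Lp_norm M p (\<Sum>n\<in>\<Lambda>. \<psi> n) \<le> ennreal (C * real (card \<Lambda>) powr (1 / p))))"

definition approx_norm :: "'a measure \<Rightarrow> real \<Rightarrow> ('a \<Rightarrow> 'k::real_normed_field) set \<Rightarrow>
    real \<Rightarrow> ennreal \<Rightarrow> ('a \<Rightarrow> 'k) \<Rightarrow> ennreal" where
  "approx_norm M p D \<alpha> q f =
     Lp_norm M p f + lq_norm q (\<lambda>n. ennreal (2 powr (real n * \<alpha>)) * sigma_n M p D (2 ^ n) f)"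

definition approx_space :: "'a measure \<Rightarrow> (nat \<Rightarrow> 'a measure) \<Rightarrow>
    ('a \<Rightarrow> 'k::real_normed_field) set \<Rightarrow> real \<Rightarrow> ('a \<Rightarrow> 'k) set \<Rightarrow>
    real \<Rightarrow> ennreal \<Rightarrow> ('a \<Rightarrow> 'k) set" where
  "approx_space M F S p D \<alpha> q = {f \<in> LpS M F S p. approx_norm M p D \<alpha> q f < \<infinity>}"

definition local_error :: "'a measure \<Rightarrow> ('a \<Rightarrow> 'k::real_normed_field) set \<Rightarrow>
    real \<Rightarrow> ('a \<Rightarrow> 'k) \<Rightarrow> 'a set \<Rightarrow> ennreal" where
  "local_error M S p f R = (INF g \<in> restricted_space S R. Lp_norm (restrict_space M R) p (f - g))"

definition variation_seminorm :: "'a measure \<Rightarrow> (nat \<Rightarrow> 'a measure) \<Rightarrow>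
    ('a \<Rightarrow> 'k::real_normed_field) set \<Rightarrow> real \<Rightarrow> real \<Rightarrow> ('a \<Rightarrow> 'k) \<Rightarrow> ennreal" where
  "variation_seminorm M F S p \<sigma> f =
     (SUP Q \<in> {Q. finite Q \<and> Q \<subseteq> all_atoms F \<union> rings F \<and> disjoint Q}.
        epowr (\<Sum>R\<in>Q. epowr (local_error M S p f R) \<sigma>) (1 / \<sigma>))"

definition variation_norm :: "'a measure \<Rightarrow> (nat \<Rightarrow> 'a measure) \<Rightarrow>
    ('a \<Rightarrow> 'k::real_normed_field) set \<Rightarrow> real \<Rightarrow> real \<Rightarrow> ('a \<Rightarrow> 'k) \<Rightarrow> ennreal" where
  "variation_norm M F S p \<sigma> f = Lp_norm M p f + variation_seminorm M F S p \<sigma> f"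

definition variation_space :: "'a measure \<Rightarrow> (nat \<Rightarrow> 'a measure) \<Rightarrow>
    ('a \<Rightarrow> 'k::real_normed_field) set \<Rightarrow> real \<Rightarrow> real \<Rightarrow> ('a \<Rightarrow> 'k) set" where
  "variation_space M F S p \<sigma> = {f \<in> LpS M F S p. variation_norm M F S p \<sigma> f < \<infinity>}"

definition K_functional :: "(('a \<Rightarrow> 'k::ab_group_add) \<Rightarrow> ennreal) \<Rightarrow> ('a \<Rightarrow> 'k) set \<Rightarrow>
    (('a \<Rightarrow> 'k) \<Rightarrow> ennreal) \<Rightarrow> ('a \<Rightarrow> 'k) \<Rightarrow> real \<Rightarrow> ennreal" where
  "K_functional normX Y normY f t = (INF g \<in> Y. normX (f - g) + ennreal t * normY g)"

definition bernstein_inequality :: "'a measure \<Rightarrow> (nat \<Rightarrow> 'a measure) \<Rightarrow>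
    ('a \<Rightarrow> 'k::real_normed_field) set \<Rightarrow> ('a \<Rightarrow> 'k) set \<Rightarrow> real \<Rightarrow> real \<Rightarrow> bool" where
  "bernstein_inequality M F S D p \<tau> \<longleftrightarrow>
     (let \<beta> = 1 / \<tau> - 1 / p in
      \<exists>C::real. \<forall>n\<ge>1. \<forall>f \<in> Sigma_n (C_dict F S) (2 ^ n).
        approx_norm M p D \<beta> (ennreal \<tau>) f \<le> ennreal (C * 2 powr (real n * \<beta>)) * Lp_norm M p f)"

end

theory Submission
  imports Defs
begin

text \<open>
  All four conditions are equivalent to a fifth one that mentions only the errors of best
  approximation from \<open>\<Phi>\<close>: the sequence \<open>2\<^sup>n\<^sup>\<gamma> \<sigma>\<^bsub>2^n\<^esub>(f, \<Phi>)\<close> belongs to \<open>\<ell>\<^sup>\<kappa>\<close>.  Let \<open>Y\<close> be the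
  approximation space or the variation space.  The greedy approximation is a near-best one and a
  competitor in the K-functional, so two inequalities for \<open>Y\<close> are needed.

  A Jackson inequality \<open>\<sigma>\<^bsub>2^n\<^esub>(g, \<Phi>) \<le> C 2\<^sup>-\<^sup>n\<^sup>\<alpha> \<bar>g\<bar>\<^sub>Y\<close> bounds the best error of \<open>f\<close> by the
  K-functional, which in turn is at most the expression formed with the greedy approximation.

  In the other direction, the norm in \<open>Y\<close> of the \<open>2\<^sup>n\<close>-term greedy approximation is bounded by a
  geometrically weighted maximum of the earlier errors, the \<open>envelope\<close> below, and such a maximum
  is in \<open>\<ell>\<^sup>\<kappa>\<close> as soon as the errors are.  This is a form of Hardy's inequality; since
  \<open>\<gamma> < \<alpha>\<close> leaves a geometric factor to spare, suprema suffice and the argument is the same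
  for all exponents.  Lemma \<open>K_functional_greedy_equivalence\<close> combines the two parts.

  For the approximation space both inequalities follow directly from the definition of its norm.
  For the variation space they carry the weight of the proof.

  Bernstein: an atom cuts at most one member of a disjoint family of atoms and rings, hence a sum
  of \<open>N\<close> dictionary elements has a nonzero local error on at most \<open>N\<close> of them
  (\<open>variation_Bernstein\<close>).  Each element of \<open>\<Phi>\<close> is almost everywhere a sum of at most \<open>\<nu>\<close>
  dictionary elements, because the orthogonal projections defining \<open>\<Phi>\<close> exist and are piecewise
  in \<open>S\<close>; so the inequality passes to \<open>\<Phi>\<close>.

  Jackson: a greedy bottom-up subdivision of the tree of atoms partitions the space into
  \<open>O(N)\<close> regions with small local error, and yields \<open>N\<close>-term approximation from the dictionary at
  the rate \<open>N\<^sup>-\<^sup>\<alpha>\<close> (\<open>variation_Jackson_dict\<close>).  The hypothesis \<open>BI\<close>, whose order \<open>\<beta>\<close>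
  exceeds \<open>\<alpha>\<close>, transfers this rate from the dictionary to \<open>\<Phi>\<close> by successive correction
  (\<open>variation_Jackson_step\<close>, \<open>variation_Jackson\<close>).
\<close>

section \<open>Powers of extended reals and the L^p quasi-norm\<close>

lemma epowr_ennreal: "0 \<le> x \<Longrightarrow> epowr (ennreal x) r = ennreal (x powr r)"
  by (simp add: epowr_def)

lemma epowr_0 [simp]: "epowr 0 r = 0"
  by (simp add: epowr_def)

lemma epowr_1 [simp]: "epowr x 1 = x"
  by (cases x) (auto simp: epowr_def)

lemma epowr_mono: "x \<le> y \<Longrightarrow> 0 \<le> r \<Longrightarrow> epowr x r \<le> epowr y r"
proof (cases "y = \<top>")
  case False
  assume *: "x \<le> y" "0 \<le> r"
  then obtain a b where "x = ennreal a" "y = ennreal b" "0 \<le> a" "0 \<le> b"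
    using False by (cases x; cases y) (auto simp: top_unique)
  with * show ?thesis by (simp add: epowr_ennreal ennreal_leI powr_mono2)
qed (simp add: epowr_def)

lemma epowr_top_iff: "epowr x r = \<top> \<longleftrightarrow> x = \<top>"
  by (cases x) (auto simp: epowr_def)

lemma epowr_less_top_iff: "epowr x r < \<top> \<longleftrightarrow> x < \<top>"
  by (simp add: less_top[symmetric] epowr_top_iff)

lemma epowr_mult:
  assumes "0 < r" shows "epowr (x * y) r = epowr x r * epowr y r"
proof (cases "x = \<top> \<or> y = \<top>")
  case True
  then show ?thesis using assms
    by (cases x; cases y)
       (auto simp: epowr_def ennreal_mult_top ennreal_top_mult ennreal_mult[symmetric] enn2real_eq_0_iff)
next
  case False
  then obtain a b where "x = ennreal a" "y = ennreal b" "0 \<le> a" "0 \<le> b"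
    by (cases x; cases y) auto
  then show ?thesis
    by (simp add: epowr_ennreal ennreal_mult[symmetric] powr_mult)
qed

lemma epowr_epowr: "epowr (epowr x r) s = epowr x (r * s)"
  by (cases x) (auto simp: epowr_ennreal powr_powr, auto simp: epowr_def)

lemma epowr_inverse:
  assumes "0 < r" shows "epowr (epowr x r) (1 / r) = x" "epowr (epowr x (1 / r)) r = x"
  using assms by (auto simp: epowr_epowr)

lemma epowr_le_iff:
  assumes "0 < r" shows "epowr x (1 / r) \<le> y \<longleftrightarrow> x \<le> epowr y r"
  using epowr_mono[of "epowr x (1 / r)" y r] epowr_mono[of x "epowr y r" "1 / r"] assms
  by (auto simp: epowr_inverse)

lemma epowr_Lp_norm:
  assumes "0 < p"
  shows "epowr (Lp_norm M p f) p = (\<integral>\<^sup>+\<omega>. ennreal (norm (f \<omega>) powr p) \<partial>M)"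
  unfolding Lp_norm_def by (simp add: epowr_inverse assms)

lemma Lp_norm_le_iff:
  assumes "0 < p"
  shows "Lp_norm M p f \<le> c \<longleftrightarrow> (\<integral>\<^sup>+\<omega>. ennreal (norm (f \<omega>) powr p) \<partial>M) \<le> epowr c p"
  unfolding Lp_norm_def by (simp add: epowr_le_iff assms)

lemma Lp_norm_mono_AE:
  assumes "0 < p" "AE \<omega> in M. norm (f \<omega>) \<le> norm (g \<omega>)"
  shows "Lp_norm M p f \<le> Lp_norm M p g"
proof -
  have "AE \<omega> in M. ennreal (norm (f \<omega>) powr p) \<le> ennreal (norm (g \<omega>) powr p)"
    using assms(2) by eventually_elim (use assms(1) in \<open>auto intro!: ennreal_leI powr_mono2\<close>)
  then show ?thesis
    unfolding Lp_norm_def using assms(1) by (intro epowr_mono nn_integral_mono_AE) auto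
qed

lemma Lp_norm_cong_AE:
  assumes "0 < p" "AE \<omega> in M. norm (f \<omega>) = norm (g \<omega>)"
  shows "Lp_norm M p f = Lp_norm M p g"
proof (intro antisym Lp_norm_mono_AE)
  show "AE \<omega> in M. norm (f \<omega>) \<le> norm (g \<omega>)" "AE \<omega> in M. norm (g \<omega>) \<le> norm (f \<omega>)"
    using assms(2) by (eventually_elim, simp)+
qed (use assms in auto)

lemma Lp_norm_minus_commute:
  fixes f g :: "'a \<Rightarrow> 'k::real_normed_vector"
  shows "0 < p \<Longrightarrow> Lp_norm M p (f - g) = Lp_norm M p (g - f)"
  by (rule Lp_norm_cong_AE) (auto simp: norm_minus_commute)

lemma Lp_norm_0 [simp]: "Lp_norm M p 0 = 0"
  unfolding Lp_norm_def by simp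

lemma Lp_norm_fscale:
  fixes f :: "'a \<Rightarrow> 'k::{real_normed_field, euclidean_space}"
  assumes "0 < p" "f \<in> borel_measurable M"
  shows "Lp_norm M p (fscale c f) = ennreal (norm c) * Lp_norm M p f"
proof -
  have "(\<integral>\<^sup>+\<omega>. ennreal (norm (fscale c f \<omega>) powr p) \<partial>M)
      = (\<integral>\<^sup>+\<omega>. ennreal (norm c powr p) * ennreal (norm (f \<omega>) powr p) \<partial>M)"
    by (simp add: fscale_def norm_mult powr_mult ennreal_mult)
  also have "\<dots> = ennreal (norm c powr p) * (\<integral>\<^sup>+\<omega>. ennreal (norm (f \<omega>) powr p) \<partial>M)"
    using assms by (intro nn_integral_cmult) auto
  finally show ?thesis
    using assms by (simp add: Lp_norm_def epowr_mult epowr_ennreal powr_powr)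
qed

text \<open>Convexity of \<open>t \<mapsto> t\<^sup>p\<close> at the points \<open>x / a\<close> and \<open>y / b\<close> with weights proportional to \<open>a\<close>
  and \<open>b\<close>, multiplied by \<open>(a + b)\<^sup>p\<close>.\<close>

lemma powr_convex_combination:
  assumes p: "1 \<le> p" and ab: "0 < a" "0 < b" and xy: "0 \<le> x" "0 \<le> (y::real)"
  shows "(x + y) powr p \<le> (a + b) powr (p - 1) * (a powr (1 - p) * x powr p + b powr (1 - p) * y powr p)"
proof -
  have *: "z powr p \<le> (a + b) powr (p - 1) * (c powr (1 - p) * z powr p)" if c: "0 < c" "c \<le> a + b" for c z
  proof -
    have "c powr (p - 1) \<le> (a + b) powr (p - 1)" using c p by (intro powr_mono2) auto
    then have "c powr (p - 1) * (c powr (1 - p) * z powr p) \<le> (a + b) powr (p - 1) * (c powr (1 - p) * z powr p)"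
      by (rule mult_right_mono) simp
    moreover have "c powr (p - 1) * c powr (1 - p) = 1" using c by (simp flip: powr_add)
    ultimately show ?thesis by (simp flip: mult.assoc)
  qed
  consider "x = 0" | "y = 0" | "0 < x" "0 < y" using xy by linarith
  then show ?thesis
  proof cases
    case 1
    then show ?thesis using *[of b y] ab by simp
  next
    case 2
    then show ?thesis using *[of a x] ab by simp
  next
    case 3
    define s where "s = a + b"
    have s: "0 < s" "a = s - b" "b \<le> s" using ab by (auto simp: s_def)
    have "a / s = 1 - b / s" using s by (simp add: diff_divide_distrib)
    then have "(a / s * (x / a) + b / s * (y / b)) powr p \<le> a / s * (x / a) powr p + b / s * (y / b) powr p"
      using convex_onD[OF powr_convex[OF p], of "b / s" "x / a" "y / b"] ab s(1,3) 3 by simp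
    also have "a / s * (x / a) + b / s * (y / b) = (x + y) / s"
      using ab by (simp add: add_divide_distrib)
    finally have "s powr p * ((x + y) / s) powr p \<le> s powr p * (a / s * (x / a) powr p + b / s * (y / b) powr p)"
      by (rule mult_left_mono) simp
    moreover have "s powr p * ((x + y) / s) powr p = (x + y) powr p"
      using xy s(1) by (simp add: powr_divide)
    moreover have "s powr p * (c / s * (z / c) powr p) = s powr (p - 1) * (c powr (1 - p) * z powr p)"
      if "0 < c" "0 < z" for c z
      using that s(1) by (simp add: powr_divide powr_diff)
    ultimately show ?thesis
      using ab 3 by (simp only: distrib_left s_def)
  qed
qed

text \<open>Minkowski's inequality.  Dividing by the norms reduces it to the convexity of
  \<open>t \<mapsto> t\<^sup>p\<close>, integrated against the weights \<open>a / (a + b)\<close> and \<open>b / (a + b)\<close>; taking for \<open>a\<close> and \<open>b\<close>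
  positive upper bounds of the norms avoids division by zero.\<close>

lemma Lp_norm_triangle:
  fixes f g :: "'a \<Rightarrow> 'k::{real_normed_field, euclidean_space}"
  assumes p: "1 \<le> p" and f [measurable]: "f \<in> borel_measurable M"
    and g [measurable]: "g \<in> borel_measurable M"
  shows "Lp_norm M p (f + g) \<le> Lp_norm M p f + Lp_norm M p g"
proof (cases "Lp_norm M p f = \<top> \<or> Lp_norm M p g = \<top>")
  case True then show ?thesis by auto
next
  case False
  have key: "Lp_norm M p (f + g) \<le> ennreal (a + b)"
    if a: "0 < a" "Lp_norm M p f \<le> ennreal a" and b: "0 < b" "Lp_norm M p g \<le> ennreal b" for a b
  proof -
    let ?If = "\<integral>\<^sup>+\<omega>. ennreal (norm (f \<omega>) powr p) \<partial>M" and ?Ig = "\<integral>\<^sup>+\<omega>. ennreal (norm (g \<omega>) powr p) \<partial>M"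
    have If: "?If \<le> ennreal (a powr p)" and Ig: "?Ig \<le> ennreal (b powr p)"
      using a b p by (simp_all add: Lp_norm_le_iff epowr_ennreal)
    have "(\<integral>\<^sup>+\<omega>. ennreal (norm ((f + g) \<omega>) powr p) \<partial>M)
       \<le> (\<integral>\<^sup>+\<omega>. ennreal ((a + b) powr (p - 1)) * (ennreal (a powr (1 - p)) * ennreal (norm (f \<omega>) powr p)
             + ennreal (b powr (1 - p)) * ennreal (norm (g \<omega>) powr p)) \<partial>M)"
    proof (rule nn_integral_mono)
      fix \<omega>
      have "norm ((f + g) \<omega>) powr p \<le> (norm (f \<omega>) + norm (g \<omega>)) powr p"
        using p by (intro powr_mono2) (auto simp: norm_triangle_ineq)
      also have "\<dots> \<le> (a + b) powr (p - 1) * (a powr (1 - p) * norm (f \<omega>) powr p + b powr (1 - p) * norm (g \<omega>) powr p)"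
        using p a b by (intro powr_convex_combination) auto
      finally show "ennreal (norm ((f + g) \<omega>) powr p) \<le> ennreal ((a + b) powr (p - 1)) * (ennreal (a powr (1 - p)) * ennreal (norm (f \<omega>) powr p)
             + ennreal (b powr (1 - p)) * ennreal (norm (g \<omega>) powr p))"
        by (simp add: ennreal_mult[symmetric] ennreal_plus[symmetric] del: ennreal_plus)
    qed
    also have "\<dots> = ennreal ((a + b) powr (p - 1)) * (ennreal (a powr (1 - p)) * ?If + ennreal (b powr (1 - p)) * ?Ig)"
      by (simp add: nn_integral_cmult nn_integral_add)
    also have "\<dots> \<le> ennreal ((a + b) powr (p - 1)) * (ennreal (a powr (1 - p)) * ennreal (a powr p) + ennreal (b powr (1 - p)) * ennreal (b powr p))"
      by (intro mult_left_mono add_mono If Ig) auto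
    also have "\<dots> = ennreal ((a + b) powr p)"
    proof -
      have 1: "a powr (1 - p) * a powr p = a" "b powr (1 - p) * b powr p = b"
        using a b by (simp_all flip: powr_add)
      have "(a + b) powr (p - 1) * (a + b) powr 1 = (a + b) powr p"
        unfolding powr_add[symmetric] by simp
      then have 2: "(a + b) powr (p - 1) * (a + b) = (a + b) powr p" using a b by simp
      show ?thesis using a b
        by (simp only: ennreal_mult[symmetric] powr_ge_zero 1 2 ennreal_plus[symmetric] less_imp_le add_nonneg_nonneg)
    qed
    finally show ?thesis using p a b
      by (simp add: Lp_norm_le_iff epowr_ennreal del: ennreal_plus)
  qed
  obtain a b where ab: "Lp_norm M p f = ennreal a" "0 \<le> a" "Lp_norm M p g = ennreal b" "0 \<le> b"
    using False by (cases "Lp_norm M p f"; cases "Lp_norm M p g") auto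
  have *: "Lp_norm M p (f + g) \<le> Lp_norm M p f + Lp_norm M p g + ennreal e" if "0 < e" for e
  proof -
    have "Lp_norm M p (f + g) \<le> ennreal ((a + e / 2) + (b + e / 2))"
      using ab that by (intro key) auto
    also have "(a + e / 2) + (b + e / 2) = a + b + e" by simp
    also have "ennreal (a + b + e) = Lp_norm M p f + Lp_norm M p g + ennreal e" using ab that by simp
    finally show ?thesis .
  qed
  show ?thesis by (rule ennreal_le_epsilon) (rule *)
qed

lemma Lp_norm_triangle_diff:
  fixes f g h :: "'a \<Rightarrow> 'k::{real_normed_field, euclidean_space}"
  assumes "1 \<le> p" "f \<in> borel_measurable M" "g \<in> borel_measurable M" "h \<in> borel_measurable M"
  shows "Lp_norm M p (f - h) \<le> Lp_norm M p (f - g) + Lp_norm M p (g - h)"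
proof -
  have "f - h = (f - g) + (g - h)" by simp
  moreover have "Lp_norm M p ((f - g) + (g - h)) \<le> Lp_norm M p (f - g) + Lp_norm M p (g - h)"
    using assms by (intro Lp_norm_triangle) (auto simp: fun_diff_def)
  ultimately show ?thesis by simp
qed

lemma borel_measurable_fscale [measurable]:
  fixes f :: "'a \<Rightarrow> 'k::{real_normed_field, euclidean_space}"
  shows "f \<in> borel_measurable M \<Longrightarrow> fscale c f \<in> borel_measurable M"
  unfolding fscale_def by measurable

lemma borel_measurable_span:
  fixes B :: "('a \<Rightarrow> 'k::{real_normed_field, euclidean_space}) set"
  assumes "B \<subseteq> borel_measurable M" "f \<in> fun_space.span B"
  shows "f \<in> borel_measurable M"
  using assms(2)
proof (induction rule: fun_space.span_induct_alt)
  case base then show ?case by (simp add: zero_fun_def)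
next
  case (step c x y)
  then have "x \<in> borel_measurable M" using assms(1) by auto
  then show ?case using step by (simp add: plus_fun_def)
qed

lemma restrict_fun_measurable:
  fixes f :: "'a \<Rightarrow> 'k::{real_normed_field, euclidean_space}"
  shows "f \<in> borel_measurable M \<Longrightarrow> R \<in> sets M \<Longrightarrow> restrict_fun f R \<in> borel_measurable M"
  unfolding restrict_fun_def by (intro borel_measurable_times borel_measurable_indicator)

lemma Lp_norm_restrict_fun_partition:
  fixes f :: "'a \<Rightarrow> 'k::{real_normed_field, euclidean_space}"
  assumes p: "0 < p" and [measurable]: "f \<in> borel_measurable M" and Q: "finite Q" "Q \<subseteq> sets M" "disjoint Q"
  shows "(\<Sum>R\<in>Q. epowr (Lp_norm M p (restrict_fun f R)) p) = epowr (Lp_norm M p (restrict_fun f (\<Union>Q))) p"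
proof -
  have 1: "ennreal (norm (restrict_fun f R \<omega>) powr p) = ennreal (norm (f \<omega>) powr p) * indicator R \<omega>" for R \<omega>
    using p by (auto simp: restrict_fun_def split: split_indicator)
  have "(\<Sum>R\<in>Q. epowr (Lp_norm M p (restrict_fun f R)) p)
      = (\<Sum>R\<in>Q. \<integral>\<^sup>+\<omega>. ennreal (norm (f \<omega>) powr p) * indicator R \<omega> \<partial>M)"
    using p by (simp add: epowr_Lp_norm 1)
  also have "\<dots> = (\<integral>\<^sup>+\<omega>. (\<Sum>R\<in>Q. ennreal (norm (f \<omega>) powr p) * indicator R \<omega>) \<partial>M)"
    using Q by (intro nn_integral_sum[symmetric]) auto
  also have "\<dots> = (\<integral>\<^sup>+\<omega>. ennreal (norm (f \<omega>) powr p) * indicator (\<Union>Q) \<omega> \<partial>M)"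
  proof (intro nn_integral_cong)
    fix \<omega>
    have "(\<Sum>R\<in>Q. indicator R \<omega>) = (indicator (\<Union>Q) \<omega> :: ennreal)"
    proof (cases "\<omega> \<in> \<Union>Q")
      case True
      then obtain R0 where R0: "R0 \<in> Q" "\<omega> \<in> R0" by auto
      then have "(\<Sum>R\<in>Q. indicator R \<omega> :: ennreal) = (\<Sum>R\<in>Q. if R = R0 then 1 else 0)"
        using Q(3) by (intro sum.cong) (auto simp: disjoint_def split: split_indicator)
      also have "\<dots> = 1" using R0 Q(1) by simp
      finally show ?thesis using True by simp
    next
      case False
      then have "\<forall>R\<in>Q. indicator R \<omega> = (0::ennreal)" by (auto simp: indicator_def)
      then show ?thesis using False by simp
    qed
    then show "(\<Sum>R\<in>Q. ennreal (norm (f \<omega>) powr p) * indicator R \<omega>) = ennreal (norm (f \<omega>) powr p) * indicator (\<Union>Q) \<omega>"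
      by (simp add: sum_distrib_left[symmetric])
  qed
  also have "\<dots> = epowr (Lp_norm M p (restrict_fun f (\<Union>Q))) p"
    using p by (simp add: epowr_Lp_norm 1)
  finally show ?thesis .
qed

section \<open>Weighted sequence spaces and best approximation\<close>

lemma in_lq_top: "in_lq \<top> a \<longleftrightarrow> (\<exists>c<\<top>. \<forall>n. a n \<le> c)"
proof -
  have "(SUP n. a n) < \<top> \<longleftrightarrow> (\<exists>c<\<top>. \<forall>n. a n \<le> c)"
  proof
    assume *: "(SUP n. a n) < \<top>"
    show "\<exists>c<\<top>. \<forall>n. a n \<le> c"
      by (rule exI[of _ "SUP n. a n"], rule conjI[OF *], rule allI, rule SUP_upper, rule UNIV_I)
  next
    assume "\<exists>c<\<top>. \<forall>n. a n \<le> c"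
    then obtain c where c: "c < \<top>" "\<And>n. a n \<le> c" by blast
    have "(SUP n. a n) \<le> c" by (rule SUP_least, rule c(2))
    with c(1) show "(SUP n. a n) < \<top>" by (rule order.strict_trans1[rotated])
  qed
  then show ?thesis by (simp add: in_lq_def lq_norm_def)
qed

lemma in_lq_finite:
  assumes "0 < q" "q < \<top>"
  shows "in_lq q a \<longleftrightarrow> (\<Sum>n. epowr (a n) (enn2real q)) < \<top>"
proof -
  have "q \<noteq> \<top>" using assms by simp
  then show ?thesis by (simp add: in_lq_def lq_norm_def epowr_less_top_iff)
qed

lemma in_lq_mono:
  assumes q: "0 < q" and b: "in_lq q b" and c: "c < \<top>" and le: "\<And>n. a n \<le> c * b n"
  shows "in_lq q a"
proof (cases "q = \<top>")
  case True
  obtain d where d: "d < \<top>" "\<And>n. b n \<le> d" using b True by (auto simp: in_lq_top)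
  have "a n \<le> c * d" for n using le[of n] mult_left_mono[OF d(2)[of n], of c] by (rule order_trans) simp
  moreover have "c * d < \<top>" using c d by (simp add: ennreal_mult_less_top)
  ultimately show ?thesis using True by (auto simp: in_lq_top)
next
  case False
  define r where "r = enn2real q"
  have r: "0 < r" using q False by (simp add: r_def enn2real_positive_iff less_top)
  have fin: "0 < q" "q < \<top>" using q False by (auto simp: less_top)
  have "epowr (a n) r \<le> epowr (c * b n) r" for n
    by (rule epowr_mono[OF le less_imp_le[OF r]])
  then have "epowr (a n) r \<le> epowr c r * epowr (b n) r" for n
    by (simp only: epowr_mult[OF r])
  then have "(\<Sum>n. epowr (a n) r) \<le> (\<Sum>n. epowr c r * epowr (b n) r)"
    by (intro suminf_le) auto
  also have "\<dots> = epowr c r * (\<Sum>n. epowr (b n) r)" by simp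
  also have "\<dots> < \<top>" using b c in_lq_finite[OF fin, of b] unfolding r_def
    by (simp add: ennreal_mult_less_top epowr_less_top_iff)
  finally show ?thesis using in_lq_finite[OF fin, of a] unfolding r_def by simp
qed

lemma in_lq_case_nat:
  assumes q: "0 < q" and a: "in_lq q a" and x: "x < \<top>"
  shows "in_lq q (case_nat x a)"
proof (cases "q = \<top>")
  case True
  obtain d where d: "d < \<top>" "\<And>n. a n \<le> d" using a True by (auto simp: in_lq_top)
  have "case_nat x a n \<le> max x d" for n using d by (cases n) (auto simp: le_max_iff_disj)
  then show ?thesis using True x d by (auto simp: in_lq_top intro!: exI[of _ "max x d"])
next
  case False
  have fin: "0 < q" "q < \<top>" using q False by (auto simp: less_top)
  have "(\<Sum>n. epowr (case_nat x a n) (enn2real q)) = (\<Sum>n. epowr (a n) (enn2real q)) + epowr x (enn2real q)"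
    using suminf_offset[of "\<lambda>n. epowr (case_nat x a n) (enn2real q)" 1] by simp
  then show ?thesis
    using a x unfolding in_lq_finite[OF fin] by (simp add: epowr_less_top_iff)
qed

lemma lq_norm_ge:
  assumes "0 < q" shows "a n \<le> lq_norm q a"
proof (cases "q = \<top>")
  case True then show ?thesis by (simp add: lq_norm_def SUP_upper)
next
  case False
  define r where "r = enn2real q"
  have r: "0 < r" using assms False by (simp add: r_def enn2real_positive_iff less_top)
  have "epowr (a n) r \<le> (\<Sum>n. epowr (a n) r)"
    using sum_le_suminf[of "\<lambda>n. epowr (a n) r" "{n}"] by simp
  then have "epowr (epowr (a n) r) (1 / r) \<le> epowr (\<Sum>n. epowr (a n) r) (1 / r)"
    using r by (intro epowr_mono) auto
  then have "a n \<le> epowr (\<Sum>n. epowr (a n) r) (1 / r)"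
    by (simp only: epowr_inverse[OF r])
  then show ?thesis using False by (simp add: lq_norm_def r_def)
qed

lemma ennreal_geometric_suminf:
  assumes "0 \<le> x" "x < 1" shows "(\<Sum>n. ennreal (x ^ n)) < \<top>"
proof -
  have "(\<Sum>n. ennreal (x ^ n)) = ennreal (1 / (1 - x))"
    using assms by (intro suminf_ennreal_eq geometric_sums) simp_all
  then show ?thesis by simp
qed

text \<open>A geometrically weighted sequence has, for every exponent, a quasi-norm comparable with its
  supremum.  Giving up part of the geometric weight thus replaces every \<open>\<ell>\<^sup>q\<close> norm by a supremum,
  uniformly in \<open>n\<close>; the exponent \<open>q\<close> disappears.\<close>

lemma lq_norm_geometric_le:
  assumes q: "0 < q" and x: "0 < x" "x < 1"
  obtains C :: real where "0 \<le> C"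
    "\<And>n a s. (\<And>m. m < n \<Longrightarrow> a m \<le> ennreal (x ^ (n - m)) * s) \<Longrightarrow> (\<And>m. n \<le> m \<Longrightarrow> a m = 0) \<Longrightarrow>
      lq_norm q a \<le> ennreal C * s"
proof (cases "q = \<top>")
  case True
  have "lq_norm q a \<le> ennreal 1 * s"
    if a: "\<And>m. m < n \<Longrightarrow> a m \<le> ennreal (x ^ (n - m)) * s" "\<And>m. n \<le> m \<Longrightarrow> a m = 0" for n a s
  proof -
    have "a m \<le> s" for m
    proof (cases "m < n")
      case True
      have "ennreal (x ^ (n - m)) * s \<le> 1 * s"
        using x by (intro mult_right_mono) (simp_all add: power_le_one)
      with a(1)[OF True] show ?thesis by simp
    next
      case False
      then show ?thesis using a(2)[of m] by simp
    qed
    then have "(SUP n. a n) \<le> s" by (rule SUP_least)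
    then show ?thesis using True by (simp add: lq_norm_def)
  qed
  with that[of 1] show thesis by (meson zero_le_one)
next
  case False
  define r where "r = enn2real q"
  have r: "0 < r" using assms False by (simp add: r_def enn2real_positive_iff less_top)
  define z where "z = x powr r"
  have z: "0 \<le> z" "z < 1" using r x by (auto simp: z_def powr01_less_one)
  define K where "K = (\<Sum>n. ennreal (z ^ n))"
  have K: "K < \<top>" unfolding K_def by (rule ennreal_geometric_suminf[OF z])
  have "lq_norm q a \<le> epowr K (1 / r) * s"
    if a: "\<And>m. m < n \<Longrightarrow> a m \<le> ennreal (x ^ (n - m)) * s" "\<And>m. n \<le> m \<Longrightarrow> a m = 0" for n a s
  proof -
    have pw: "epowr (ennreal (x ^ i)) r = ennreal (z ^ i)" for i
      using x by (simp add: epowr_ennreal z_def powr_realpow[symmetric] powr_powr mult.commute)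
    have "(\<Sum>m. epowr (a m) r) = (\<Sum>m<n. epowr (a m) r)"
    proof (rule suminf_finite)
      fix m assume "m \<notin> {..<n}"
      then have "a m = 0" using a(2)[of m] by simp
      then show "epowr (a m) r = 0" by simp
    qed simp
    also have "\<dots> \<le> (\<Sum>m<n. ennreal (z ^ (n - m)) * epowr s r)"
    proof (rule sum_mono)
      fix m assume "m \<in> {..<n}"
      then have "epowr (a m) r \<le> epowr (ennreal (x ^ (n - m)) * s) r"
        using a(1)[of m] r by (intro epowr_mono) simp_all
      then show "epowr (a m) r \<le> ennreal (z ^ (n - m)) * epowr s r"
        using r by (simp add: epowr_mult pw)
    qed
    also have "\<dots> = (\<Sum>m<n. ennreal (z ^ (n - m))) * epowr s r"
      by (simp add: sum_distrib_right)
    also have "(\<Sum>m<n. ennreal (z ^ (n - m))) = (\<Sum>i\<in>{1..n}. ennreal (z ^ i))"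
      by (rule sum.reindex_bij_witness[of _ "\<lambda>i. n - i" "\<lambda>i. n - i"]) auto
    also have "\<dots> \<le> K" unfolding K_def by (intro sum_le_suminf) auto
    finally have "(\<Sum>m. epowr (a m) r) \<le> K * epowr s r" by (meson mult_right_mono order_trans zero_le)
    then have "epowr (\<Sum>m. epowr (a m) r) (1 / r) \<le> epowr (K * epowr s r) (1 / r)"
      using r by (intro epowr_mono) auto
    also have "\<dots> = epowr K (1 / r) * s" using r by (simp add: epowr_mult epowr_inverse)
    finally show ?thesis using False by (simp add: lq_norm_def r_def)
  qed
  moreover have "epowr K (1 / r) = ennreal (enn2real (epowr K (1 / r)))"
    using K by (simp add: epowr_less_top_iff)
  ultimately show thesis using that[of "enn2real (epowr K (1 / r))"] by (metis enn2real_nonneg)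
qed

lemma geometric_average_sum_le:
  fixes x y :: "nat \<Rightarrow> ennreal" and t :: real
  assumes t: "0 \<le> t" "t < 1"
    and y0: "y 0 \<le> x 0" and y: "\<And>n. y (Suc n) \<le> x (Suc n) + ennreal t * y n"
  shows "(\<Sum>n. y n) \<le> ennreal (1 / (1 - t)) * (\<Sum>n. x n)"
proof -
  define c where "c = 1 / (1 - t)"
  have c: "0 \<le> c" "1 + c * t = c" using t by (auto simp: c_def field_simps)
  have c': "1 + ennreal c * ennreal t = ennreal c"
    using c t by (simp add: ennreal_mult[symmetric] flip: ennreal_1 ennreal_plus)
  \<comment> \<open>The extra term \<open>c t y\<^sub>N\<close> is the sum of the geometric tail that \<open>y\<^sub>N\<close> would still produce.\<close>
  have *: "(\<Sum>n\<le>N. y n) + ennreal c * ennreal t * y N \<le> ennreal c * (\<Sum>n\<le>N. x n)" for N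
  proof (induction N)
    case 0
    have "y 0 + ennreal c * ennreal t * y 0 = ennreal c * y 0"
      by (subst c'[symmetric]) (simp add: distrib_right)
    then show ?case using y0 by (simp add: mult_left_mono)
  next
    case (Suc N)
    have "(\<Sum>n\<le>Suc N. y n) + ennreal c * ennreal t * y (Suc N)
       = (\<Sum>n\<le>N. y n) + (1 + ennreal c * ennreal t) * y (Suc N)"
      by (simp add: distrib_right add.assoc)
    also have "\<dots> \<le> (\<Sum>n\<le>N. y n) + ennreal c * (x (Suc N) + ennreal t * y N)"
      unfolding c' by (intro add_left_mono mult_left_mono y) auto
    also have "\<dots> = ((\<Sum>n\<le>N. y n) + ennreal c * ennreal t * y N) + ennreal c * x (Suc N)"
      by (simp add: distrib_left mult.assoc add_ac)
    also have "\<dots> \<le> ennreal c * (\<Sum>n\<le>N. x n) + ennreal c * x (Suc N)"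
      by (intro add_right_mono Suc)
    finally show ?case by (simp add: distrib_left)
  qed
  show ?thesis
  proof (rule suminf_le_const)
    fix N
    have "(\<Sum>n<N. y n) \<le> (\<Sum>n\<le>N. y n)" by (intro sum_mono2) auto
    also have "\<dots> \<le> (\<Sum>n\<le>N. y n) + ennreal c * ennreal t * y N" by simp
    also have "\<dots> \<le> ennreal c * (\<Sum>n\<le>N. x n)" by (rule *)
    also have "\<dots> \<le> ennreal c * (\<Sum>n. x n)" by (intro mult_left_mono sum_le_suminf) auto
    finally show "(\<Sum>n<N. y n) \<le> ennreal (1 / (1 - t)) * (\<Sum>n. x n)" by (simp add: c_def)
  qed auto
qed

definition geometric_max :: "real \<Rightarrow> (nat \<Rightarrow> ennreal) \<Rightarrow> nat \<Rightarrow> ennreal" where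
  "geometric_max x a n = (SUP j\<in>{..n}. ennreal (x ^ (n - j)) * a j)"

lemma geometric_max_ge: "j \<le> n \<Longrightarrow> ennreal (x ^ (n - j)) * a j \<le> geometric_max x a n"
  unfolding geometric_max_def by (intro SUP_upper) auto

lemma geometric_max_Suc:
  assumes "0 \<le> x"
  shows "geometric_max x a (Suc n) \<le> max (a (Suc n)) (ennreal x * geometric_max x a n)"
  unfolding geometric_max_def[of _ _ "Suc n"]
proof (rule SUP_least)
  fix j assume "j \<in> {..Suc n}"
  then consider "j = Suc n" | "j \<le> n" by (auto simp: le_Suc_eq)
  then show "ennreal (x ^ (Suc n - j)) * a j \<le> max (a (Suc n)) (ennreal x * geometric_max x a n)"
  proof cases
    case 2
    have "ennreal (x ^ (Suc n - j)) * a j = ennreal x * (ennreal (x ^ (n - j)) * a j)"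
      using 2 assms by (simp add: Suc_diff_le ennreal_mult mult.assoc)
    then show ?thesis using geometric_max_ge[OF 2, of x a]
      by (simp add: max.coboundedI2 mult_left_mono)
  qed simp
qed

lemma geometric_max_less_top:
  assumes "\<And>n. a n < \<top>" shows "geometric_max x a n < \<top>"
proof -
  have "(SUP j\<in>{..n}. ennreal (x ^ (n - j)) * a j) \<in> (\<lambda>j. ennreal (x ^ (n - j)) * a j) ` {..n}"
    using Max_in[of "(\<lambda>j. ennreal (x ^ (n - j)) * a j) ` {..n}"]
    by (subst Max_Sup[symmetric]) auto
  then show ?thesis using assms unfolding geometric_max_def
    by (auto simp: ennreal_mult_less_top)
qed

text \<open>This replaces the discrete Hardy inequality: \<open>geometric_max\<close> obeys a one-step recursion
  \<open>s\<^sub>n\<^sub>+\<^sub>1 \<le> max a\<^sub>n\<^sub>+\<^sub>1 (x s\<^sub>n)\<close>, whose \<open>q\<close>-th powers sum up to a multiple of the \<open>q\<close>-th powers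
  of \<open>a\<close>, for every exponent \<open>q\<close> alike.\<close>

lemma in_lq_geometric_max:
  assumes q: "0 < q" and a: "in_lq q a" and x: "0 < x" "x < 1"
  shows "in_lq q (geometric_max x a)"
proof (cases "q = \<top>")
  case True
  obtain d where d: "d < \<top>" "\<And>n. a n \<le> d" using a True by (auto simp: in_lq_top)
  have "geometric_max x a n \<le> d" for n
    unfolding geometric_max_def
  proof (rule SUP_least)
    fix j
    have "ennreal (x ^ (n - j)) * a j \<le> 1 * d"
      using x d by (intro mult_mono) (auto simp: power_le_one)
    then show "ennreal (x ^ (n - j)) * a j \<le> d" by simp
  qed
  then show ?thesis using True d by (auto simp: in_lq_top)
next
  case False
  have fin: "0 < q" "q < \<top>" using q False by (auto simp: less_top)
  define r where "r = enn2real q"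
  have r: "0 < r" using assms False by (simp add: r_def enn2real_positive_iff less_top)
  define t where "t = x powr r"
  have t: "0 \<le> t" "t < 1" using r x by (auto simp: t_def powr01_less_one)
  have "(\<Sum>n. epowr (geometric_max x a n) r) \<le> ennreal (1 / (1 - t)) * (\<Sum>n. epowr (a n) r)"
  proof (rule geometric_average_sum_le[OF t])
    show "epowr (geometric_max x a 0) r \<le> epowr (a 0) r" by (simp add: geometric_max_def)
    fix n
    have "epowr (geometric_max x a (Suc n)) r \<le> epowr (max (a (Suc n)) (ennreal x * geometric_max x a n)) r"
      using x r by (intro epowr_mono geometric_max_Suc) auto
    also have "\<dots> \<le> epowr (a (Suc n)) r + epowr (ennreal x * geometric_max x a n) r"
      by (auto simp: max_def)
    also have "epowr (ennreal x * geometric_max x a n) r = ennreal t * epowr (geometric_max x a n) r"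
      using x r by (simp add: epowr_mult epowr_ennreal t_def)
    finally show "epowr (geometric_max x a (Suc n)) r \<le> epowr (a (Suc n)) r + ennreal t * epowr (geometric_max x a n) r" .
  qed
  also have "\<dots> < \<top>" using a unfolding in_lq_finite[OF fin] r_def
    by (simp add: ennreal_mult_less_top)
  finally show ?thesis unfolding in_lq_finite[OF fin] r_def .
qed

lemma Sigma_nE:
  assumes "x \<in> Sigma_n D n"
  obtains T where "T \<subseteq> D" "finite T" "card T \<le> n" "x \<in> fun_space.span T"
  using assms unfolding Sigma_n_def by auto

lemma Sigma_nI: "T \<subseteq> D \<Longrightarrow> finite T \<Longrightarrow> card T \<le> n \<Longrightarrow> x \<in> fun_space.span T \<Longrightarrow> x \<in> Sigma_n D n"
  unfolding Sigma_n_def by auto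

lemma Sigma_n_zero: "0 \<in> Sigma_n D n"
  by (rule Sigma_nI[of "{}"]) auto

lemma Sigma_n_base: "x \<in> D \<Longrightarrow> x \<in> Sigma_n D 1"
  by (rule Sigma_nI[of "{x}"]) (auto intro: fun_space.span_base)

lemma Sigma_n_mono: "x \<in> Sigma_n D m \<Longrightarrow> m \<le> n \<Longrightarrow> x \<in> Sigma_n D n"
  by (auto simp: Sigma_n_def)

lemma Sigma_n_scale: "x \<in> Sigma_n D n \<Longrightarrow> fscale c x \<in> Sigma_n D n"
  by (auto simp: Sigma_n_def fun_space.span_scale)

lemma Sigma_n_add:
  assumes "x \<in> Sigma_n D m" "y \<in> Sigma_n D n" shows "x + y \<in> Sigma_n D (m + n)"
proof -
  obtain T U where T: "T \<subseteq> D" "finite T" "card T \<le> m" "x \<in> fun_space.span T"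
    and U: "U \<subseteq> D" "finite U" "card U \<le> n" "y \<in> fun_space.span U"
    using assms by (auto elim!: Sigma_nE)
  have "x + y \<in> fun_space.span (T \<union> U)"
    using T(4) U(4) fun_space.span_mono[of T "T \<union> U"] fun_space.span_mono[of U "T \<union> U"]
    by (auto intro!: fun_space.span_add)
  then show ?thesis using T U card_Un_le[of T U]
    by (intro Sigma_nI[of "T \<union> U"]) auto
qed

lemma Sigma_n_diff:
  assumes "x \<in> Sigma_n D m" "y \<in> Sigma_n D n" shows "x - y \<in> Sigma_n D (m + n)"
  using Sigma_n_add[OF assms(1) Sigma_n_scale[OF assms(2), of "-1"]]
  by (simp add: fun_space.scale_minus_left)

lemma Sigma_n_sum:
  assumes "finite I" "\<And>i. i \<in> I \<Longrightarrow> x i \<in> Sigma_n D (k i)"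
  shows "(\<Sum>i\<in>I. x i) \<in> Sigma_n D (\<Sum>i\<in>I. k i)"
  using assms by (induction I rule: finite_induct) (auto simp: Sigma_n_zero intro: Sigma_n_add)

lemma Sigma_n_measurable:
  fixes D :: "('a \<Rightarrow> 'k::{real_normed_field, euclidean_space}) set"
  shows "D \<subseteq> borel_measurable M \<Longrightarrow> x \<in> Sigma_n D n \<Longrightarrow> x \<in> borel_measurable M"
  by (auto elim!: Sigma_nE intro: borel_measurable_span)

lemma sigma_n_le: "g \<in> Sigma_n D n \<Longrightarrow> sigma_n M p D n f \<le> Lp_norm M p (f - g)"
  unfolding sigma_n_def by (rule INF_lower)

lemma sigma_n_le_norm: "sigma_n M p D n f \<le> Lp_norm M p f"
  using sigma_n_le[OF Sigma_n_zero, of M p D n f] by simp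

lemma sigma_n_eq_0: "g \<in> Sigma_n D n \<Longrightarrow> sigma_n M p D n g = 0"
  using sigma_n_le[of g D n M p g] by simp

lemma sigma_n_antimono: "m \<le> n \<Longrightarrow> sigma_n M p D n f \<le> sigma_n M p D m f"
  unfolding sigma_n_def by (rule INF_superset_mono) (auto intro: Sigma_n_mono)

text \<open>An \<open>n\<close>-term sum \<open>y0\<close> may be subtracted at the price of \<open>n\<close> terms, also through a different
  representative \<open>y\<close> of the same class.\<close>

lemma sigma_n_perturb:
  fixes f g y y0 :: "'a \<Rightarrow> 'k::{real_normed_field, euclidean_space}"
  assumes p: "1 \<le> p" and D: "D \<subseteq> borel_measurable M"
    and meas: "f \<in> borel_measurable M" "g \<in> borel_measurable M" "y \<in> borel_measurable M"
    and y0: "y0 \<in> Sigma_n D n" "AE \<omega> in M. y0 \<omega> = y \<omega>"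
  shows "sigma_n M p D (m + n) f \<le> Lp_norm M p (f - g) + sigma_n M p D m (g - y)"
proof -
  have *: "sigma_n M p D (m + n) f \<le> Lp_norm M p (f - g) + Lp_norm M p ((g - y) - z)"
    if z: "z \<in> Sigma_n D m" for z
  proof -
    have zm: "z \<in> borel_measurable M" "y0 \<in> borel_measurable M"
      using Sigma_n_measurable[OF D] z y0 by blast+
    have "sigma_n M p D (m + n) f \<le> Lp_norm M p (f - (z + y0))"
      by (intro sigma_n_le Sigma_n_add z y0)
    also have "\<dots> \<le> Lp_norm M p (f - g) + Lp_norm M p (g - (z + y0))"
      using p meas zm by (intro Lp_norm_triangle_diff) (auto simp: plus_fun_def)
    also have "Lp_norm M p (g - (z + y0)) = Lp_norm M p ((g - y) - z)"
    proof (rule Lp_norm_cong_AE)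
      show "AE \<omega> in M. norm ((g - (z + y0)) \<omega>) = norm ((g - y - z) \<omega>)"
        using y0(2) by eventually_elim (simp add: algebra_simps)
    qed (use p in auto)
    finally show ?thesis .
  qed
  show ?thesis
  proof (rule ennreal_le_epsilon)
    fix \<epsilon> :: real
    assume fin: "Lp_norm M p (f - g) + sigma_n M p D m (g - y) < \<top>" and "0 < \<epsilon>"
    then have "sigma_n M p D m (g - y) < sigma_n M p D m (g - y) + ennreal \<epsilon>"
      by (cases "sigma_n M p D m (g - y)") (simp_all add: ennreal_less_iff flip: ennreal_plus)
    then obtain z where z: "z \<in> Sigma_n D m" "Lp_norm M p ((g - y) - z) < sigma_n M p D m (g - y) + ennreal \<epsilon>"
      unfolding sigma_n_def INF_less_iff by auto
    then show "sigma_n M p D (m + n) f \<le> Lp_norm M p (f - g) + sigma_n M p D m (g - y) + ennreal \<epsilon>"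
      using order_trans[OF *[OF z(1)] add_left_mono[OF less_imp_le[OF z(2)]]] by (simp add: add.assoc)
  qed
qed

lemma sigma_n_triangle:
  fixes f g :: "'a \<Rightarrow> 'k::{real_normed_field, euclidean_space}"
  assumes "1 \<le> p" "D \<subseteq> borel_measurable M" "f \<in> borel_measurable M" "g \<in> borel_measurable M"
  shows "sigma_n M p D n f \<le> Lp_norm M p (f - g) + sigma_n M p D n g"
proof -
  have "sigma_n M p D (n + 0) f \<le> Lp_norm M p (f - g) + sigma_n M p D n (g - 0)"
    using assms by (intro sigma_n_perturb[where ?y0.0 = 0] Sigma_n_zero) (simp_all, simp add: zero_fun_def)
  then show ?thesis by simp
qed

section \<open>Conjugation and orthogonal projection in L^2\<close>

text \<open>A commutative field with a multiplicative Euclidean norm is a composition algebra, hence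
  quadratic over the reals: \<open>x\<^sup>2 - 2\<langle>x,1\<rangle> x + \<bar>x\<bar>\<^sup>2 = 0\<close>.  The identity
  follows by polarizing \<open>\<bar>x y\<bar> = \<bar>x\<bar> \<bar>y\<bar>\<close>.  It shows that \<open>sconj x = 2\<langle>x,1\<rangle> - x\<close>, which makes
  \<open>sconj\<close> additive and \<open>L2_inner\<close> a sesquilinear form.\<close>

lemma inner_mult_mult:
  fixes x y z :: "'k::{real_normed_field, euclidean_space}"
  shows "inner (x * y) (x * z) = (norm x)\<^sup>2 * inner y z"
proof -
  have "inner (x * y) (x * z) = ((norm (x * (y + z)))\<^sup>2 - (norm (x * y))\<^sup>2 - (norm (x * z))\<^sup>2) / 2"
    by (simp only: dot_norm distrib_left)
  also have "\<dots> = (norm x)\<^sup>2 * (((norm (y + z))\<^sup>2 - (norm y)\<^sup>2 - (norm z)\<^sup>2) / 2)"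
    by (simp add: norm_mult power_mult_distrib right_diff_distrib)
  finally show ?thesis by (simp only: dot_norm)
qed

lemma inner_square:
  fixes x y :: "'k::{real_normed_field, euclidean_space}"
  shows "inner (x * x) y = 2 * inner x 1 * inner x y - (norm x)\<^sup>2 * inner 1 y"
proof -
  have n: "(norm (x + 1))\<^sup>2 = (norm x)\<^sup>2 + 2 * inner x 1 + 1"
    by (simp add: power2_norm_eq_inner inner_add_left inner_add_right inner_commute)
       (simp add: norm_eq_1[symmetric])
  have "inner ((x + 1) * x) ((x + 1) * y) = (norm (x + 1))\<^sup>2 * inner x y"
    by (rule inner_mult_mult)
  moreover have "inner ((x + 1) * x) ((x + 1) * y) = inner (x * x) (x * y) + inner (x * x) y + inner (x * 1) (x * y) + inner x y"
    by (simp add: distrib_right inner_add_left inner_add_right)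
  moreover have "inner (x * x) (x * y) = (norm x)\<^sup>2 * inner x y" "inner (x * 1) (x * y) = (norm x)\<^sup>2 * inner 1 y"
    by (rule inner_mult_mult)+
  ultimately show ?thesis unfolding n by (simp add: algebra_simps)
qed

lemma sconj_eq_inner:
  fixes x :: "'k::{real_normed_field, euclidean_space}"
  shows "sconj x = of_real (2 * inner x 1) - x"
proof (cases "x = 0")
  case False
  have "inner y (x * x) = inner y ((2 * inner x 1) *\<^sub>R x - (norm x)\<^sup>2 *\<^sub>R 1)" for y
    using inner_square[of x y] by (simp add: inner_diff_right inner_commute mult.assoc)
  then have "x * x = (2 * inner x 1) *\<^sub>R x - (norm x)\<^sup>2 *\<^sub>R 1"
    using vector_eq_ldot[of "x * x"] by blast
  then have "of_real ((norm x)\<^sup>2) = (of_real (2 * inner x 1) - x) * x"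
    by (simp add: scaleR_conv_of_real left_diff_distrib)
  then show ?thesis using False by (simp add: sconj_def)
qed (simp add: sconj_def)

lemma sconj_add:
  fixes x y :: "'k::{real_normed_field, euclidean_space}"
  shows "sconj (x + y) = sconj x + sconj y"
  by (simp add: sconj_eq_inner inner_add_left)

lemma sconj_mult: "sconj (x * y) = sconj x * sconj y"
  by (simp add: sconj_def norm_mult power_mult_distrib)

lemma norm_sconj: "norm (sconj x) = norm x"
  by (simp add: sconj_def norm_divide power2_eq_square norm_mult)

lemma mult_sconj: "x * sconj x = of_real ((norm x)\<^sup>2)"
  by (simp add: sconj_def)

lemma borel_measurable_sconj [measurable]:
  fixes f :: "'a \<Rightarrow> 'k::{real_normed_field, euclidean_space}"
  shows "f \<in> borel_measurable M \<Longrightarrow> (\<lambda>\<omega>. sconj (f \<omega>)) \<in> borel_measurable M"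
  unfolding sconj_eq_inner
  by (rule borel_measurable_continuous_on[where f = "\<lambda>x. of_real (2 * inner x 1) - x"])
     (auto intro!: continuous_intros)

lemma Lp_D: "f \<in> Lp M p \<Longrightarrow> f \<in> borel_measurable M" "f \<in> Lp M p \<Longrightarrow> Lp_norm M p f < \<top>"
  by (auto simp: Lp_def)

lemma Lp_add:
  fixes f g :: "'a \<Rightarrow> 'k::{real_normed_field, euclidean_space}"
  assumes "1 \<le> p" "f \<in> Lp M p" "g \<in> Lp M p" shows "f + g \<in> Lp M p"
proof -
  have "Lp_norm M p (f + g) \<le> Lp_norm M p f + Lp_norm M p g"
    using assms by (intro Lp_norm_triangle) (auto simp: Lp_def)
  also have "\<dots> < \<top>" using assms by (simp add: Lp_def)
  finally show ?thesis
    using borel_measurable_add[of f M g] Lp_D(1)[OF assms(2)] Lp_D(1)[OF assms(3)]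
    unfolding Lp_def plus_fun_def by simp
qed

lemma Lp_fscale:
  fixes f :: "'a \<Rightarrow> 'k::{real_normed_field, euclidean_space}"
  assumes "0 < p" "f \<in> Lp M p" shows "fscale c f \<in> Lp M p"
  using assms by (simp add: Lp_def Lp_norm_fscale ennreal_mult_less_top borel_measurable_fscale)

lemma Lp_diff:
  fixes f g :: "'a \<Rightarrow> 'k::{real_normed_field, euclidean_space}"
  assumes "1 \<le> p" "f \<in> Lp M p" "g \<in> Lp M p" shows "f - g \<in> Lp M p"
proof -
  have "f - g = f + fscale (-1) g" by (simp add: fun_eq_iff fscale_def)
  then show ?thesis using assms by (simp only: Lp_add Lp_fscale)
qed

lemma Lp_zero: "0 \<in> Lp M p"
  by (simp add: Lp_def zero_fun_def[symmetric]) (simp add: zero_fun_def)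

lemma Lp_span:
  fixes B :: "('a \<Rightarrow> 'k::{real_normed_field, euclidean_space}) set"
  assumes "1 \<le> p" "B \<subseteq> Lp M p" "f \<in> fun_space.span B" shows "f \<in> Lp M p"
  using assms(3)
proof (induction rule: fun_space.span_induct_alt)
  case base then show ?case by (rule Lp_zero)
next
  case (step c x y)
  then have "x \<in> Lp M p" using assms by auto
  then show ?case using step assms(1) by (intro Lp_add Lp_fscale) auto
qed

lemma integrable_norm_power2:
  fixes f :: "'a \<Rightarrow> 'k::{real_normed_field, euclidean_space}"
  assumes "f \<in> Lp M 2" shows "integrable M (\<lambda>\<omega>. (norm (f \<omega>))\<^sup>2)"
proof (rule integrableI_bounded)
  show "(\<lambda>\<omega>. (norm (f \<omega>))\<^sup>2) \<in> borel_measurable M"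
    using Lp_D(1)[OF assms] by measurable
  have "(\<integral>\<^sup>+\<omega>. ennreal (norm ((norm (f \<omega>))\<^sup>2)) \<partial>M) = (\<integral>\<^sup>+\<omega>. ennreal (norm (f \<omega>) powr 2) \<partial>M)"
    by (intro nn_integral_cong) simp
  also have "\<dots> = epowr (Lp_norm M 2 f) 2" by (simp add: epowr_Lp_norm)
  finally show "(\<integral>\<^sup>+\<omega>. ennreal (norm ((norm (f \<omega>))\<^sup>2)) \<partial>M) < \<infinity>"
    using assms by (simp add: Lp_def epowr_less_top_iff)
qed

lemma integrable_L2_inner:
  fixes f g :: "'a \<Rightarrow> 'k::{real_normed_field, euclidean_space}"
  assumes f: "f \<in> Lp M 2" and g: "g \<in> Lp M 2"
  shows "integrable M (\<lambda>\<omega>. f \<omega> * sconj (g \<omega>))"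
proof (rule Bochner_Integration.integrable_bound)
  show "integrable M (\<lambda>\<omega>. (norm (f \<omega>))\<^sup>2 + (norm (g \<omega>))\<^sup>2)"
    using f g by (intro Bochner_Integration.integrable_add integrable_norm_power2)
  show "(\<lambda>\<omega>. f \<omega> * sconj (g \<omega>)) \<in> borel_measurable M"
    using Lp_D(1)[OF f] Lp_D(1)[OF g] by measurable
  show "AE \<omega> in M. norm (f \<omega> * sconj (g \<omega>)) \<le> norm ((norm (f \<omega>))\<^sup>2 + (norm (g \<omega>))\<^sup>2)"
  proof (rule AE_I2)
    fix \<omega>
    have "norm (f \<omega>) * norm (g \<omega>) \<le> 2 * (norm (f \<omega>) * norm (g \<omega>))" by simp
    also have "\<dots> \<le> (norm (f \<omega>))\<^sup>2 + (norm (g \<omega>))\<^sup>2"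
      using sum_squares_bound[of "norm (f \<omega>)" "norm (g \<omega>)"] by (simp add: mult.assoc)
    finally show "norm (f \<omega> * sconj (g \<omega>)) \<le> norm ((norm (f \<omega>))\<^sup>2 + (norm (g \<omega>))\<^sup>2)"
      by (simp add: norm_mult norm_sconj)
  qed
qed

lemma L2_inner_add_left:
  fixes f g h :: "'a \<Rightarrow> 'k::{real_normed_field, euclidean_space}"
  assumes "f \<in> Lp M 2" "g \<in> Lp M 2" "h \<in> Lp M 2"
  shows "L2_inner M (f + g) h = L2_inner M f h + L2_inner M g h"
  unfolding L2_inner_def using assms
  by (simp add: distrib_right Bochner_Integration.integral_add integrable_L2_inner)

lemma L2_inner_add_right:
  fixes f g h :: "'a \<Rightarrow> 'k::{real_normed_field, euclidean_space}"
  assumes "f \<in> Lp M 2" "g \<in> Lp M 2" "h \<in> Lp M 2"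
  shows "L2_inner M h (f + g) = L2_inner M h f + L2_inner M h g"
  unfolding L2_inner_def using assms
  by (simp add: sconj_add distrib_left Bochner_Integration.integral_add integrable_L2_inner)

lemma L2_inner_fscale_left:
  fixes f h :: "'a \<Rightarrow> 'k::{real_normed_field, euclidean_space}"
  shows "L2_inner M (fscale c f) h = c * L2_inner M f h"
  unfolding L2_inner_def fscale_def by (simp add: mult.assoc)

lemma L2_inner_fscale_right:
  fixes f h :: "'a \<Rightarrow> 'k::{real_normed_field, euclidean_space}"
  shows "L2_inner M h (fscale c f) = sconj c * L2_inner M h f"
  unfolding L2_inner_def fscale_def by (simp add: sconj_mult mult.left_commute)

lemma L2_inner_self_eq_0:
  fixes f h :: "'a \<Rightarrow> 'k::{real_normed_field, euclidean_space}"
  assumes f: "f \<in> Lp M 2" and 0: "L2_inner M f f = 0"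
  shows "L2_inner M h f = 0"
proof -
  have "L2_inner M f f = of_real (LINT \<omega>|M. (norm (f \<omega>))\<^sup>2)"
    unfolding L2_inner_def mult_sconj by (rule integral_of_real) (rule integrable_norm_power2[OF f])
  then have "(LINT \<omega>|M. (norm (f \<omega>))\<^sup>2) = 0" using 0 by simp
  then have "AE \<omega> in M. (norm (f \<omega>))\<^sup>2 = 0"
    using integral_nonneg_eq_0_iff_AE[OF integrable_norm_power2[OF f]] by simp
  then have "AE \<omega> in M. h \<omega> * sconj (f \<omega>) = 0" by eventually_elim (simp add: sconj_def)
  then show ?thesis unfolding L2_inner_def by (rule integral_eq_zero_AE)
qed

lemma L2_inner_span_right_eq_0:
  fixes B :: "('a \<Rightarrow> 'k::{real_normed_field, euclidean_space}) set"
  assumes "B \<subseteq> Lp M 2" "u \<in> Lp M 2" "\<And>b. b \<in> B \<Longrightarrow> L2_inner M u b = 0" "h \<in> fun_space.span B"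
  shows "L2_inner M u h = 0"
proof -
  have "h \<in> fun_space.span B \<and> L2_inner M u h = 0"
    using assms(4)
  proof (induction rule: fun_space.span_induct_alt)
  case base
  have "L2_inner M u 0 = 0" by (simp add: L2_inner_def sconj_def)
  then show ?case using fun_space.span_zero[of B] by blast
next
  case (step c x y)
  have "y \<in> Lp M 2"
    using step(2) fun_space.span_superset[of B] by (intro Lp_span[OF _ assms(1)]) simp_all
  moreover have "x \<in> Lp M 2" using step assms by auto
  ultimately have "L2_inner M u (fscale c x + y) = 0" using step assms(2,3)
    by (simp add: L2_inner_add_right Lp_fscale L2_inner_fscale_right)
  moreover have "fscale c x + y \<in> fun_space.span B" using step
    by (intro fun_space.span_add fun_space.span_scale fun_space.span_base[of x]) auto
  ultimately show ?case by blast
  qed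
  then show ?thesis ..
qed

text \<open>Gram--Schmidt: a new vector \<open>b\<close> is first made orthogonal to the old ones.  If the
  remainder \<open>b0\<close> has norm zero, everything is orthogonal to it and the old projection serves.\<close>

lemma orthogonal_projection_exists:
  fixes B :: "('a \<Rightarrow> 'k::{real_normed_field, euclidean_space}) set"
  assumes "finite B" "B \<subseteq> Lp M 2" "f \<in> Lp M 2"
  shows "\<exists>g\<in>fun_space.span B. \<forall>h\<in>fun_space.span B. L2_inner M (f - g) h = 0"
  using assms
proof (induction B arbitrary: f rule: finite_induct)
  case empty
  then show ?case by (simp add: L2_inner_def sconj_def)
next
  case (insert b B)
  note f = insert.prems(2)
  have B: "B \<subseteq> Lp M 2" and b: "b \<in> Lp M 2" using insert.prems by auto
  obtain g where g: "g \<in> fun_space.span B" "\<And>h. h \<in> fun_space.span B \<Longrightarrow> L2_inner M (f - g) h = 0"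
    using insert.IH[OF B f] by blast
  obtain g' where g': "g' \<in> fun_space.span B" "\<And>h. h \<in> fun_space.span B \<Longrightarrow> L2_inner M (b - g') h = 0"
    using insert.IH[OF B b] by blast
  define b0 where "b0 = b - g'"
  have L: "g \<in> Lp M 2" "g' \<in> Lp M 2" using g g' Lp_span[of 2 B M] B by auto
  have b0: "b0 \<in> Lp M 2" unfolding b0_def using b L by (intro Lp_diff) auto
  have fg: "f - g \<in> Lp M 2" using f L by (intro Lp_diff) auto
  define c where "c = (if L2_inner M b0 b0 = 0 then 0 else L2_inner M (f - g) b0 / L2_inner M b0 b0)"
  define u where "u = g + fscale c b0"
  have sub: "fun_space.span B \<subseteq> fun_space.span (insert b B)"
    by (rule fun_space.span_mono) auto
  have "b0 \<in> fun_space.span (insert b B)"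
    unfolding b0_def using sub g'(1) by (intro fun_space.span_diff subsetD[OF sub] fun_space.span_base[of b]) auto
  then have u: "u \<in> fun_space.span (insert b B)"
    unfolding u_def using sub g(1) by (intro fun_space.span_add fun_space.span_scale) auto
  have fu: "f - u = (f - g) + fscale (- c) b0"
    by (simp add: u_def fscale_def fun_eq_iff)
  have fuL: "f - u \<in> Lp M 2" unfolding fu using fg b0 by (intro Lp_add Lp_fscale) auto
  have inner_fu: "L2_inner M (f - u) h = L2_inner M (f - g) h - c * L2_inner M b0 h" if "h \<in> Lp M 2" for h
    unfolding fu using L2_inner_add_left[OF fg _ that, of "fscale (- c) b0"] b0
    by (simp add: Lp_fscale L2_inner_fscale_left del: fun_space.scale_minus_left)
  have 0: "L2_inner M (f - u) h = 0" if "h \<in> fun_space.span B" for h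
  proof -
    have "h \<in> Lp M 2" using that B Lp_span[of 2 B M h] by simp
    then show ?thesis using g(2)[OF that] g'(2)[OF that] by (simp add: inner_fu b0_def)
  qed
  have 1: "L2_inner M (f - u) b0 = 0"
  proof (cases "L2_inner M b0 b0 = 0")
    case True
    then show ?thesis using L2_inner_self_eq_0[OF b0] by simp
  next
    case False
    then show ?thesis by (simp add: inner_fu[OF b0] c_def)
  qed
  have "L2_inner M (f - u) (b0 + g') = 0"
    using 1 0[OF g'(1)] L2_inner_add_right[OF b0 L(2) fuL] by simp
  then have 2: "L2_inner M (f - u) b = 0" by (simp add: b0_def)
  have "L2_inner M (f - u) h = 0" if "h \<in> fun_space.span (insert b B)" for h
  proof (rule L2_inner_span_right_eq_0[OF insert.prems(1) fuL _ that])
    fix b' assume "b' \<in> insert b B"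
    then show "L2_inner M (f - u) b' = 0" using 2 0 fun_space.span_base[of b' B] by auto
  qed
  then show ?case using u by blast
qed

section \<open>Atoms, piecewise functions and the local orthonormal system\<close>

lemma restrict_fun_span:
  assumes "f \<in> fun_space.span B"
  shows "restrict_fun f A \<in> fun_space.span ((\<lambda>b. restrict_fun b A) ` B)"
  using assms
proof (induction rule: fun_space.span_induct_alt)
  case base
  have "restrict_fun 0 A = 0" by (simp add: restrict_fun_def fun_eq_iff)
  then show ?case using fun_space.span_zero by metis
next
  case (step c x y)
  have "restrict_fun (fscale c x + y) A = fscale c (restrict_fun x A) + restrict_fun y A"
    by (simp add: restrict_fun_def fun_eq_iff fscale_def distrib_right mult.assoc)
  moreover have "fscale c (restrict_fun x A) + restrict_fun y A \<in> fun_space.span ((\<lambda>b. restrict_fun b A) ` B)"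
    using step by (intro fun_space.span_add fun_space.span_scale fun_space.span_base[of "restrict_fun x A"]) auto
  ultimately show ?case by metis
qed

lemma sum_fun_apply: "(\<Sum>i\<in>I. f i) x = (\<Sum>i\<in>I. f i x)"
  by (induction I rule: infinite_finite_induct) auto

lemma sum_restrict_fun_disjoint:
  assumes "finite U" "disjoint U" "A \<in> U" "\<omega> \<in> A"
  shows "(\<Sum>A\<in>U. restrict_fun (f A) A) \<omega> = f A \<omega>"
proof -
  have "(\<Sum>A\<in>U. restrict_fun (f A) A) \<omega> = (\<Sum>B\<in>U. if B = A then f A \<omega> else 0)"
    unfolding sum_fun_apply using assms
    by (intro sum.cong) (auto simp: restrict_fun_def disjoint_def split: split_indicator)
  then show ?thesis using assms by simp
qed

context nuary_filtration
begin

lemma sets_F_subset: "sets (F n) \<subseteq> sets M"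
  using subalg[of n] by (simp add: subalgebra_def)

lemma atom_nonempty: "A \<in> atoms_of (F n) \<Longrightarrow> A \<noteq> {}"
  by (simp add: atoms_of_def)

lemma atom_sets_F: "A \<in> atoms_of (F n) \<Longrightarrow> A \<in> sets (F n)"
  by (simp add: atoms_of_def)

lemma finite_atoms: "finite (atoms_of (F n))"
  using finite_F[of n] by (rule rev_finite_subset) (auto simp: atoms_of_def)

lemma atom_inter:
  assumes "A \<in> atoms_of (F n)" "B \<in> sets (F n)" shows "A \<inter> B = {} \<or> A \<subseteq> B"
proof -
  have "A \<inter> B \<in> sets (F n)" using assms by (auto simp: atoms_of_def)
  then have "A \<inter> B = {} \<or> A \<inter> B = A" using assms(1) by (auto simp: atoms_of_def)
  then show ?thesis by auto
qed

lemma atoms_nested: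
  assumes "A \<in> atoms_of (F m)" "B \<in> atoms_of (F n)" "m \<le> n" shows "A \<inter> B = {} \<or> B \<subseteq> A"
proof -
  have "A \<in> sets (F n)" using atom_sets_F[OF assms(1)] sets_F_mono[OF assms(3)] by auto
  then show ?thesis using atom_inter[OF assms(2)] by auto
qed

lemma all_atoms_nested:
  assumes "A \<in> all_atoms F" "B \<in> all_atoms F"
  shows "A \<inter> B = {} \<or> A \<subseteq> B \<or> B \<subseteq> A"
proof -
  obtain m n where "A \<in> atoms_of (F m)" "B \<in> atoms_of (F n)"
    using assms by (auto simp: all_atoms_def)
  then show ?thesis using atoms_nested[of A m B n] atoms_nested[of B n A m] linear[of m n] by auto
qed

lemma all_atoms_sets: "A \<in> all_atoms F \<Longrightarrow> A \<in> sets M"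
  using sets_F_subset by (auto simp: all_atoms_def atoms_of_def)

lemma all_atoms_nonempty: "A \<in> all_atoms F \<Longrightarrow> A \<noteq> {}"
  by (auto simp: all_atoms_def atoms_of_def)

lemma atoms_disjoint: "disjoint (atoms_of (F n))"
proof (unfold disjoint_def, intro ballI impI)
  fix A B assume "A \<in> atoms_of (F n)" "B \<in> atoms_of (F n)" "A \<noteq> B"
  then show "A \<inter> B = {}" using atoms_nested[of A n B n] atoms_nested[of B n A n] by auto
qed

lemma atoms_cover: "\<Union>(atoms_of (F n)) = space M"
proof (intro equalityI subsetI)
  fix \<omega> assume "\<omega> \<in> \<Union>(atoms_of (F n))"
  then show "\<omega> \<in> space M" using sets.sets_into_space[of _ M] sets_F_subset[of n] atom_sets_F[of _ n] by blast
next
  fix \<omega> assume \<omega>: "\<omega> \<in> space M"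
  define A where "A = (\<Inter>B\<in>{B \<in> sets (F n). \<omega> \<in> B}. B)"
  have sp: "space M \<in> sets (F n)" using sets.top[of "F n"] by (simp add: space_F)
  have A: "A \<in> sets (F n)"
    unfolding A_def using finite_F[of n] sp \<omega> by (intro sets.finite_INT) auto
  have "\<omega> \<in> A" by (simp add: A_def)
  moreover have "B = {} \<or> B = A" if B: "B \<in> sets (F n)" "B \<subseteq> A" for B
  proof (cases "\<omega> \<in> B")
    case True
    then have "A \<subseteq> B" using B unfolding A_def by auto
    then show ?thesis using B by auto
  next
    case False
    have "A - B \<in> sets (F n)" using A B by auto
    moreover have "\<omega> \<in> A - B" using False \<open>\<omega> \<in> A\<close> by auto
    ultimately have "A \<subseteq> A - B" unfolding A_def by auto
    then show ?thesis using B by auto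
  qed
  ultimately have "A \<in> atoms_of (F n)" using A by (auto simp: atoms_of_def)
  then show "\<omega> \<in> \<Union>(atoms_of (F n))" using \<open>\<omega> \<in> A\<close> by auto
qed

lemma atoms_of_F0: "atoms_of (F 0) = {space M}"
  using not_empty by (auto simp: atoms_of_def F_0)

lemma space_in_all_atoms: "space M \<in> all_atoms F"
  using atoms_of_F0 by (auto simp: all_atoms_def)

lemma rings_sets: "R \<in> rings F \<Longrightarrow> R \<in> sets M"
  unfolding rings_def using all_atoms_sets by auto

lemma C_dict_measurable:
  assumes "admissible_space M F S" shows "C_dict F S \<subseteq> borel_measurable M"
  unfolding C_dict_def using assms all_atoms_sets
  by (auto simp: admissible_space_def intro: restrict_fun_measurable)

lemma C_dict_Lp:
  assumes S: "admissible_space M F S" and p: "0 < p" shows "C_dict F S \<subseteq> Lp M p"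
proof
  fix g assume g: "g \<in> C_dict F S"
  then obtain f A where fA: "f \<in> S" "A \<in> all_atoms F" "g = restrict_fun f A" by (auto simp: C_dict_def)
  obtain K where K: "\<And>\<omega>. \<omega> \<in> space M \<Longrightarrow> norm (f \<omega>) \<le> K"
    using S fA(1) by (fastforce simp: admissible_space_def bounded_iff)
  have K0: "0 \<le> K"
  proof -
    obtain \<omega> where "\<omega> \<in> space M" using not_empty by auto
    then show ?thesis using K[of \<omega>] norm_ge_zero[of "f \<omega>"] by linarith
  qed
  have "(\<integral>\<^sup>+\<omega>. ennreal (norm (g \<omega>) powr p) \<partial>M) \<le> (\<integral>\<^sup>+\<omega>. ennreal (K powr p) \<partial>M)"
  proof (intro nn_integral_mono ennreal_leI powr_mono2)
    fix \<omega> assume "\<omega> \<in> space M"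
    then show "norm (g \<omega>) \<le> K" using K[of \<omega>] K0
      by (auto simp: fA restrict_fun_def split: split_indicator)
  qed (use p in auto)
  also have "\<dots> < \<top>" by (simp add: emeasure_space_1)
  finally have "Lp_norm M p g < \<top>" by (simp add: Lp_norm_def epowr_less_top_iff)
  then show "g \<in> Lp M p" using C_dict_measurable[OF S] g by (auto simp: Lp_def)
qed

definition level_dict :: "('a \<Rightarrow> 'k::real_normed_field) set \<Rightarrow> nat \<Rightarrow> ('a \<Rightarrow> 'k) set" where
  "level_dict B n = (\<Union>A\<in>atoms_of (F n). (\<lambda>b. restrict_fun b A) ` B)"

text \<open>Members of the piecewise space are arbitrary off \<open>space M\<close>, so it may have infinite dimension;
  it is spanned by \<open>level_dict\<close> only as far as values on \<open>space M\<close> are concerned.\<close>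

lemma span_level_dict:
  assumes B: "S = fun_space.span B" and h: "h \<in> piecewise_space F S n"
  shows "\<exists>g\<in>fun_space.span (level_dict B n). \<forall>\<omega>\<in>space M. g \<omega> = h \<omega>"
proof -
  obtain s where s: "\<And>A. A \<in> atoms_of (F n) \<Longrightarrow> s A \<in> S \<and> (\<forall>\<omega>\<in>A. h \<omega> = s A \<omega>)"
    using h unfolding piecewise_space_def by simp metis
  define g where "g = (\<Sum>A\<in>atoms_of (F n). restrict_fun (s A) A)"
  have "g \<in> fun_space.span (level_dict B n)"
    unfolding g_def
  proof (rule fun_space.span_sum)
    fix A assume A: "A \<in> atoms_of (F n)"
    have "restrict_fun (s A) A \<in> fun_space.span ((\<lambda>b. restrict_fun b A) ` B)"
      using s[OF A] B by (intro restrict_fun_span) auto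
    also have "\<dots> \<subseteq> fun_space.span (level_dict B n)"
      using A by (intro fun_space.span_mono) (auto simp: level_dict_def)
    finally show "restrict_fun (s A) A \<in> fun_space.span (level_dict B n)" .
  qed
  moreover have "g \<omega> = h \<omega>" if "\<omega> \<in> space M" for \<omega>
  proof -
    obtain A where A: "A \<in> atoms_of (F n)" "\<omega> \<in> A" using \<open>\<omega> \<in> space M\<close> atoms_cover[of n] by auto
    then show ?thesis unfolding g_def
      using sum_restrict_fun_disjoint[OF finite_atoms atoms_disjoint A, of s] s[OF A(1)] by simp
  qed
  ultimately show ?thesis by blast
qed

lemma piecewise_space_subspace:
  fixes S :: "('a \<Rightarrow> 'k::{real_normed_field, euclidean_space}) set"
  assumes "S = fun_space.span B" shows "fun_space.subspace (piecewise_space F S n)"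
proof (rule fun_space.subspaceI)
  show "0 \<in> piecewise_space F S n"
    unfolding piecewise_space_def
  proof (intro CollectI ballI)
    fix A show "\<exists>f\<in>S. \<forall>\<omega>\<in>A. 0 \<omega> = f \<omega>"
      by (rule bexI[of _ 0]) (auto simp: assms fun_space.span_zero)
  qed
next
  fix x y assume *: "x \<in> piecewise_space F S n" "y \<in> piecewise_space F S n"
  show "x + y \<in> piecewise_space F S n"
    unfolding piecewise_space_def
  proof (intro CollectI ballI)
    fix A assume "A \<in> atoms_of (F n)"
    then obtain u v where "u \<in> S" "v \<in> S" "\<forall>\<omega>\<in>A. x \<omega> = u \<omega>" "\<forall>\<omega>\<in>A. y \<omega> = v \<omega>"
      using * unfolding piecewise_space_def by blast
    then show "\<exists>f\<in>S. \<forall>\<omega>\<in>A. (x + y) \<omega> = f \<omega>"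
      by (intro bexI[of _ "u + v"]) (auto simp: assms fun_space.span_add)
  qed
next
  fix c x assume *: "x \<in> piecewise_space F S n"
  show "fscale c x \<in> piecewise_space F S n"
    unfolding piecewise_space_def
  proof (intro CollectI ballI)
    fix A assume "A \<in> atoms_of (F n)"
    then obtain u where "u \<in> S" "\<forall>\<omega>\<in>A. x \<omega> = u \<omega>"
      using * unfolding piecewise_space_def by blast
    then show "\<exists>f\<in>S. \<forall>\<omega>\<in>A. (fscale c x) \<omega> = f \<omega>"
      using fun_space.span_scale[of u B c] by (intro bexI[of _ "fscale c u"]) (simp_all add: assms fscale_def)
  qed
qed

lemma piecewise_space_mono:
  assumes "m \<le> n" shows "piecewise_space F S m \<subseteq> piecewise_space F S n"
proof
  fix g assume g: "g \<in> piecewise_space F S m"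
  show "g \<in> piecewise_space F S n"
    unfolding piecewise_space_def
  proof (intro CollectI ballI)
    fix A assume A: "A \<in> atoms_of (F n)"
    obtain \<omega> where \<omega>: "\<omega> \<in> A" using atom_nonempty[OF A] by auto
    then have "\<omega> \<in> space M" using A atoms_cover[of n] by auto
    then obtain B where B: "B \<in> atoms_of (F m)" "\<omega> \<in> B" using atoms_cover[of m] by auto
    then have "A \<subseteq> B" using atoms_nested[OF B(1) A assms] \<omega> by auto
    then show "\<exists>f\<in>S. \<forall>\<omega>\<in>A. g \<omega> = f \<omega>" using g B(1) unfolding piecewise_space_def by blast
  qed
qed

lemma restrict_fun_piecewise:
  fixes S :: "('a \<Rightarrow> 'k::{real_normed_field, euclidean_space}) set"
  assumes S: "S = fun_space.span B" and f: "f \<in> S" and A: "A \<in> atoms_of (F n)"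
  shows "restrict_fun f A \<in> piecewise_space F S n"
  unfolding piecewise_space_def
proof (intro CollectI ballI)
  fix A' assume A': "A' \<in> atoms_of (F n)"
  show "\<exists>g\<in>S. \<forall>\<omega>\<in>A'. restrict_fun f A \<omega> = g \<omega>"
  proof (cases "A' = A")
    case True then show ?thesis using f by (intro bexI[of _ f]) (auto simp: restrict_fun_def)
  next
    case False
    then have "A' \<inter> A = {}" using atoms_disjoint[of n] A A' by (auto simp: disjoint_def)
    then have "\<forall>\<omega>\<in>A'. restrict_fun f A \<omega> = (0 :: 'a \<Rightarrow> 'k) \<omega>"
      by (auto simp: restrict_fun_def split: split_indicator)
    then show ?thesis unfolding S by (intro bexI[of _ 0] fun_space.span_zero)
  qed
qed

text \<open>\<open>orth_proj\<close> is a choice, about which nothing is known unless a projection exists.\<close>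

lemma orth_proj_mem:
  assumes S: "admissible_space M F S" and f: "f \<in> Lp M 2"
  shows "orth_proj M (piecewise_space F S n) f \<in> piecewise_space F S n"
proof -
  obtain B where B: "finite B" "S = fun_space.span B" using S by (auto simp: admissible_space_def)
  have fin: "finite (level_dict B n)" using B(1) finite_atoms by (simp add: level_dict_def)
  have "level_dict B n \<subseteq> C_dict F S"
    using B(2) by (auto simp: level_dict_def C_dict_def all_atoms_def intro: fun_space.span_base)
  then have Lp: "level_dict B n \<subseteq> Lp M 2" using C_dict_Lp[OF S, of 2] by simp
  obtain g where g: "g \<in> fun_space.span (level_dict B n)"
    "\<And>h. h \<in> fun_space.span (level_dict B n) \<Longrightarrow> L2_inner M (f - g) h = 0"
    using orthogonal_projection_exists[OF fin Lp f] by blast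
  have "level_dict B n \<subseteq> piecewise_space F S n"
    unfolding level_dict_def using restrict_fun_piecewise[OF B(2)] B(2) fun_space.span_base[of _ B] by blast
  then have "g \<in> piecewise_space F S n"
    using g(1) piecewise_space_subspace[OF B(2)] fun_space.span_minimal by blast
  moreover have "L2_inner M (f - g) h = 0" if h: "h \<in> piecewise_space F S n" for h
  proof -
    obtain h' where h': "h' \<in> fun_space.span (level_dict B n)" "\<forall>\<omega>\<in>space M. h' \<omega> = h \<omega>"
      using span_level_dict[OF B(2) h] by blast
    have "L2_inner M (f - g) h = L2_inner M (f - g) h'"
      unfolding L2_inner_def using h'(2) by (intro Bochner_Integration.integral_cong) auto
    then show ?thesis using g(2)[OF h'(1)] by simp
  qed
  ultimately have "\<exists>g. g \<in> piecewise_space F S n \<and> (\<forall>h\<in>piecewise_space F S n. L2_inner M (f - g) h = 0)"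
    by blast
  then show ?thesis unfolding orth_proj_def by (rule someI2_ex) blast
qed

lemma proj_diff_mem:
  assumes S: "admissible_space M F S" and f: "f \<in> Lp M 2"
  shows "proj_diff M F S n f \<in> piecewise_space F S n"
proof (cases n)
  case 0
  then show ?thesis using orth_proj_mem[OF S f] by (simp add: proj_diff_def)
next
  case (Suc m)
  obtain B where "S = fun_space.span B" using S by (auto simp: admissible_space_def)
  then have "fun_space.subspace (piecewise_space F S n)" by (rule piecewise_space_subspace)
  moreover have "orth_proj M (piecewise_space F S m) f \<in> piecewise_space F S n"
    using orth_proj_mem[OF S f, of m] piecewise_space_mono[of m n S] Suc by auto
  moreover have "orth_proj M (piecewise_space F S n) f \<in> piecewise_space F S n"
    by (rule orth_proj_mem[OF S f])
  ultimately show ?thesis unfolding Suc proj_diff_def by (simp add: fun_space.subspace_diff)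
qed

text \<open>An element of \<open>\<Phi> (Suc n)\<close> is, up to a null set, piecewise in \<open>S\<close> on the atoms of
  \<open>F (Suc n)\<close> and lives on one atom of \<open>F n\<close>, which has at most \<open>\<nu>\<close> children.\<close>

lemma local_system_subset_Sigma:
  assumes S: "admissible_space M F S" and Phi: "local_orthonormal_system M F S \<Phi>" and \<phi>: "\<phi> \<in> (\<Union>n. \<Phi> n)"
  shows "\<exists>\<phi>'\<in>Sigma_n (C_dict F S) \<nu>. AE \<omega> in M. \<phi> \<omega> = \<phi>' \<omega>"
proof -
  obtain n where n: "\<phi> \<in> \<Phi> n" using \<phi> by blast
  have "\<phi> \<in> proj_diff_range M F S n"
    using Phi n unfolding local_orthonormal_system_def orthonormal_basis_def by blast
  then obtain f where f: "f \<in> Lp M 2" "AE \<omega> in M. \<phi> \<omega> = proj_diff M F S n f \<omega>"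
    unfolding proj_diff_range_def by blast
  define u where "u = proj_diff M F S n f"
  have u: "u \<in> piecewise_space F S n" "AE \<omega> in M. \<phi> \<omega> = u \<omega>"
    unfolding u_def using proj_diff_mem[OF S f(1)] f(2) by blast+
  obtain s where s: "\<And>A. A \<in> atoms_of (F n) \<Longrightarrow> s A \<in> S \<and> (\<forall>\<omega>\<in>A. u \<omega> = s A \<omega>)"
    using u(1) unfolding piecewise_space_def by simp metis
  have "\<exists>U\<subseteq>atoms_of (F n). finite U \<and> card U \<le> \<nu> \<and> (AE \<omega> in M. \<omega> \<notin> \<Union>U \<longrightarrow> \<phi> \<omega> = 0)"
  proof (cases n)
    case 0
    show ?thesis using nu_ge_2 by (intro exI[of _ "{space M}"]) (auto simp: 0 atoms_of_F0)
  next
    case (Suc m)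
    obtain A where A: "A \<in> atoms_of (F m)" "AE \<omega> in M. \<omega> \<notin> A \<longrightarrow> \<phi> \<omega> = 0"
      using Phi n unfolding Suc local_orthonormal_system_def by blast
    show ?thesis using refine[OF A(1)] A(2) unfolding Suc by blast
  qed
  then obtain U where U: "U \<subseteq> atoms_of (F n)" "finite U" "card U \<le> \<nu>" "AE \<omega> in M. \<omega> \<notin> \<Union>U \<longrightarrow> \<phi> \<omega> = 0"
    by blast
  define \<phi>' where "\<phi>' = (\<Sum>A\<in>U. restrict_fun (s A) A)"
  have "\<phi>' \<in> Sigma_n (C_dict F S) (\<Sum>A\<in>U. 1)"
    unfolding \<phi>'_def
  proof (rule Sigma_n_sum[OF U(2)])
    fix A assume "A \<in> U"
    then show "restrict_fun (s A) A \<in> Sigma_n (C_dict F S) 1"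
      using U(1) s by (intro Sigma_n_base) (auto simp: C_dict_def all_atoms_def)
  qed
  then have "\<phi>' \<in> Sigma_n (C_dict F S) \<nu>"
    by (rule Sigma_n_mono) (use U(3) in simp)
  moreover have "AE \<omega> in M. \<phi> \<omega> = \<phi>' \<omega>"
    using u(2) U(4)
  proof eventually_elim
    case (elim \<omega>)
    show ?case
    proof (cases "\<omega> \<in> \<Union>U")
      case True
      then obtain A where A: "A \<in> U" "\<omega> \<in> A" by blast
      have "disjoint U" using atoms_disjoint[of n] U(1) by (auto simp: disjoint_def)
      then have "\<phi>' \<omega> = s A \<omega>" unfolding \<phi>'_def by (rule sum_restrict_fun_disjoint[OF U(2) _ A])
      then show ?thesis using elim s[of A] A U(1) by auto
    next
      case False
      then have "\<phi>' \<omega> = 0"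
        unfolding \<phi>'_def sum_fun_apply by (intro sum.neutral) (auto simp: restrict_fun_def)
      then show ?thesis using elim False by simp
    qed
  qed
  ultimately show ?thesis by blast
qed

lemma Sigma_local_system:
  assumes S: "admissible_space M F S" and Phi: "local_orthonormal_system M F S \<Phi>"
    and x: "x \<in> Sigma_n (\<Union>n. \<Phi> n) m"
  shows "\<exists>x'\<in>Sigma_n (C_dict F S) (\<nu> * m). AE \<omega> in M. x \<omega> = x' \<omega>"
proof -
  obtain T where T: "T \<subseteq> (\<Union>n. \<Phi> n)" "finite T" "card T \<le> m" "x \<in> fun_space.span T"
    using x by (rule Sigma_nE)
  obtain c where c: "x = (\<Sum>t\<in>T. fscale (c t) t)"
    using T(4) unfolding fun_space.span_finite[OF T(2)] by blast
  have "\<forall>t\<in>T. \<exists>t'\<in>Sigma_n (C_dict F S) \<nu>. AE \<omega> in M. t \<omega> = t' \<omega>"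
    using local_system_subset_Sigma[OF S Phi] T(1) by blast
  then obtain t' where t': "\<And>t. t \<in> T \<Longrightarrow> t' t \<in> Sigma_n (C_dict F S) \<nu>" "\<And>t. t \<in> T \<Longrightarrow> AE \<omega> in M. t \<omega> = t' t \<omega>"
    by metis
  define x' where "x' = (\<Sum>t\<in>T. fscale (c t) (t' t))"
  have "x' \<in> Sigma_n (C_dict F S) (\<Sum>t\<in>T. \<nu>)"
    unfolding x'_def by (intro Sigma_n_sum T(2) Sigma_n_scale t'(1))
  then have "x' \<in> Sigma_n (C_dict F S) (\<nu> * m)"
    by (rule Sigma_n_mono) (use T(3) in simp)
  moreover have "AE \<omega> in M. \<forall>t\<in>T. t \<omega> = t' t \<omega>"
    using T(2) t'(2) by (intro AE_finite_allI)
  then have "AE \<omega> in M. x \<omega> = x' \<omega>"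
    by eventually_elim (simp add: c x'_def sum_fun_apply fscale_def)
  ultimately show ?thesis by blast
qed

end

section \<open>Variation seminorms and their Bernstein inequality\<close>

lemma local_error_eq_INF:
  fixes S :: "('a \<Rightarrow> 'k::{real_normed_field, euclidean_space}) set"
  assumes R: "R \<in> sets M" and p: "0 < p"
  shows "local_error M S p f R = (INF h\<in>S. Lp_norm M p (restrict_fun (f - h) R))"
proof -
  have *: "Lp_norm (restrict_space M R) p (f - restrict_fun h R) = Lp_norm M p (restrict_fun (f - h) R)" for h
  proof -
    have "(\<integral>\<^sup>+\<omega>. ennreal (norm ((f - restrict_fun h R) \<omega>) powr p) \<partial>restrict_space M R)
        = (\<integral>\<^sup>+\<omega>. ennreal (norm ((f - restrict_fun h R) \<omega>) powr p) * indicator R \<omega> \<partial>M)"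
      using R sets.sets_into_space[OF R] by (intro nn_integral_restrict_space) (simp add: Int_absorb2)
    also have "\<dots> = (\<integral>\<^sup>+\<omega>. ennreal (norm (restrict_fun (f - h) R \<omega>) powr p) \<partial>M)"
      using p by (intro nn_integral_cong) (auto simp: restrict_fun_def split: split_indicator)
    finally show ?thesis by (simp add: Lp_norm_def)
  qed
  have "restricted_space S R = (\<lambda>h. restrict_fun h R) ` S" by (auto simp: restricted_space_def)
  then show ?thesis unfolding local_error_def by (simp add: * image_image)
qed

lemma Lp_norm_restrict_le:
  assumes "0 < p" shows "Lp_norm M p (restrict_fun f R) \<le> Lp_norm M p f"
  using assms by (intro Lp_norm_mono_AE AE_I2) (auto simp: restrict_fun_def split: split_indicator)

lemma local_error_le:
  fixes S :: "('a \<Rightarrow> 'k::{real_normed_field, euclidean_space}) set"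
  assumes "R \<in> sets M" "0 < p" "h \<in> S"
  shows "local_error M S p f R \<le> Lp_norm M p (restrict_fun (f - h) R)"
  unfolding local_error_eq_INF[OF assms(1,2)] using assms(3) by (rule INF_lower)

lemma local_error_eq_0:
  fixes S :: "('a \<Rightarrow> 'k::{real_normed_field, euclidean_space}) set"
  assumes "R \<in> sets M" "0 < p" "h \<in> S" "\<And>\<omega>. \<omega> \<in> R \<Longrightarrow> f \<omega> = h \<omega>"
  shows "local_error M S p f R = 0"
proof -
  have "restrict_fun (f - h) R = 0"
    using assms(4) by (auto simp: restrict_fun_def fun_eq_iff split: split_indicator)
  then show ?thesis using local_error_le[OF assms(1-3), of f] by simp
qed

lemma local_error_cong_AE:
  fixes S :: "('a \<Rightarrow> 'k::{real_normed_field, euclidean_space}) set"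
  assumes "R \<in> sets M" "0 < p" "AE \<omega> in M. f \<omega> = g \<omega>"
  shows "local_error M S p f R = local_error M S p g R"
proof -
  have "Lp_norm M p (restrict_fun (f - h) R) = Lp_norm M p (restrict_fun (g - h) R)" for h
  proof (rule Lp_norm_cong_AE[OF assms(2)])
    show "AE \<omega> in M. norm (restrict_fun (f - h) R \<omega>) = norm (restrict_fun (g - h) R \<omega>)"
      using assms(3) by eventually_elim (simp add: restrict_fun_def)
  qed
  then show ?thesis by (simp add: local_error_eq_INF[OF assms(1,2)])
qed

lemma local_error_add_le:
  fixes S :: "('a \<Rightarrow> 'k::{real_normed_field, euclidean_space}) set"
  assumes R: "R \<in> sets M" and p: "1 \<le> p" and S: "fun_space.subspace S" "S \<subseteq> borel_measurable M"
    and meas: "f \<in> borel_measurable M" "g \<in> borel_measurable M"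
  shows "local_error M S p (f + g) R \<le> local_error M S p f R + local_error M S p g R"
proof (rule ennreal_le_epsilon)
  fix \<epsilon> :: real
  assume fin: "local_error M S p f R + local_error M S p g R < \<top>" and \<epsilon>: "0 < \<epsilon>"
  have p0: "0 < p" using p by simp
  note E = local_error_eq_INF[OF R p0]
  have *: "\<exists>h\<in>S. Lp_norm M p (restrict_fun (u - h) R) < local_error M S p u R + ennreal (\<epsilon> / 2)"
    if "local_error M S p u R < \<top>" for u
  proof -
    have "local_error M S p u R < local_error M S p u R + ennreal (\<epsilon> / 2)"
      using that \<epsilon> by (cases "local_error M S p u R") (simp_all add: ennreal_less_iff flip: ennreal_plus)
    then show ?thesis by (simp only: E INF_less_iff)
  qed
  obtain h1 where h1: "h1 \<in> S" "Lp_norm M p (restrict_fun (f - h1) R) < local_error M S p f R + ennreal (\<epsilon> / 2)"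
    using *[of f] fin by auto
  obtain h2 where h2: "h2 \<in> S" "Lp_norm M p (restrict_fun (g - h2) R) < local_error M S p g R + ennreal (\<epsilon> / 2)"
    using *[of g] fin by auto
  have eq: "restrict_fun ((f + g) - (h1 + h2)) R = restrict_fun (f - h1) R + restrict_fun (g - h2) R"
    by (simp add: restrict_fun_def fun_eq_iff algebra_simps)
  have m: "restrict_fun (f - h1) R \<in> borel_measurable M" "restrict_fun (g - h2) R \<in> borel_measurable M"
    using meas h1(1) h2(1) S(2) R by (auto intro!: restrict_fun_measurable simp: fun_diff_def)
  have "local_error M S p (f + g) R \<le> Lp_norm M p (restrict_fun ((f + g) - (h1 + h2)) R)"
    using h1(1) h2(1) S(1) by (intro local_error_le R p0 fun_space.subspace_add)
  also have "\<dots> \<le> Lp_norm M p (restrict_fun (f - h1) R) + Lp_norm M p (restrict_fun (g - h2) R)"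
    unfolding eq by (rule Lp_norm_triangle[OF p m])
  also have "\<dots> \<le> (local_error M S p f R + ennreal (\<epsilon> / 2)) + (local_error M S p g R + ennreal (\<epsilon> / 2))"
    using h1(2) h2(2) by (intro add_mono less_imp_le)
  also have "\<dots> = local_error M S p f R + local_error M S p g R + (ennreal (\<epsilon> / 2) + ennreal (\<epsilon> / 2))"
    by (simp add: add_ac)
  also have "ennreal (\<epsilon> / 2) + ennreal (\<epsilon> / 2) = ennreal \<epsilon>"
    using \<epsilon> by (simp flip: ennreal_plus)
  finally show "local_error M S p (f + g) R \<le> local_error M S p f R + local_error M S p g R + ennreal \<epsilon>" .
qed

lemma local_error_sum_le:
  fixes S :: "('a \<Rightarrow> 'k::{real_normed_field, euclidean_space}) set"
  assumes R: "R \<in> sets M" and p: "1 \<le> p" and S: "fun_space.subspace S" "S \<subseteq> borel_measurable M"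
    and I: "finite I" and meas: "\<And>i. i \<in> I \<Longrightarrow> d i \<in> borel_measurable M"
  shows "local_error M S p (\<Sum>i\<in>I. d i) R \<le> (\<Sum>i\<in>I. local_error M S p (d i) R)"
  using I meas
proof (induction I rule: finite_induct)
  case empty
  have "local_error M S p 0 R = 0"
    using p S(1) by (intro local_error_eq_0[OF R, of _ 0]) (auto simp: fun_space.subspace_0)
  then show ?case by (metis order_refl sum.empty)
next
  case (insert i I)
  have m: "(\<Sum>i\<in>I. d i) \<in> borel_measurable M"
    by (rule borel_measurable_span[of "d ` I"])
       (use insert.prems in \<open>auto intro!: fun_space.span_sum intro: fun_space.span_base\<close>)
  have "local_error M S p (d i + (\<Sum>i\<in>I. d i)) R \<le> local_error M S p (d i) R + local_error M S p (\<Sum>i\<in>I. d i) R"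
    using insert.prems by (intro local_error_add_le R p S m) auto
  also have "\<dots> \<le> local_error M S p (d i) R + (\<Sum>i\<in>I. local_error M S p (d i) R)"
    using insert.prems by (intro add_left_mono insert.IH) auto
  finally show ?case by (simp only: sum.insert[OF insert.hyps])
qed

lemma epowr_le_interpolate:
  assumes "0 < e" "0 < \<sigma>" "\<sigma> < p"
  shows "epowr x \<sigma> \<le> ennreal (e powr \<sigma>) + ennreal (e powr (\<sigma> - p)) * epowr x p"
proof (cases x)
  case (real r)
  have "r powr \<sigma> \<le> e powr \<sigma> + e powr (\<sigma> - p) * r powr p"
  proof (cases "r \<le> e")
    case True
    then have "r powr \<sigma> \<le> e powr \<sigma>" using real assms by (intro powr_mono2) auto
    then show ?thesis by (simp add: add_increasing2)
  next
    case False
    have "r powr (\<sigma> - p) \<le> e powr (\<sigma> - p)"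
      using False assms by (intro powr_mono2') auto
    then have "r powr (\<sigma> - p) * r powr p \<le> e powr (\<sigma> - p) * r powr p" by (rule mult_right_mono) simp
    then have "r powr \<sigma> \<le> e powr (\<sigma> - p) * r powr p" by (simp flip: powr_add)
    then show ?thesis by (simp add: add_increasing)
  qed
  then show ?thesis using real by (simp add: epowr_ennreal flip: ennreal_mult ennreal_plus)
next
  case top
  then show ?thesis using assms by (simp add: epowr_def ennreal_mult_top)
qed

lemma epowr_SUP_le_sum:
  assumes "0 \<le> r" shows "epowr (SUP j\<in>{..n::nat}. a j) r \<le> (\<Sum>j\<le>n. epowr (a j) r)"
proof -
  have "(SUP j\<in>{..n}. a j) \<in> a ` {..n}"
    using Max_in[of "a ` {..n}"] by (subst Max_Sup[symmetric]) auto
  then obtain i where i: "i \<le> n" "(SUP j\<in>{..n}. a j) = a i" by auto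
  have "epowr (a i) r \<le> (\<Sum>j\<in>{..n}. epowr (a j) r)"
    using i(1) by (intro member_le_sum) auto
  then show ?thesis using i(2) by simp
qed

context nuary_filtration
begin

definition regions :: "'a set set" where
  "regions = all_atoms F \<union> rings F"

lemma regions_sets: "R \<in> regions \<Longrightarrow> R \<in> sets M"
  using all_atoms_sets rings_sets by (auto simp: regions_def)

lemma regionE:
  assumes "R \<in> regions"
  obtains X Y where "R = X - Y" "X \<in> all_atoms F" "Y = {} \<or> Y \<in> all_atoms F" "Y \<subset> X"
proof (cases "R \<in> all_atoms F")
  case True
  then show ?thesis using that[of R "{}"] all_atoms_nonempty by auto
next
  case False
  then obtain X Y where "R = X - Y" "X \<in> all_atoms F" "Y \<in> all_atoms F" "Y \<subset> X"
    using assms by (auto simp: regions_def rings_def)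
  then show ?thesis using that[of X Y] by auto
qed

lemma region_nonempty: "R \<in> regions \<Longrightarrow> R \<noteq> {}"
  by (erule regionE) auto

text \<open>An atom cuts a region if it meets the region without containing it.  Two disjoint regions cut
  by the same atom \<open>A\<close> would have nested outer atoms \<open>X \<subseteq> X'\<close>
  strictly containing \<open>A\<close>; disjointness forces \<open>X\<close> to be covered by the two removed atoms.  These
  are then disjoint and both meet \<open>A\<close> without containing it, so both lie in \<open>A\<close>, whence
  \<open>X \<subseteq> A\<close>.\<close>

lemma atom_splits_at_most_one_aux:
  assumes A: "A \<in> all_atoms F"
    and X: "X \<in> all_atoms F" "Y = {} \<or> Y \<in> all_atoms F" "Y \<subset> X"
    and X': "X' \<in> all_atoms F" "Y' = {} \<or> Y' \<in> all_atoms F" "Y' \<subset> X'"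
    and split: "A \<inter> (X - Y) \<noteq> {}" "\<not> X - Y \<subseteq> A" and split': "A \<inter> (X' - Y') \<noteq> {}" "\<not> X' - Y' \<subseteq> A"
    and disj: "(X - Y) \<inter> (X' - Y') = {}" and sub: "X \<subseteq> X'"
  shows False
proof -
  have AX: "A \<subset> X" using all_atoms_nested[OF A X(1)] split by blast
  have cover: "X \<subseteq> Y \<union> Y'" using disj sub by blast
  have nXY': "\<not> X \<subseteq> Y'" using AX split'(1) by blast
  have nXY: "\<not> X \<subseteq> Y" using X(3) by blast
  have Y: "Y \<in> all_atoms F" using X(2) cover nXY' by blast
  have Y': "Y' \<in> all_atoms F" using X'(2) cover nXY by blast
  have "Y' \<subseteq> X" using all_atoms_nested[OF Y' X(1)] nXY nXY' cover by blast
  have "\<not> A \<subseteq> Y" "\<not> A \<subseteq> Y'" using split(1) split'(1) by blast+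
  then have "A \<inter> Y \<noteq> {}" "A \<inter> Y' \<noteq> {}" using AX cover by blast+
  then have "Y \<subseteq> A" "Y' \<subseteq> A"
    using all_atoms_nested[OF A Y] all_atoms_nested[OF A Y'] \<open>\<not> A \<subseteq> Y\<close> \<open>\<not> A \<subseteq> Y'\<close> by blast+
  then show False using cover AX by blast
qed

lemma atom_splits_at_most_one:
  assumes A: "A \<in> all_atoms F" and R: "R \<in> regions" "R' \<in> regions" "R \<inter> R' = {}"
    and split: "A \<inter> R \<noteq> {}" "\<not> R \<subseteq> A" and split': "A \<inter> R' \<noteq> {}" "\<not> R' \<subseteq> A"
  shows False
proof -
  obtain X Y where X: "R = X - Y" "X \<in> all_atoms F" "Y = {} \<or> Y \<in> all_atoms F" "Y \<subset> X"
    using R(1) by (rule regionE)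
  obtain X' Y' where X': "R' = X' - Y'" "X' \<in> all_atoms F" "Y' = {} \<or> Y' \<in> all_atoms F" "Y' \<subset> X'"
    using R(2) by (rule regionE)
  have AX: "A \<subseteq> X" "A \<subseteq> X'"
    using all_atoms_nested[OF A X(2)] all_atoms_nested[OF A X'(2)] split split' X(1) X'(1) by blast+
  have "X \<subseteq> X' \<or> X' \<subseteq> X"
    using all_atoms_nested[OF X(2) X'(2)] AX all_atoms_nonempty[OF A] by blast
  then show False
    using atom_splits_at_most_one_aux[OF A X(2-4) X'(2-4)] atom_splits_at_most_one_aux[OF A X'(2-4) X(2-4)]
      split split' R(3) unfolding X(1) X'(1) by blast
qed

text \<open>A combination of \<open>N\<close> dictionary elements restricts to an element of \<open>S\<close> on every region that
  none of its \<open>N\<close> atoms cuts, and each atom cuts at most one member of a disjoint family.\<close>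

lemma card_nonzero_local_error:
  fixes S :: "('a \<Rightarrow> 'k::{real_normed_field, euclidean_space}) set"
  assumes S: "fun_space.subspace S" and p: "0 < p" and g: "g \<in> Sigma_n (C_dict F S) N"
    and Q: "finite Q" "Q \<subseteq> regions" "disjoint Q"
  shows "card {R \<in> Q. local_error M S p g R \<noteq> 0} \<le> N"
proof -
  obtain T where T: "T \<subseteq> C_dict F S" "finite T" "card T \<le> N" "g \<in> fun_space.span T"
    using g by (rule Sigma_nE)
  obtain c where c: "g = (\<Sum>t\<in>T. fscale (c t) t)"
    using T(4) unfolding fun_space.span_finite[OF T(2)] by blast
  have "\<forall>t\<in>T. \<exists>s A. s \<in> S \<and> A \<in> all_atoms F \<and> t = restrict_fun s A"
    using T(1) unfolding C_dict_def by blast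
  then obtain s A where sA: "\<And>t. t \<in> T \<Longrightarrow> s t \<in> S" "\<And>t. t \<in> T \<Longrightarrow> A t \<in> all_atoms F"
    "\<And>t. t \<in> T \<Longrightarrow> t = restrict_fun (s t) (A t)" by metis
  define W where "W t = {R \<in> Q. A t \<inter> R \<noteq> {} \<and> \<not> R \<subseteq> A t}" for t
  have "{R \<in> Q. local_error M S p g R \<noteq> 0} \<subseteq> (\<Union>t\<in>T. W t)"
  proof (rule subsetI, rule ccontr)
    fix R assume "R \<in> {R \<in> Q. local_error M S p g R \<noteq> 0}" and nW: "R \<notin> (\<Union>t\<in>T. W t)"
    then have R: "R \<in> Q" "local_error M S p g R \<noteq> 0" by auto
    have uncut: "A t \<inter> R = {} \<or> R \<subseteq> A t" if "t \<in> T" for t using nW R(1) that by (auto simp: W_def)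
    define h where "h = (\<Sum>t\<in>T. if R \<subseteq> A t then fscale (c t) (s t) else 0)"
    have h: "h \<in> S" unfolding h_def
      using S sA(1) by (intro fun_space.subspace_sum) (auto simp: fun_space.subspace_scale fun_space.subspace_0)
    have "g \<omega> = h \<omega>" if "\<omega> \<in> R" for \<omega>
      unfolding c h_def sum_fun_apply
    proof (rule sum.cong[OF refl])
      fix t assume t: "t \<in> T"
      have "t \<omega> = (if R \<subseteq> A t then s t \<omega> else 0)"
        using uncut[OF t] \<open>\<omega> \<in> R\<close> by (subst sA(3)[OF t]) (auto simp: restrict_fun_def split: split_indicator)
      then show "fscale (c t) t \<omega> = (if R \<subseteq> A t then fscale (c t) (s t) else 0) \<omega>"
        by (simp add: fscale_def)
    qed
    then have "local_error M S p g R = 0"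
      using R(1) Q(2) by (intro local_error_eq_0[OF _ p h] regions_sets) auto
    then show False using R(2) by simp
  qed
  then have "card {R \<in> Q. local_error M S p g R \<noteq> 0} \<le> card (\<Union>t\<in>T. W t)"
    using T(2) Q(1) by (intro card_mono) (auto simp: W_def)
  also have "\<dots> \<le> (\<Sum>t\<in>T. card (W t))" by (rule card_UN_le[OF T(2)])
  also have "\<dots> \<le> (\<Sum>t\<in>T. 1)"
  proof (rule sum_mono)
    fix t assume t: "t \<in> T"
    have "R = R'" if "R \<in> W t" "R' \<in> W t" for R R'
    proof (rule ccontr)
      assume "R \<noteq> R'"
      then have "R \<inter> R' = {}" using that Q(3) by (auto simp: W_def disjoint_def)
      then show False using atom_splits_at_most_one[OF sA(2)[OF t]] that Q(2) unfolding W_def by blast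
    qed
    moreover have "finite (W t)" using Q(1) by (simp add: W_def)
    ultimately show "card (W t) \<le> 1" by (simp add: card_le_Suc0_iff_eq)
  qed
  also have "\<dots> \<le> N" using T(3) by simp
  finally show ?thesis .
qed

lemma variation_seminorm_le:
  assumes "\<And>Q. finite Q \<Longrightarrow> Q \<subseteq> regions \<Longrightarrow> disjoint Q \<Longrightarrow>
      (\<Sum>R\<in>Q. epowr (local_error M S p f R) \<sigma>) \<le> epowr c \<sigma>" and "0 < \<sigma>"
  shows "variation_seminorm M F S p \<sigma> f \<le> c"
  unfolding variation_seminorm_def regions_def[symmetric]
proof (rule SUP_least)
  fix Q assume "Q \<in> {Q. finite Q \<and> Q \<subseteq> regions \<and> disjoint Q}"
  then show "epowr (\<Sum>R\<in>Q. epowr (local_error M S p f R) \<sigma>) (1 / \<sigma>) \<le> c"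
    using assms(1)[of Q] by (simp add: epowr_le_iff[OF assms(2)])
qed

lemma variation_seminorm_ge:
  assumes "finite Q" "Q \<subseteq> regions" "disjoint Q" "0 < \<sigma>"
  shows "(\<Sum>R\<in>Q. epowr (local_error M S p f R) \<sigma>) \<le> epowr (variation_seminorm M F S p \<sigma> f) \<sigma>"
  unfolding epowr_le_iff[OF assms(4), symmetric] variation_seminorm_def regions_def[symmetric]
  by (rule SUP_upper) (use assms in simp)

lemma variation_seminorm_cong_AE:
  fixes S :: "('a \<Rightarrow> 'k::{real_normed_field, euclidean_space}) set"
  assumes "0 < p" "AE \<omega> in M. f \<omega> = g \<omega>"
  shows "variation_seminorm M F S p \<sigma> f = variation_seminorm M F S p \<sigma> g"
proof -
  have "local_error M S p f R = local_error M S p g R" if "R \<in> all_atoms F \<union> rings F" for R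
    using that by (intro local_error_cong_AE assms regions_sets) (simp add: regions_def)
  then show ?thesis
    unfolding variation_seminorm_def
    by (intro SUP_cong refl arg_cong[where f = "\<lambda>x. epowr x (1 / \<sigma>)"] sum.cong) auto
qed

text \<open>Bernstein inequality for the variation space.  Only \<open>N\<close> members of a disjoint family
  contribute; interpolating \<open>t\<^sup>\<sigma>\<close> between a constant and \<open>t\<^sup>p\<close> at the mean height
  \<open>e = N\<^sup>-\<^sup>1\<^sup>/\<^sup>p \<bar>g\<bar>\<close> replaces Hoelder's inequality and costs a factor 2.\<close>

lemma variation_Bernstein:
  fixes S :: "('a \<Rightarrow> 'k::{real_normed_field, euclidean_space}) set"
  assumes S: "fun_space.subspace S" "S \<subseteq> borel_measurable M" and \<sigma>: "0 < \<sigma>" "\<sigma> < p"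
    and N: "1 \<le> N" and g: "g \<in> Sigma_n (C_dict F S) N"
    and gm: "g \<in> borel_measurable M"
  shows "variation_seminorm M F S p \<sigma> g
    \<le> ennreal (2 powr (1 / \<sigma>) * real N powr (1 / \<sigma> - 1 / p)) * Lp_norm M p g"
proof (cases "Lp_norm M p g")
  case top
  then show ?thesis using N by (simp add: ennreal_mult_top)
next
  case (real w)
  have p: "0 < p" using \<sigma> by simp
  show ?thesis
  proof (rule variation_seminorm_le[OF _ \<sigma>(1)])
    fix Q assume Q: "finite Q" "Q \<subseteq> regions" "disjoint Q"
    define Q' where "Q' = {R \<in> Q. local_error M S p g R \<noteq> 0}"
    define x where "x R = Lp_norm M p (restrict_fun g R)" for R
    have E: "local_error M S p g R \<le> x R" if "R \<in> Q" for R
      using local_error_le[of R M p 0 S g] that Q(2) regions_sets p fun_space.subspace_0[OF S(1)]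
      by (auto simp: x_def)
    have sumQ': "(\<Sum>R\<in>Q. epowr (local_error M S p g R) \<sigma>) = (\<Sum>R\<in>Q'. epowr (local_error M S p g R) \<sigma>)"
      unfolding Q'_def using Q(1) by (intro sum.mono_neutral_right) auto
    have "(\<Sum>R\<in>Q'. epowr (local_error M S p g R) \<sigma>) \<le> ennreal (2 * real N powr (1 - \<sigma> / p) * w powr \<sigma>)"
    proof (cases "w = 0")
      case True
      have "Q' = {}"
        using E Lp_norm_restrict_le[OF p, of M g] True real by (fastforce simp: Q'_def x_def)
      then show ?thesis by simp
    next
      case False
      then have w: "0 < w" using real by simp
      define e where "e = w * real N powr (- 1 / p)"
      have e: "0 < e" using w N by (simp add: e_def)
      have xp: "(\<Sum>R\<in>Q'. epowr (x R) p) \<le> ennreal (w powr p)"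
      proof -
        have "disjoint Q'" using Q(3) unfolding Q'_def disjoint_def by blast
        then have "(\<Sum>R\<in>Q'. epowr (x R) p) = epowr (Lp_norm M p (restrict_fun g (\<Union>Q'))) p"
          unfolding x_def using Q regions_sets
          by (intro Lp_norm_restrict_fun_partition p gm) (auto simp: Q'_def)
        also have "\<dots> \<le> epowr (Lp_norm M p g) p"
          using p by (intro epowr_mono Lp_norm_restrict_le) auto
        finally show ?thesis using real by (simp add: epowr_ennreal)
      qed
      have "(\<Sum>R\<in>Q'. epowr (local_error M S p g R) \<sigma>)
          \<le> (\<Sum>R\<in>Q'. ennreal (e powr \<sigma>) + ennreal (e powr (\<sigma> - p)) * epowr (x R) p)"
      proof (rule sum_mono)
        fix R assume "R \<in> Q'"
        then have "epowr (local_error M S p g R) \<sigma> \<le> epowr (x R) \<sigma>"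
          using E \<sigma> by (intro epowr_mono) (auto simp: Q'_def)
        also note epowr_le_interpolate[OF e \<sigma>]
        finally show "epowr (local_error M S p g R) \<sigma> \<le> ennreal (e powr \<sigma>) + ennreal (e powr (\<sigma> - p)) * epowr (x R) p" .
      qed
      also have "\<dots> = of_nat (card Q') * ennreal (e powr \<sigma>) + ennreal (e powr (\<sigma> - p)) * (\<Sum>R\<in>Q'. epowr (x R) p)"
        by (simp add: sum.distrib sum_distrib_left)
      also have "\<dots> \<le> of_nat N * ennreal (e powr \<sigma>) + ennreal (e powr (\<sigma> - p)) * ennreal (w powr p)"
        using card_nonzero_local_error[OF S(1) p g Q] xp
        by (intro add_mono mult_left_mono mult_right_mono) (auto simp: Q'_def)
      also have "\<dots> = ennreal (real N * e powr \<sigma> + e powr (\<sigma> - p) * w powr p)"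
        by (simp add: ennreal_of_nat_eq_real_of_nat flip: ennreal_mult ennreal_plus)
      also have "real N * e powr \<sigma> + e powr (\<sigma> - p) * w powr p = 2 * real N powr (1 - \<sigma> / p) * w powr \<sigma>"
      proof -
        have 1: "real N * e powr \<sigma> = real N powr (1 - \<sigma> / p) * w powr \<sigma>"
        proof -
          have "e powr \<sigma> = w powr \<sigma> * real N powr (- \<sigma> / p)"
            using w by (simp add: e_def powr_mult powr_powr)
          moreover have "real N powr 1 * real N powr (- \<sigma> / p) = real N powr (1 - \<sigma> / p)"
            unfolding powr_add[symmetric] by simp
          ultimately show ?thesis using N by (simp add: mult_ac)
        qed
        have 2: "e powr (\<sigma> - p) * w powr p = real N powr (1 - \<sigma> / p) * w powr \<sigma>"
        proof -
          have "e powr (\<sigma> - p) = w powr (\<sigma> - p) * real N powr (- 1 / p * (\<sigma> - p))"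
            using w by (simp add: e_def powr_mult powr_powr)
          moreover have "- 1 / p * (\<sigma> - p) = 1 - \<sigma> / p" using p by (simp add: field_simps)
          moreover have "w powr (\<sigma> - p) * w powr p = w powr \<sigma>"
            unfolding powr_add[symmetric] by simp
          ultimately show ?thesis by (simp add: mult_ac)
        qed
        show ?thesis using 1 2 by simp
      qed
      finally show ?thesis .
    qed
    also have "ennreal (2 * real N powr (1 - \<sigma> / p) * w powr \<sigma>)
       = epowr (ennreal (2 powr (1 / \<sigma>) * real N powr (1 / \<sigma> - 1 / p)) * Lp_norm M p g) \<sigma>"
    proof -
      have "(1 / \<sigma> - 1 / p) * \<sigma> = 1 - \<sigma> / p" using \<sigma> by (simp add: left_diff_distrib)
      then have "(2 powr (1 / \<sigma>) * real N powr (1 / \<sigma> - 1 / p)) powr \<sigma> = 2 * real N powr (1 - \<sigma> / p)"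
        using \<sigma> by (simp add: powr_mult powr_powr)
      then have "epowr (ennreal (2 powr (1 / \<sigma>) * real N powr (1 / \<sigma> - 1 / p))) \<sigma> = ennreal (2 * real N powr (1 - \<sigma> / p))"
        by (simp add: epowr_ennreal)
      moreover have "epowr (Lp_norm M p g) \<sigma> = ennreal (w powr \<sigma>)"
        using real by (simp add: epowr_ennreal)
      ultimately show ?thesis by (simp only: epowr_mult[OF \<sigma>(1)]) (simp add: ennreal_mult)
    qed
    finally show "(\<Sum>R\<in>Q. epowr (local_error M S p g R) \<sigma>)
      \<le> epowr (ennreal (2 powr (1 / \<sigma>) * real N powr (1 / \<sigma> - 1 / p)) * Lp_norm M p g) \<sigma>"
      unfolding sumQ' .
  qed
qed

text \<open>A substitute for the triangle inequality that works for every \<open>\<sigma> > 0\<close>.  Half of the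
  geometric weight bounds a sum of local errors by its largest weighted term, the other half sums
  the \<open>\<sigma>\<close>-th powers over \<open>j\<close>; the constant does not depend on \<open>n\<close>.\<close>

lemma variation_seminorm_geometric_sum:
  fixes S :: "('a \<Rightarrow> 'k::{real_normed_field, euclidean_space}) set"
  assumes S: "fun_space.subspace S" "S \<subseteq> borel_measurable M" and \<sigma>: "0 < \<sigma>" and p: "1 \<le> p"
    and x: "0 < x" "x < 1"
  obtains C :: real where "0 \<le> C"
    "\<And>n d s. (\<And>j. j \<le> n \<Longrightarrow> d j \<in> borel_measurable M) \<Longrightarrow>
       (\<And>j. j \<le> n \<Longrightarrow> variation_seminorm M F S p \<sigma> (d j) \<le> ennreal (x ^ (n - j)) * s) \<Longrightarrow>
       variation_seminorm M F S p \<sigma> (\<Sum>j\<le>n. d j) \<le> ennreal C * s"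
proof -
  \<comment> \<open>Each of the two halves of the weight is a power of the square root.\<close>
  define y where "y = sqrt x"
  have y: "0 < y" "y < 1" "y * y = x" using x by (auto simp: y_def)
  define t where "t = y powr \<sigma>"
  have t: "0 \<le> t" "t < 1" using y \<sigma> by (auto simp: t_def powr01_less_one)
  define K where "K = (\<Sum>i. ennreal (y ^ i))"
  define L where "L = (\<Sum>i. ennreal (t ^ i))"
  have K: "K < \<top>" unfolding K_def using y by (intro ennreal_geometric_suminf) auto
  have L: "L < \<top>" unfolding L_def by (rule ennreal_geometric_suminf[OF t])
  have rev: "(\<Sum>j\<le>n. ennreal (z ^ (n - j))) \<le> (\<Sum>i. ennreal (z ^ i))" for z :: real and n
  proof -
    have "(\<Sum>j\<le>n. ennreal (z ^ (n - j))) = (\<Sum>i\<le>n. ennreal (z ^ i))"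
      by (rule sum.reindex_bij_witness[of _ "\<lambda>i. n - i" "\<lambda>i. n - i"]) auto
    also have "\<dots> \<le> (\<Sum>i. ennreal (z ^ i))" by (intro sum_le_suminf) auto
    finally show ?thesis .
  qed
  have inv: "ennreal (y ^ i) * ennreal ((1 / y) ^ i) = 1" for i
    using y by (simp add: power_divide flip: ennreal_mult)
  have key: "variation_seminorm M F S p \<sigma> (\<Sum>j\<le>n. d j) \<le> K * epowr L (1 / \<sigma>) * s"
    if dm: "\<And>j. j \<le> n \<Longrightarrow> d j \<in> borel_measurable M"
      and d: "\<And>j. j \<le> n \<Longrightarrow> variation_seminorm M F S p \<sigma> (d j) \<le> ennreal (x ^ (n - j)) * s" for n d s
  proof (rule variation_seminorm_le[OF _ \<sigma>])
    fix Q assume Q: "finite Q" "Q \<subseteq> regions" "disjoint Q"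
    define E where "E j R = local_error M S p (d j) R" for j R
    define b where "b j R = ennreal ((1 / y) ^ (n - j)) * E j R" for j R
    have "epowr (local_error M S p (\<Sum>j\<le>n. d j) R) \<sigma> \<le> epowr K \<sigma> * (\<Sum>j\<le>n. epowr (b j R) \<sigma>)"
      if R: "R \<in> Q" for R
    proof -
      have "local_error M S p (\<Sum>j\<le>n. d j) R \<le> (\<Sum>j\<le>n. E j R)"
        unfolding E_def using R Q(2) dm by (intro local_error_sum_le p S regions_sets) auto
      also have "\<dots> = (\<Sum>j\<le>n. ennreal (y ^ (n - j)) * b j R)"
        unfolding b_def mult.assoc[symmetric] inv by simp
      also have "\<dots> \<le> (\<Sum>j\<le>n. ennreal (y ^ (n - j)) * (SUP j\<in>{..n}. b j R))"
        by (intro sum_mono mult_left_mono SUP_upper) auto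
      also have "\<dots> = (\<Sum>j\<le>n. ennreal (y ^ (n - j))) * (SUP j\<in>{..n}. b j R)"
        by (simp add: sum_distrib_right)
      also have "\<dots> \<le> K * (SUP j\<in>{..n}. b j R)"
        unfolding K_def by (intro mult_right_mono rev) simp
      finally have "epowr (local_error M S p (\<Sum>j\<le>n. d j) R) \<sigma> \<le> epowr (K * (SUP j\<in>{..n}. b j R)) \<sigma>"
        using \<sigma> by (intro epowr_mono) auto
      also have "\<dots> \<le> epowr K \<sigma> * (\<Sum>j\<le>n. epowr (b j R) \<sigma>)"
        unfolding epowr_mult[OF \<sigma>] using \<sigma> by (intro mult_left_mono epowr_SUP_le_sum) auto
      finally show ?thesis .
    qed
    then have "(\<Sum>R\<in>Q. epowr (local_error M S p (\<Sum>j\<le>n. d j) R) \<sigma>)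
        \<le> (\<Sum>R\<in>Q. epowr K \<sigma> * (\<Sum>j\<le>n. epowr (b j R) \<sigma>))" by (rule sum_mono)
    also have "\<dots> = epowr K \<sigma> * (\<Sum>j\<le>n. \<Sum>R\<in>Q. epowr (b j R) \<sigma>)"
      unfolding sum_distrib_left[symmetric] by (subst sum.swap) (rule refl)
    also have "\<dots> \<le> epowr K \<sigma> * (\<Sum>j\<le>n. ennreal (t ^ (n - j)) * epowr s \<sigma>)"
    proof (intro mult_left_mono sum_mono)
      fix j assume "j \<in> {..n}"
      then have j: "j \<le> n" by simp
      have "(\<Sum>R\<in>Q. epowr (b j R) \<sigma>) = epowr (ennreal ((1 / y) ^ (n - j))) \<sigma> * (\<Sum>R\<in>Q. epowr (E j R) \<sigma>)"
        unfolding b_def epowr_mult[OF \<sigma>] by (simp add: sum_distrib_left)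
      also have "\<dots> \<le> epowr (ennreal ((1 / y) ^ (n - j))) \<sigma> * epowr (variation_seminorm M F S p \<sigma> (d j)) \<sigma>"
        unfolding E_def by (intro mult_left_mono variation_seminorm_ge Q \<sigma>) simp
      also have "\<dots> \<le> epowr (ennreal ((1 / y) ^ (n - j))) \<sigma> * epowr (ennreal (x ^ (n - j)) * s) \<sigma>"
        using \<sigma> by (intro mult_left_mono epowr_mono d j) auto
      also have "\<dots> = epowr (ennreal (y ^ (n - j)) * s) \<sigma>"
      proof -
        have "(1 / y) ^ (n - j) * x ^ (n - j) = y ^ (n - j)"
          using y(1) unfolding y(3)[symmetric] power_mult_distrib[symmetric] by simp
        then have "ennreal ((1 / y) ^ (n - j)) * ennreal (x ^ (n - j)) = ennreal (y ^ (n - j))"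
          using y(1) x(1) by (simp add: ennreal_mult[symmetric])
        then show ?thesis unfolding epowr_mult[OF \<sigma>, symmetric] by (simp add: mult.assoc[symmetric])
      qed
      also have "\<dots> = ennreal (t ^ (n - j)) * epowr s \<sigma>"
      proof -
        have "(y ^ (n - j)) powr \<sigma> = t ^ (n - j)"
          using y(1) by (simp add: t_def powr_realpow[symmetric] powr_powr mult.commute)
        then show ?thesis using y(1) by (simp add: epowr_mult[OF \<sigma>] epowr_ennreal)
      qed
      finally show "(\<Sum>R\<in>Q. epowr (b j R) \<sigma>) \<le> ennreal (t ^ (n - j)) * epowr s \<sigma>" .
    qed simp
    also have "\<dots> = epowr K \<sigma> * ((\<Sum>j\<le>n. ennreal (t ^ (n - j))) * epowr s \<sigma>)"
      by (simp add: sum_distrib_right)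
    also have "\<dots> \<le> epowr K \<sigma> * (L * epowr s \<sigma>)"
      unfolding L_def by (intro mult_left_mono mult_right_mono rev) auto
    also have "\<dots> = epowr (K * epowr L (1 / \<sigma>) * s) \<sigma>"
      using \<sigma> by (simp add: epowr_mult epowr_inverse mult.assoc)
    finally show "(\<Sum>R\<in>Q. epowr (local_error M S p (\<Sum>j\<le>n. d j) R) \<sigma>) \<le> epowr (K * epowr L (1 / \<sigma>) * s) \<sigma>" .
  qed
  have "K * epowr L (1 / \<sigma>) < \<top>"
    using K L by (simp add: ennreal_mult_less_top epowr_less_top_iff)
  then have "K * epowr L (1 / \<sigma>) = ennreal (enn2real (K * epowr L (1 / \<sigma>)))" by simp
  then show thesis using key that[of "enn2real (K * epowr L (1 / \<sigma>))"] by (metis enn2real_nonneg)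
qed

end

section \<open>A Jackson inequality for the dictionary\<close>

context nuary_filtration
begin

text \<open>State of a greedy bottom-up subdivision of an atom \<open>A\<close> with respect to a set function \<open>E\<close>:
  \<open>B\<close> is the part that has been cut into good pieces \<open>P\<close>, the rest \<open>A - B\<close> is empty or still a
  single good region, and \<open>Q\<close> is a disjoint family of bad regions that pays for the pieces.  The extra
  \<open>\<nu>\<close> pieces credited to a nonempty \<open>B\<close> are what makes the bound survive a branching.\<close>

definition subdivision ::
    "('a set \<Rightarrow> ennreal) \<Rightarrow> ennreal \<Rightarrow> 'a set \<Rightarrow> 'a set \<Rightarrow> 'a set set \<Rightarrow> 'a set set \<Rightarrow> bool" where
  "subdivision E \<epsilon> A B P Q \<longleftrightarrow>
     (B = {} \<or> B \<in> all_atoms F) \<and> B \<subseteq> A \<and> E (A - B) \<le> \<epsilon> \<and>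
     finite P \<and> P \<subseteq> regions \<and> disjoint P \<and> \<Union>P = B \<and> (\<forall>R\<in>P. E R \<le> \<epsilon>) \<and>
     finite Q \<and> Q \<subseteq> regions \<and> disjoint Q \<and> \<Union>Q \<subseteq> B \<and> (\<forall>R\<in>Q. \<epsilon> < E R) \<and>
     card P + (if B = {} then 0 else \<nu>) \<le> 2 * \<nu> * card Q"

lemma subdivisionD:
  assumes "subdivision E \<epsilon> A B P Q"
  shows "B = {} \<or> B \<in> all_atoms F" "B \<subseteq> A" "E (A - B) \<le> \<epsilon>"
    "finite P" "P \<subseteq> regions" "disjoint P" "\<Union>P = B" "\<forall>R\<in>P. E R \<le> \<epsilon>"
    "finite Q" "Q \<subseteq> regions" "disjoint Q" "\<Union>Q \<subseteq> B" "\<forall>R\<in>Q. \<epsilon> < E R"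
    "card P + (if B = {} then 0 else \<nu>) \<le> 2 * \<nu> * card Q"
  using assms by (simp_all add: subdivision_def)

text \<open>The subdivisions of the children \<open>u\<close> of \<open>A\<close> are merged.  If at most one of them has
  a nonempty cut part \<open>b u\<close> and \<open>A\<close> minus this part is still good, nothing is cut.  Otherwise all
  nonempty rests \<open>u - b u\<close>, at most \<open>\<nu>\<close> many, become pieces.  They are paid for by the new bad
  region, or else by the credits of two children.\<close>

lemma subdivision_step:
  assumes E0: "E {} \<le> \<epsilon>" and A: "A \<in> all_atoms F"
    and U: "U \<subseteq> atoms_of (F n)" "finite U" "card U \<le> \<nu>" "A = \<Union>U"
    and sub: "\<And>u. u \<in> U \<Longrightarrow> subdivision E \<epsilon> u (b u) (P u) (Q u)"
  shows "\<exists>B P Q. subdivision E \<epsilon> A B P Q"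
proof -
  have b: "b u = {} \<or> b u \<in> all_atoms F" "b u \<subseteq> u" "E (u - b u) \<le> \<epsilon>"
    and Pu: "finite (P u)" "P u \<subseteq> regions" "disjoint (P u)" "\<Union>(P u) = b u" "\<forall>R\<in>P u. E R \<le> \<epsilon>"
    and Qu: "finite (Q u)" "Q u \<subseteq> regions" "disjoint (Q u)" "\<Union>(Q u) \<subseteq> b u" "\<forall>R\<in>Q u. \<epsilon> < E R"
    and cu: "card (P u) + (if b u = {} then 0 else \<nu>) \<le> 2 * \<nu> * card (Q u)" if "u \<in> U" for u
    by (rule subdivisionD[OF sub[OF that]])+
  have Udisj: "u \<inter> u' = {}" if "u \<in> U" "u' \<in> U" "u \<noteq> u'" for u u'
    using atoms_disjoint[of n] U(1) that unfolding disjoint_def by blast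
  have Uatom: "u \<in> all_atoms F" if "u \<in> U" for u using U(1) that by (auto simp: all_atoms_def)
  define b0 where "b0 = (\<Union>u\<in>U. b u)"
  define P0 where "P0 = (\<Union>u\<in>U. P u)"
  define W where "W = (\<lambda>u. u - b u) ` {u \<in> U. b u \<noteq> u}"
  define Q0 where "Q0 = (\<Union>u\<in>U. Q u)"
  have finW: "finite W" using U(2) by (simp add: W_def)
  have P0: "finite P0" "P0 \<subseteq> regions" "\<Union>P0 = b0" "\<forall>R\<in>P0. E R \<le> \<epsilon>"
  proof -
    show "finite P0" unfolding P0_def using U(2) Pu(1) by (rule finite_UN_I)
    show "P0 \<subseteq> regions" unfolding P0_def using Pu(2) by (rule UN_least)
    have "\<Union>P0 = (\<Union>u\<in>U. \<Union>(P u))" unfolding P0_def by blast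
    then show "\<Union>P0 = b0" unfolding b0_def using Pu(4) by simp
    show "\<forall>R\<in>P0. E R \<le> \<epsilon>" unfolding P0_def using Pu(5) by blast
  qed
  have P0_disj: "disjoint P0"
    unfolding P0_def using Pu(3)
  proof (rule disjoint_UN)
    have "\<Union>(P u) \<subseteq> u" if "u \<in> U" for u using Pu(4)[OF that] b(2)[OF that] by blast
    then show "disjoint_family_on (\<lambda>u. \<Union>(P u)) U"
      using Udisj unfolding disjoint_family_on_def by blast
  qed
  have W: "W \<subseteq> regions" "\<forall>R\<in>W. E R \<le> \<epsilon>" "\<Union>W = A - b0"
  proof -
    have "u - b u \<in> regions" if "u \<in> U" "b u \<noteq> u" for u
    proof (cases "b u = {}")
      case True then show ?thesis using Uatom[OF that(1)] by (simp add: regions_def)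
    next
      case False
      then show ?thesis using b(1,2)[OF that(1)] that Uatom[OF that(1)] unfolding regions_def rings_def by blast
    qed
    then show "W \<subseteq> regions" unfolding W_def by blast
    show "\<forall>R\<in>W. E R \<le> \<epsilon>" using b(3) unfolding W_def by blast
    have "u - b u = u - b0" if "u \<in> U" for u
      using Udisj[OF that] b(2) that unfolding b0_def by blast
    then show "\<Union>W = A - b0" unfolding W_def U(4) b0_def by blast
  qed
  have W_disj: "disjoint W"
    unfolding disjoint_def W_def using Udisj by blast
  have P1: "disjoint (P0 \<union> W)"
    using P0_disj W_disj P0(3) W(3) unfolding disjoint_def by blast
  have Q0: "finite Q0" "Q0 \<subseteq> regions" "\<Union>Q0 \<subseteq> b0" "\<forall>R\<in>Q0. \<epsilon> < E R"
  proof -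
    show "finite Q0" unfolding Q0_def using U(2) Qu(1) by (rule finite_UN_I)
    show "Q0 \<subseteq> regions" unfolding Q0_def using Qu(2) by (rule UN_least)
    show "\<Union>Q0 \<subseteq> b0" unfolding Q0_def b0_def using Qu(4) by blast
    show "\<forall>R\<in>Q0. \<epsilon> < E R" unfolding Q0_def using Qu(5) by blast
  qed
  have Q0_disj: "disjoint Q0"
    unfolding Q0_def using Qu(3)
  proof (rule disjoint_UN)
    have "\<Union>(Q u) \<subseteq> u" if "u \<in> U" for u using Qu(4)[OF that] b(2)[OF that] by blast
    then show "disjoint_family_on (\<lambda>u. \<Union>(Q u)) U"
      using Udisj unfolding disjoint_family_on_def by blast
  qed
  have card_Q0: "card Q0 = (\<Sum>u\<in>U. card (Q u))"
    unfolding Q0_def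
  proof (rule card_UN_disjoint[OF U(2)])
    show "\<forall>u\<in>U. finite (Q u)" using Qu(1) by blast
    show "\<forall>u\<in>U. \<forall>u'\<in>U. u \<noteq> u' \<longrightarrow> Q u \<inter> Q u' = {}"
    proof (intro ballI impI, rule ccontr)
      fix u u' assume u: "u \<in> U" "u' \<in> U" "u \<noteq> u'" and "Q u \<inter> Q u' \<noteq> {}"
      then obtain R where R: "R \<in> Q u" "R \<in> Q u'" by blast
      then have "R \<subseteq> u" "R \<subseteq> u'" "R \<noteq> {}" using Qu(2,4) b(2) u region_nonempty by blast+
      then show False using Udisj[OF u] by blast
    qed
  qed
  define credit where "credit = (\<Sum>u\<in>U. if b u = {} then 0 else \<nu>)"
  have card_P0: "card P0 \<le> (\<Sum>u\<in>U. card (P u))" unfolding P0_def by (rule card_UN_le[OF U(2)])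
  have "card W \<le> card {u \<in> U. b u \<noteq> u}" unfolding W_def using U(2) by (intro card_image_le) auto
  also have "\<dots> \<le> card U" using U(2) by (intro card_mono) auto
  finally have "card W \<le> \<nu>" using U(3) by simp
  then have card_P1: "card (P0 \<union> W) \<le> (\<Sum>u\<in>U. card (P u)) + \<nu>"
    using card_Un_le[of P0 W] card_P0 by linarith
  have "(\<Sum>u\<in>U. card (P u) + (if b u = {} then 0 else \<nu>)) \<le> (\<Sum>u\<in>U. 2 * \<nu> * card (Q u))"
    by (rule sum_mono) (rule cu)
  then have budget: "(\<Sum>u\<in>U. card (P u)) + credit \<le> 2 * \<nu> * card Q0"
    unfolding card_Q0 credit_def by (simp add: sum.distrib sum_distrib_left)
  have credit_eq: "credit = \<nu> * card {u \<in> U. b u \<noteq> {}}"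
  proof -
    have "credit = (\<Sum>u\<in>{u \<in> U. b u \<noteq> {}}. \<nu>)"
      unfolding credit_def using U(2) by (intro sum.mono_neutral_cong_right) auto
    then show ?thesis by simp
  qed
  have b0_sub: "b0 \<subseteq> A" using b(2) unfolding b0_def U(4) by blast
  have cover: "\<Union>(P0 \<union> W) = A" using b0_sub P0(3) W(3) by blast
  have Q0_A: "\<Union>Q0 \<subseteq> A" using b0_sub Q0(3) by blast
  have A_ne: "A \<noteq> {}" by (rule all_atoms_nonempty[OF A])
  show ?thesis
  proof (cases "2 \<le> card {u \<in> U. b u \<noteq> {}}")
    case True
    have "2 * \<nu> \<le> credit" unfolding credit_eq using True by simp
    then have "card (P0 \<union> W) + \<nu> \<le> 2 * \<nu> * card Q0" using card_P1 budget by linarith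
    then have "subdivision E \<epsilon> A A (P0 \<union> W) Q0"
      unfolding subdivision_def
      using A A_ne E0 P0 finW W(1,2) P1 cover Q0 Q0_disj Q0_A by (simp add: ball_Un)
    then show ?thesis by blast
  next
    case False
    then have "card {u \<in> U. b u \<noteq> {}} \<le> Suc 0" by simp
    then have one: "u = u'" if "u \<in> U" "u' \<in> U" "b u \<noteq> {}" "b u' \<noteq> {}" for u u'
      using that U(2) by (simp add: card_le_Suc0_iff_eq)
    have b0_cases: "b0 = {} \<or> b0 \<in> all_atoms F"
    proof (cases "\<exists>u\<in>U. b u \<noteq> {}")
      case True
      then obtain u where u: "u \<in> U" "b u \<noteq> {}" by blast
      then have "b0 = b u" unfolding b0_def using one[OF u(1) _ u(2)] by blast
      then show ?thesis using b(1)[OF u(1)] by simp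
    next
      case False then show ?thesis unfolding b0_def by blast
    qed
    show ?thesis
    proof (cases "E (A - b0) \<le> \<epsilon>")
      case True
      have "(if b0 = {} then 0 else \<nu>) \<le> credit"
      proof (cases "b0 = {}")
        case False
        then have "{u \<in> U. b u \<noteq> {}} \<noteq> {}" unfolding b0_def by blast
        then have "1 \<le> card {u \<in> U. b u \<noteq> {}}" using U(2) by (simp add: Suc_le_eq card_gt_0_iff)
        then show ?thesis unfolding credit_eq by simp
      qed simp
      then have "card P0 + (if b0 = {} then 0 else \<nu>) \<le> 2 * \<nu> * card Q0"
        using card_P0 budget by linarith
      then have "subdivision E \<epsilon> A b0 P0 Q0"
        unfolding subdivision_def using b0_cases b0_sub True P0 P0_disj Q0 Q0_disj by blast
      then show ?thesis by blast
    next
      case False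
      define R where "R = A - b0"
      have bad: "\<epsilon> < E R" using False by (simp add: R_def)
      then have "R \<noteq> {}" using E0 by auto
      then have reg: "R \<in> regions"
        using b0_cases b0_sub A unfolding R_def regions_def rings_def by auto
      have "R \<notin> Q0" using Q0(3) \<open>R \<noteq> {}\<close> unfolding R_def by blast
      then have "card (insert R Q0) = Suc (card Q0)" using Q0(1) by simp
      then have "card (P0 \<union> W) + \<nu> \<le> 2 * \<nu> * card (insert R Q0)" using card_P1 budget by simp
      moreover have "disjoint (insert R Q0)"
        using Q0_disj Q0(3) unfolding R_def disjoint_def by blast
      moreover have "\<Union>(insert R Q0) \<subseteq> A" using Q0(3) b0_sub unfolding R_def by blast
      ultimately have "subdivision E \<epsilon> A A (P0 \<union> W) (insert R Q0)"
        unfolding subdivision_def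
        using A A_ne E0 P0 finW W(1,2) P1 cover Q0 reg bad by (simp add: ball_Un)
      then show ?thesis by blast
    qed
  qed
qed

lemma subdivision_exists:
  fixes E :: "'a set \<Rightarrow> ennreal"
  assumes E0: "E {} \<le> \<epsilon>" and good: "\<And>A. A \<in> atoms_of (F n) \<Longrightarrow> E A \<le> \<epsilon>"
  shows "k + d = n \<Longrightarrow> A \<in> atoms_of (F k) \<Longrightarrow> \<exists>B P Q. subdivision E \<epsilon> A B P Q"
proof (induction d arbitrary: k A)
  case 0
  have "subdivision E \<epsilon> A {} {} {}"
    using good[of A] 0 by (simp add: subdivision_def disjoint_def)
  then show ?case by blast
next
  case (Suc d)
  obtain U where U: "U \<subseteq> atoms_of (F (Suc k))" "finite U" "card U \<le> \<nu>" "A = \<Union>U"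
    using refine[OF Suc.prems(2)] by blast
  have "\<forall>u\<in>U. \<exists>B P Q. subdivision E \<epsilon> u B P Q"
    using Suc.IH[of "Suc k"] Suc.prems(1) U(1) by auto
  then obtain b P Q where sub: "\<And>u. u \<in> U \<Longrightarrow> subdivision E \<epsilon> u (b u) (P u) (Q u)"
    by metis
  have A: "A \<in> all_atoms F" using Suc.prems(2) by (auto simp: all_atoms_def)
  show ?case by (rule subdivision_step[where b = b and P = P and Q = Q, OF E0 A U sub])
qed

text \<open>The rest left uncut in the whole space counts as one more piece.\<close>

lemma good_partition_exists:
  fixes E :: "'a set \<Rightarrow> ennreal"
  assumes E0: "E {} \<le> \<epsilon>" and good: "\<And>A. A \<in> atoms_of (F n) \<Longrightarrow> E A \<le> \<epsilon>"
  obtains P Q where "finite P" "P \<subseteq> regions" "disjoint P" "\<Union>P = space M" "\<And>R. R \<in> P \<Longrightarrow> E R \<le> \<epsilon>"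
    "finite Q" "Q \<subseteq> regions" "disjoint Q" "\<And>R. R \<in> Q \<Longrightarrow> \<epsilon> < E R" "card P \<le> 2 * \<nu> * card Q + 1"
proof -
  have "space M \<in> atoms_of (F 0)" by (simp add: atoms_of_F0)
  then obtain B P Q where "subdivision E \<epsilon> (space M) B P Q"
    using subdivision_exists[where E = E and \<epsilon> = \<epsilon> and n = n and k = 0 and d = n, OF E0 good] by (metis add_0)
  then have B: "B = {} \<or> B \<in> all_atoms F" "B \<subseteq> space M" "E (space M - B) \<le> \<epsilon>"
    and P: "finite P" "P \<subseteq> regions" "disjoint P" "\<Union>P = B" "\<And>R. R \<in> P \<Longrightarrow> E R \<le> \<epsilon>"
    and Q: "finite Q" "Q \<subseteq> regions" "disjoint Q" "\<And>R. R \<in> Q \<Longrightarrow> \<epsilon> < E R"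
    and card: "card P \<le> 2 * \<nu> * card Q"
    unfolding subdivision_def by auto
  show thesis
  proof (cases "B = space M")
    case True
    show thesis by (rule that[OF P(1-3) _ P(5) Q]) (use True P(4) card in simp_all)
  next
    case False
    have reg: "space M - B \<in> regions"
      using B(1,2) False space_in_all_atoms unfolding regions_def rings_def by auto
    have "card (insert (space M - B) P) \<le> 2 * \<nu> * card Q + 1"
      using card P(1) card_insert_le_m1[of "Suc (card P)" P "space M - B"] by (simp add: card_insert_if)
    moreover have "disjoint (insert (space M - B) P)"
      using P(3,4) unfolding disjoint_def by blast
    moreover have "\<Union>(insert (space M - B) P) = space M" using P(4) B(2) by blast
    ultimately show thesis
      using that[of "insert (space M - B) P" Q] P(1,2,5) reg B(3) Q by auto
  qed
qed

lemma span_C_dict_piecewise: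
  fixes S :: "('a \<Rightarrow> 'k::{real_normed_field, euclidean_space}) set"
  assumes S: "S = fun_space.span B" and g: "g \<in> fun_space.span (C_dict F S)"
  shows "\<exists>n. g \<in> piecewise_space F S n"
  using g
proof (induction rule: fun_space.span_induct_alt)
  case base
  show ?case using fun_space.subspace_0[OF piecewise_space_subspace[OF S]] by blast
next
  case (step c x y)
  obtain f A m where x: "x = restrict_fun f A" "f \<in> S" "A \<in> atoms_of (F m)"
    using step(1) by (auto simp: C_dict_def all_atoms_def)
  obtain n where y: "y \<in> piecewise_space F S n" using step by blast
  have "x \<in> piecewise_space F S (max m n)" "y \<in> piecewise_space F S (max m n)"
    using restrict_fun_piecewise[OF S x(2,3)] y x(1)
      piecewise_space_mono[of m "max m n" S] piecewise_space_mono[of n "max m n" S] by auto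
  then have "fscale c x + y \<in> piecewise_space F S (max m n)"
    by (intro fun_space.subspace_add fun_space.subspace_scale piecewise_space_subspace[OF S])
  then show ?case by blast
qed

lemma restrict_region_in_Sigma:
  fixes S :: "('a \<Rightarrow> 'k::{real_normed_field, euclidean_space}) set"
  assumes "h \<in> S" "R \<in> regions"
  shows "restrict_fun h R \<in> Sigma_n (C_dict F S) 2"
proof (cases "R \<in> all_atoms F")
  case True
  then have "restrict_fun h R \<in> Sigma_n (C_dict F S) 1"
    using assms(1) by (intro Sigma_n_base) (auto simp: C_dict_def)
  then show ?thesis by (rule Sigma_n_mono) simp
next
  case False
  then obtain X Y where R: "R = X - Y" "X \<in> all_atoms F" "Y \<in> all_atoms F" "Y \<subset> X"
    using assms(2) by (auto simp: regions_def rings_def)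
  have "restrict_fun h R = restrict_fun h X - restrict_fun h Y"
    using R by (auto simp: restrict_fun_def fun_eq_iff split: split_indicator)
  moreover have "restrict_fun h X - restrict_fun h Y \<in> Sigma_n (C_dict F S) (1 + 1)"
    using assms(1) R by (intro Sigma_n_diff Sigma_n_base) (auto simp: C_dict_def)
  ultimately show ?thesis by (simp add: numeral_2_eq_2)
qed

text \<open>Jackson inequality for the dictionary: at the threshold \<open>v N\<^sup>-\<^sup>1\<^sup>/\<^sup>\<sigma>\<close> at most \<open>N\<close> disjoint
  regions can be bad, so the good partition has \<open>O(N)\<close> pieces, and on each of them \<open>f\<close> is
  replaced by an almost best approximation from \<open>S\<close>.\<close>

lemma variation_Jackson_dict:
  assumes S: "admissible_space M F S" and f: "f \<in> LpS M F S p" and \<sigma>: "0 < \<sigma>" and p: "1 \<le> p"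
    and v: "0 < v" "variation_seminorm M F S p \<sigma> f \<le> ennreal v" and N: "1 \<le> N"
  shows "\<exists>g\<in>Sigma_n (C_dict F S) (2 * (2 * \<nu> * N + 1)).
     Lp_norm M p (f - g) \<le> ennreal (2 * real (2 * \<nu> + 1) powr (1 / p) * v * real N powr (1 / p - 1 / \<sigma>))"
proof -
  have p0: "0 < p" using p by simp
  obtain Bs where Bs: "S = fun_space.span Bs" using S by (auto simp: admissible_space_def)
  have sub: "fun_space.subspace S" unfolding Bs by (rule fun_space.subspace_span)
  have fm: "f \<in> borel_measurable M" using f by (auto simp: LpS_def Lp_def)
  have Sm: "h \<in> borel_measurable M" if "h \<in> S" for h using S that by (auto simp: admissible_space_def)
  define \<epsilon> where "\<epsilon> = v * real N powr (- 1 / \<sigma>)"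
  have \<epsilon>: "0 < \<epsilon>" using v N by (simp add: \<epsilon>_def)
  define E where "E R = local_error M S p f R" for R
  obtain g0 where g0: "g0 \<in> fun_space.span (C_dict F S)" "Lp_norm M p (f - g0) < ennreal \<epsilon>"
    using f \<epsilon> unfolding LpS_def by blast
  obtain n where n: "g0 \<in> piecewise_space F S n" using span_C_dict_piecewise[OF Bs g0(1)] by blast
  \<comment> \<open>A function of the span is in \<open>S\<close> on each atom of a fine enough level.\<close>
  have good: "E A \<le> ennreal \<epsilon>" if A: "A \<in> atoms_of (F n)" for A
  proof -
    obtain s where s: "s \<in> S" "\<forall>\<omega>\<in>A. g0 \<omega> = s \<omega>" using n A unfolding piecewise_space_def by blast
    have "A \<in> sets M" using A sets_F_subset atom_sets_F by blast
    then have "E A \<le> Lp_norm M p (restrict_fun (f - s) A)"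
      unfolding E_def by (rule local_error_le[OF _ p0 s(1)])
    also have "restrict_fun (f - s) A = restrict_fun (f - g0) A"
      using s(2) by (auto simp: restrict_fun_def fun_eq_iff split: split_indicator)
    also have "Lp_norm M p (restrict_fun (f - g0) A) \<le> Lp_norm M p (f - g0)"
      by (rule Lp_norm_restrict_le[OF p0])
    finally show ?thesis using g0(2) by simp
  qed
  have E0: "E {} \<le> ennreal \<epsilon>"
    unfolding E_def using local_error_eq_0[of "{}" M p 0 S f] p0 fun_space.subspace_0[OF sub] by simp
  obtain P Q where P: "finite P" "P \<subseteq> regions" "disjoint P" "\<Union>P = space M" "\<And>R. R \<in> P \<Longrightarrow> E R \<le> ennreal \<epsilon>"
    and Q: "finite Q" "Q \<subseteq> regions" "disjoint Q" "\<And>R. R \<in> Q \<Longrightarrow> ennreal \<epsilon> < E R"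
    and card: "card P \<le> 2 * \<nu> * card Q + 1"
    using good_partition_exists[where E = E and \<epsilon> = "ennreal \<epsilon>" and n = n, OF E0 good] by metis
  have "card Q \<le> N"
  proof -
    have "ennreal (real (card Q) * (v powr \<sigma> / real N)) = (\<Sum>R\<in>Q. epowr (ennreal \<epsilon>) \<sigma>)"
    proof -
      have "\<epsilon> powr \<sigma> = v powr \<sigma> / real N"
        using v N \<sigma> by (simp add: \<epsilon>_def powr_divide powr_powr powr_minus_divide)
      then show ?thesis using \<epsilon> v
        by (simp add: epowr_ennreal ennreal_of_nat_eq_real_of_nat flip: ennreal_mult)
    qed
    also have "\<dots> \<le> (\<Sum>R\<in>Q. epowr (E R) \<sigma>)"
      using Q(4) \<sigma> by (intro sum_mono epowr_mono less_imp_le)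
    also have "\<dots> \<le> epowr (variation_seminorm M F S p \<sigma> f) \<sigma>"
      unfolding E_def by (rule variation_seminorm_ge[OF Q(1-3) \<sigma>])
    also have "\<dots> \<le> epowr (ennreal v) \<sigma>" using v \<sigma> by (intro epowr_mono) auto
    also have "\<dots> = ennreal (v powr \<sigma>)" using v by (simp add: epowr_ennreal)
    finally have "real (card Q) * (v powr \<sigma> / real N) \<le> v powr \<sigma>" by simp
    then show ?thesis using v N by (simp add: field_simps)
  qed
  then have "2 * \<nu> * card Q + 1 \<le> 2 * \<nu> * N + 1" by simp
  then have card_P: "card P \<le> 2 * \<nu> * N + 1" using card by (rule order_trans[rotated])
  \<comment> \<open>The factor 2 makes up for an infimum that need not be attained.\<close>
  have "\<exists>h\<in>S. Lp_norm M p (restrict_fun (f - h) R) < ennreal (2 * \<epsilon>)" if R: "R \<in> P" for R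
  proof -
    have "E R < ennreal (2 * \<epsilon>)" using P(5)[OF R] by (rule le_less_trans) (use \<epsilon> in \<open>simp add: ennreal_less_iff\<close>)
    moreover have "R \<in> sets M" using R P(2) regions_sets by blast
    ultimately show ?thesis unfolding E_def by (simp only: local_error_eq_INF[OF _ p0] INF_less_iff)
  qed
  then obtain h where h: "\<And>R. R \<in> P \<Longrightarrow> h R \<in> S" "\<And>R. R \<in> P \<Longrightarrow> Lp_norm M p (restrict_fun (f - h R) R) < ennreal (2 * \<epsilon>)"
    by metis
  define g where "g = (\<Sum>R\<in>P. restrict_fun (h R) R)"
  have "g \<in> Sigma_n (C_dict F S) (\<Sum>R\<in>P. 2)"
    unfolding g_def using P(2) h(1) by (intro Sigma_n_sum P(1) restrict_region_in_Sigma) auto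
  then have g: "g \<in> Sigma_n (C_dict F S) (2 * (2 * \<nu> * N + 1))"
    by (rule Sigma_n_mono) (use card_P in simp)
  have gm: "g \<in> borel_measurable M" by (rule Sigma_n_measurable[OF C_dict_measurable[OF S] g])
  have fg: "restrict_fun (f - g) R = restrict_fun (f - h R) R" if R: "R \<in> P" for R
  proof
    fix \<omega>
    have "\<omega> \<in> R \<Longrightarrow> g \<omega> = h R \<omega>"
      unfolding g_def by (rule sum_restrict_fun_disjoint[OF P(1,3) R])
    then show "restrict_fun (f - g) R \<omega> = restrict_fun (f - h R) R \<omega>"
      by (simp add: restrict_fun_def split: split_indicator)
  qed
  have "epowr (Lp_norm M p (f - g)) p = epowr (Lp_norm M p (restrict_fun (f - g) (\<Union>P))) p"
    unfolding P(4) by (intro arg_cong[where f = "\<lambda>x. epowr x p"] Lp_norm_cong_AE p0 AE_I2) (simp add: restrict_fun_def)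
  also have "\<dots> = (\<Sum>R\<in>P. epowr (Lp_norm M p (restrict_fun (f - g) R)) p)"
    using P fm gm regions_sets
    by (intro Lp_norm_restrict_fun_partition[symmetric] p0) (auto simp: fun_diff_def)
  also have "\<dots> \<le> (\<Sum>R\<in>P. epowr (ennreal (2 * \<epsilon>)) p)"
  proof (rule sum_mono)
    fix R assume R: "R \<in> P"
    then show "epowr (Lp_norm M p (restrict_fun (f - g) R)) p \<le> epowr (ennreal (2 * \<epsilon>)) p"
      unfolding fg[OF R] using p0 h(2)[OF R] by (intro epowr_mono less_imp_le)
  qed
  also have "\<dots> = ennreal (real (card P) * (2 * \<epsilon>) powr p)"
  proof -
    have "epowr (ennreal (2 * \<epsilon>)) p = ennreal ((2 * \<epsilon>) powr p)"
      using \<epsilon> by (intro epowr_ennreal) simp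
    then show ?thesis by (simp add: ennreal_of_nat_eq_real_of_nat ennreal_mult)
  qed
  also have "\<dots> \<le> ennreal (real ((2 * \<nu> + 1) * N) * (2 * \<epsilon>) powr p)"
  proof (intro ennreal_leI mult_right_mono)
    have "2 * \<nu> * N + 1 \<le> (2 * \<nu> + 1) * N" using N by (simp add: algebra_simps)
    then show "real (card P) \<le> real ((2 * \<nu> + 1) * N)" using card_P by (simp only: of_nat_le_iff)
  qed simp
  finally have "epowr (epowr (Lp_norm M p (f - g)) p) (1 / p) \<le> epowr (ennreal (real ((2 * \<nu> + 1) * N) * (2 * \<epsilon>) powr p)) (1 / p)"
    using p0 by (intro epowr_mono) auto
  then have "Lp_norm M p (f - g) \<le> epowr (ennreal (real ((2 * \<nu> + 1) * N) * (2 * \<epsilon>) powr p)) (1 / p)"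
    by (simp only: epowr_inverse[OF p0])
  also have "\<dots> = ennreal ((real (2 * \<nu> + 1) * real N * (2 * \<epsilon>) powr p) powr (1 / p))"
    unfolding of_nat_mult[of "2 * \<nu> + 1" N] by (rule epowr_ennreal) simp
  also have "(real (2 * \<nu> + 1) * real N * (2 * \<epsilon>) powr p) powr (1 / p)
      = real (2 * \<nu> + 1) powr (1 / p) * real N powr (1 / p) * (2 * \<epsilon>)"
    using \<epsilon> p0 by (simp add: powr_mult powr_powr)
  also have "\<dots> = 2 * real (2 * \<nu> + 1) powr (1 / p) * v * (real N powr (1 / p) * real N powr (- 1 / \<sigma>))"
    by (simp add: \<epsilon>_def)
  also have "real N powr (1 / p) * real N powr (- 1 / \<sigma>) = real N powr (1 / p - 1 / \<sigma>)"
    by (simp flip: powr_add)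
  finally show ?thesis using g by blast
qed

end

section \<open>The Jackson inequality for the orthonormal system\<close>

context nuary_filtration
begin

lemma local_system_measurable:
  assumes "local_orthonormal_system M F S \<Phi>" shows "(\<Union>n. \<Phi> n) \<subseteq> borel_measurable M"
proof
  fix \<phi> assume "\<phi> \<in> (\<Union>n. \<Phi> n)"
  then obtain n where "\<phi> \<in> \<Phi> n" by blast
  then have "\<phi> \<in> proj_diff_range M F S n"
    using assms unfolding local_orthonormal_system_def orthonormal_basis_def by blast
  then show "\<phi> \<in> borel_measurable M" by (simp add: proj_diff_range_def Lp_def)
qed

text \<open>Each term of the \<open>\<ell>\<^sup>\<tau>\<close> norm is at most the norm, so the Bernstein hypothesis makes the
  errors of dictionary sums decay at the rate \<open>\<beta>\<close>.\<close>

lemma bernstein_inequality_sigma_n: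
  fixes S :: "('a \<Rightarrow> 'k::{real_normed_field, euclidean_space}) set"
  assumes BI: "bernstein_inequality M F S D p \<tau>" and \<tau>: "0 < \<tau>" and \<beta>: "\<beta> = 1 / \<tau> - 1 / p"
  obtains C :: real where "0 \<le> C"
    "\<And>n m h. 1 \<le> n \<Longrightarrow> h \<in> Sigma_n (C_dict F S) (2 ^ n) \<Longrightarrow>
       sigma_n M p D (2 ^ m) h \<le> ennreal (C * 2 powr (\<beta> * (real n - real m))) * Lp_norm M p h"
proof -
  obtain C0 :: real where C0: "\<And>n h. 1 \<le> n \<Longrightarrow> h \<in> Sigma_n (C_dict F S) (2 ^ n) \<Longrightarrow>
      approx_norm M p D \<beta> (ennreal \<tau>) h \<le> ennreal (C0 * 2 powr (real n * \<beta>)) * Lp_norm M p h"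
    using BI unfolding bernstein_inequality_def Let_def \<beta>[symmetric] by blast
  define C where "C = max C0 0"
  have "sigma_n M p D (2 ^ m) h \<le> ennreal (C * 2 powr (\<beta> * (real n - real m))) * Lp_norm M p h"
    if n: "1 \<le> n" and h: "h \<in> Sigma_n (C_dict F S) (2 ^ n)" for n m h
  proof -
    let ?b = "\<lambda>m. ennreal (2 powr (real m * \<beta>)) * sigma_n M p D (2 ^ m) h"
    have "?b m \<le> lq_norm (ennreal \<tau>) ?b" using \<tau> by (intro lq_norm_ge) simp
    also have "\<dots> \<le> approx_norm M p D \<beta> (ennreal \<tau>) h" by (simp add: approx_norm_def)
    also have "\<dots> \<le> ennreal (C0 * 2 powr (real n * \<beta>)) * Lp_norm M p h" by (rule C0[OF n h])
    also have "\<dots> \<le> ennreal (C * 2 powr (real n * \<beta>)) * Lp_norm M p h"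
      by (intro mult_right_mono ennreal_leI) (auto simp: C_def)
    finally have "ennreal (2 powr (- (real m * \<beta>))) * ?b m
        \<le> ennreal (2 powr (- (real m * \<beta>))) * (ennreal (C * 2 powr (real n * \<beta>)) * Lp_norm M p h)"
      by (rule mult_left_mono) simp
    moreover have "ennreal (2 powr (- (real m * \<beta>))) * ?b m = sigma_n M p D (2 ^ m) h"
      unfolding mult.assoc[symmetric] by (simp flip: ennreal_mult powr_add)
    moreover have "ennreal (2 powr (- (real m * \<beta>))) * (ennreal (C * 2 powr (real n * \<beta>)) * Lp_norm M p h)
        = ennreal (C * 2 powr (\<beta> * (real n - real m))) * Lp_norm M p h"
    proof -
      have "2 powr (- (real m * \<beta>)) * (C * 2 powr (real n * \<beta>)) = C * 2 powr (\<beta> * (real n - real m))"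
        by (simp add: algebra_simps flip: powr_add)
      moreover have "0 \<le> C" by (simp add: C_def)
      ultimately have "ennreal (2 powr (- (real m * \<beta>))) * ennreal (C * 2 powr (real n * \<beta>)) = ennreal (C * 2 powr (\<beta> * (real n - real m)))"
        by (simp only: ennreal_mult[symmetric] powr_ge_zero mult_nonneg_nonneg)
      then show ?thesis by (simp only: mult.assoc[symmetric])
    qed
    ultimately show ?thesis by simp
  qed
  then show thesis using that[of C] by (simp add: C_def)
qed

lemma variation_Bernstein_system:
  assumes S: "admissible_space M F S" and Phi: "local_orthonormal_system M F S \<Phi>"
    and \<sigma>: "0 < \<sigma>" "\<sigma> < p" and N: "1 \<le> N" and x: "x \<in> Sigma_n (\<Union>n. \<Phi> n) N"
  shows "variation_seminorm M F S p \<sigma> x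
    \<le> ennreal (2 powr (1 / \<sigma>) * real (\<nu> * N) powr (1 / \<sigma> - 1 / p)) * Lp_norm M p x"
proof -
  have p: "0 < p" using \<sigma> by simp
  obtain x' where x': "x' \<in> Sigma_n (C_dict F S) (\<nu> * N)" "AE \<omega> in M. x \<omega> = x' \<omega>"
    using Sigma_local_system[OF S Phi x] by blast
  have sub: "fun_space.subspace S" "S \<subseteq> borel_measurable M"
    using S fun_space.subspace_span by (auto simp: admissible_space_def)
  have "1 \<le> \<nu> * N" using nu_ge_2 N by (simp add: Suc_le_eq)
  then have "variation_seminorm M F S p \<sigma> x' \<le> ennreal (2 powr (1 / \<sigma>) * real (\<nu> * N) powr (1 / \<sigma> - 1 / p)) * Lp_norm M p x'"
    by (intro variation_Bernstein sub \<sigma> x' Sigma_n_measurable[OF C_dict_measurable[OF S] x'(1)])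
  moreover have "variation_seminorm M F S p \<sigma> x = variation_seminorm M F S p \<sigma> x'"
    by (rule variation_seminorm_cong_AE[OF p x'(2)])
  moreover have "Lp_norm M p x = Lp_norm M p x'"
  proof (rule Lp_norm_cong_AE[OF p])
    show "AE \<omega> in M. norm (x \<omega>) = norm (x' \<omega>)" using x'(2) by eventually_elim simp
  qed
  ultimately show ?thesis by simp
qed

text \<open>Jackson inequality for \<open>\<Phi>\<close>.  Let \<open>x\<close> be a near-best \<open>2\<^sup>n\<close>-term approximation of \<open>f\<close> from
  \<open>\<Phi>\<close> and \<open>g\<close> the dictionary approximation of comparable complexity.  Up to a null set the
  difference \<open>g - x\<close> has \<open>O(2\<^sup>n)\<close> terms in the dictionary, so the Bernstein hypothesis approximates it by
  \<open>2\<^sup>n\<^sup>+\<^sup>r\<^sup>-\<^sup>1\<close> terms of \<open>\<Phi>\<close> with a gain \<open>2\<^sup>-\<^sup>r\<^sup>\<beta>\<close>.  Adding this correction to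
  \<open>x\<close> relates the errors at the levels \<open>n\<close> and \<open>n + r\<close>.\<close>

lemma variation_Jackson_step:
  assumes S: "admissible_space M F S" and Phi: "local_orthonormal_system M F S \<Phi>" and D_def: "D = (\<Union>n. \<Phi> n)" and p: "1 \<le> p"
    and \<sigma>: "0 < \<sigma>" and CB: "0 \<le> CB"
    and BI: "\<And>n m h. 1 \<le> n \<Longrightarrow> h \<in> Sigma_n (C_dict F S) (2 ^ n) \<Longrightarrow>
       sigma_n M p D (2 ^ m) h \<le> ennreal (CB * 2 powr (\<beta> * (real n - real m))) * Lp_norm M p h"
    and \<alpha>: "\<alpha> = 1 / \<sigma> - 1 / p" and c: "1 \<le> c" "5 * \<nu> + 2 \<le> 2 ^ c" and r: "1 \<le> r"
    and f: "f \<in> LpS M F S p" and v: "0 < v" "variation_seminorm M F S p \<sigma> f \<le> ennreal v"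
  defines "K \<equiv> 2 * real (2 * \<nu> + 1) powr (1 / p)"
    and "e \<equiv> \<lambda>n. enn2real (sigma_n M p D (2 ^ n) f)"
  shows "e (n + r) \<le> K * v * 2 powr (- real n * \<alpha>)
     + CB * 2 powr (\<beta> * (real c + 1 - real r)) * ((K + 1) * v * 2 powr (- real n * \<alpha>) + e n)"
proof -
  let ?D = D and ?C = "C_dict F S" and ?N = "Lp_norm M p"
  define A where "A = 2 powr (- real n * \<alpha>)"
  have p0: "0 < p" using p by simp
  have D: "?D \<subseteq> borel_measurable M" unfolding D_def by (rule local_system_measurable[OF Phi])
  have fm: "f \<in> borel_measurable M" and fN: "?N f < \<top>" using f by (auto simp: LpS_def Lp_def)
  have efin: "ennreal (e m) = sigma_n M p ?D (2 ^ m) f" for m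
  proof -
    have "sigma_n M p ?D (2 ^ m) f < \<top>" using sigma_n_le_norm fN by (rule le_less_trans)
    then show ?thesis by (simp add: e_def)
  qed
  have vA: "0 < v * A" using v by (simp add: A_def)
  have "real (2 ^ n) powr (1 / p - 1 / \<sigma>) = A"
  proof -
    have "real (2 ^ n) = 2 powr real n" by (simp add: powr_realpow)
    then show ?thesis by (simp add: powr_powr A_def \<alpha> algebra_simps)
  qed
  then obtain g where g: "g \<in> Sigma_n ?C (2 * (2 * \<nu> * 2 ^ n + 1))" "?N (f - g) \<le> ennreal (K * v * A)"
    using variation_Jackson_dict[OF S f \<sigma> p v, of "2 ^ n"] unfolding K_def by auto
  have "sigma_n M p ?D (2 ^ n) f < ennreal (e n + v * A)"
    unfolding efin[symmetric] using vA by (simp add: ennreal_less_iff e_def)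
  then obtain x where x: "x \<in> Sigma_n ?D (2 ^ n)" "?N (f - x) < ennreal (e n + v * A)"
    unfolding sigma_n_def INF_less_iff by blast
  obtain x' where x': "x' \<in> Sigma_n ?C (\<nu> * 2 ^ n)" "AE \<omega> in M. x \<omega> = x' \<omega>"
    using Sigma_local_system[OF S Phi, of x] x(1) unfolding D_def by blast
  have gm: "g \<in> borel_measurable M" and x'm: "x' \<in> borel_measurable M"
    using Sigma_n_measurable[OF C_dict_measurable[OF S]] g(1) x'(1) by blast+
  have size: "2 * (2 * \<nu> * 2 ^ n + 1) + \<nu> * 2 ^ n \<le> 2 ^ (n + c)"
  proof -
    have "2 * (2 * \<nu> * 2 ^ n + 1) + \<nu> * 2 ^ n \<le> (5 * \<nu> + 2) * 2 ^ n" by (simp add: algebra_simps)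
    also have "\<dots> \<le> 2 ^ c * 2 ^ n" by (rule mult_right_mono[OF c(2)]) simp
    finally show ?thesis by (simp add: power_add mult.commute)
  qed
  have gx': "g - x' \<in> Sigma_n ?C (2 ^ (n + c))"
    by (rule Sigma_n_mono[OF Sigma_n_diff[OF g(1) x'(1)] size])
  obtain r' where r': "r = Suc r'" using r by (cases r) auto
  have "sigma_n M p ?D (2 ^ (n + r)) f \<le> sigma_n M p ?D (2 ^ (n + r') + 2 ^ n) f"
    by (intro sigma_n_antimono) (simp add: r' power_add)
  also have "\<dots> \<le> ?N (f - g) + sigma_n M p ?D (2 ^ (n + r')) (g - x')"
    by (rule sigma_n_perturb[OF p D fm gm x'm x(1) x'(2)])
  also have "\<dots> \<le> ennreal (K * v * A) + ennreal (CB * 2 powr (\<beta> * (real c + 1 - real r))) * ennreal (K * v * A + (e n + v * A))"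
  proof (rule add_mono[OF g(2)])
    have "?N (g - x') \<le> ?N (g - f) + ?N (f - x')"
      by (rule Lp_norm_triangle_diff[OF p gm fm x'm])
    also have "?N (g - f) = ?N (f - g)" by (rule Lp_norm_minus_commute[OF p0])
    also have "?N (f - x') = ?N (f - x)"
    proof (rule Lp_norm_cong_AE[OF p0])
      show "AE \<omega> in M. norm ((f - x') \<omega>) = norm ((f - x) \<omega>)" using x'(2) by eventually_elim simp
    qed
    also have "?N (f - g) + ?N (f - x) \<le> ennreal (K * v * A) + ennreal (e n + v * A)"
      by (rule add_mono[OF g(2) less_imp_le[OF x(2)]])
    also have "\<dots> = ennreal (K * v * A + (e n + v * A))"
      using vA v by (simp add: K_def A_def e_def flip: ennreal_plus)
    finally have N_gx': "?N (g - x') \<le> ennreal (K * v * A + (e n + v * A))" .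
    have "sigma_n M p ?D (2 ^ (n + r')) (g - x')
        \<le> ennreal (CB * 2 powr (\<beta> * (real (n + c) - real (n + r')))) * ?N (g - x')"
      by (rule BI[OF _ gx']) (use c in simp)
    also have "real (n + c) - real (n + r') = real c + 1 - real r" by (simp add: r')
    also have "ennreal (CB * 2 powr (\<beta> * (real c + 1 - real r))) * ?N (g - x')
        \<le> ennreal (CB * 2 powr (\<beta> * (real c + 1 - real r))) * ennreal (K * v * A + (e n + v * A))"
      by (rule mult_left_mono[OF N_gx']) simp
    finally show "sigma_n M p ?D (2 ^ (n + r')) (g - x')
      \<le> ennreal (CB * 2 powr (\<beta> * (real c + 1 - real r))) * ennreal (K * v * A + (e n + v * A))" .
  qed
  also have "\<dots> = ennreal (K * v * A + CB * 2 powr (\<beta> * (real c + 1 - real r)) * ((K + 1) * v * A + e n))"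
  proof -
    have "K * v * A + (e n + v * A) = (K + 1) * v * A + e n" by (simp add: algebra_simps)
    moreover have "0 \<le> K * v * A" "0 \<le> (K + 1) * v * A + e n"
      using v by (simp_all add: K_def A_def e_def)
    ultimately show ?thesis using CB by (simp flip: ennreal_mult ennreal_plus)
  qed
  finally have "ennreal (e (n + r)) \<le> ennreal (K * v * A + CB * 2 powr (\<beta> * (real c + 1 - real r)) * ((K + 1) * v * A + e n))"
    unfolding efin .
  moreover have "0 \<le> K * v * A + CB * 2 powr (\<beta> * (real c + 1 - real r)) * ((K + 1) * v * A + e n)"
    using v CB by (simp add: K_def A_def e_def)
  ultimately show ?thesis unfolding A_def by (simp add: ennreal_le_iff)
qed

text \<open>Since \<open>\<alpha> < \<beta>\<close>, for a fixed large \<open>r\<close> the old error enters with the factor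
  \<open>2\<^sup>-\<^sup>r\<^sup>\<alpha> / 2\<close>, half of what the rate \<open>\<alpha>\<close> allows over \<open>r\<close> levels; the other half absorbs the error of
  the dictionary approximation, and induction in steps of \<open>r\<close> gives the rate.\<close>

lemma variation_Jackson:
  assumes S: "admissible_space M F S" and Phi: "local_orthonormal_system M F S \<Phi>" and p: "1 \<le> p"
    and BI: "bernstein_inequality M F S (\<Union>n. \<Phi> n) p \<tau>" and \<tau>: "0 < \<tau>"
    and \<alpha>: "0 < \<alpha>" "\<alpha> < 1 / \<tau> - 1 / p" and \<sigma>: "0 < \<sigma>" "\<alpha> = 1 / \<sigma> - 1 / p"
  obtains C :: real where "0 < C"
    "\<And>f n. f \<in> LpS M F S p \<Longrightarrow> sigma_n M p (\<Union>n. \<Phi> n) (2 ^ n) f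
        \<le> ennreal (C * 2 powr (- real n * \<alpha>)) * variation_norm M F S p \<sigma> f"
proof -
  define D where "D = (\<Union>n. \<Phi> n)"
  define \<beta> where "\<beta> = 1 / \<tau> - 1 / p"
  obtain CB where CB: "0 \<le> CB" "\<And>n m h. 1 \<le> n \<Longrightarrow> h \<in> Sigma_n (C_dict F S) (2 ^ n) \<Longrightarrow>
       sigma_n M p D (2 ^ m) h \<le> ennreal (CB * 2 powr (\<beta> * (real n - real m))) * Lp_norm M p h"
    using bernstein_inequality_sigma_n[OF BI \<tau> \<beta>_def] unfolding D_def by blast
  define K where "K = 2 * real (2 * \<nu> + 1) powr (1 / p)"
  have K: "0 \<le> K" by (simp add: K_def)
  define c where "c = 5 * \<nu> + 2"
  have c: "1 \<le> c" "5 * \<nu> + 2 \<le> 2 ^ c" using less_exp[of c] by (simp_all add: c_def)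
  define B where "B = CB * 2 powr (\<beta> * (real c + 1))"
  have B: "0 \<le> B" using CB by (simp add: B_def)
  have "0 < \<beta> - \<alpha>" using \<alpha> by (simp add: \<beta>_def)
  then have "(\<lambda>r. (2 powr (- (\<beta> - \<alpha>))) ^ r) \<longlonglongrightarrow> 0"
    by (intro LIMSEQ_realpow_zero powr_less_one) simp_all
  then have "((\<lambda>r. B * 2 powr (- (\<beta> - \<alpha>) * real r)) \<longlongrightarrow> B * 0) sequentially"
    by (intro tendsto_mult_left) (simp add: powr_realpow[symmetric] powr_powr)
  then have "eventually (\<lambda>r. B * 2 powr (- (\<beta> - \<alpha>) * real r) < 1 / 2) sequentially"
    by (intro order_tendstoD) auto
  then have "eventually (\<lambda>r. B * 2 powr (- (\<beta> - \<alpha>) * real r) < 1 / 2 \<and> 1 \<le> r) sequentially"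
    using eventually_ge_at_top[of 1] by (rule eventually_conj)
  then obtain r :: nat where r: "B * 2 powr (- (\<beta> - \<alpha>) * real r) < 1 / 2" "1 \<le> r"
    using eventually_happens'[OF sequentially_bot] by blast
  define L where "L = 2 powr (real r * \<alpha>) * (2 * (2 * K + 1))"
  have L: "0 < L" using K by (simp add: L_def)
  have main: "sigma_n M p D (2 ^ n) f \<le> ennreal (L * 2 powr (- real n * \<alpha>)) * ennreal v"
    if f: "f \<in> LpS M F S p" and v: "0 < v" "variation_norm M F S p \<sigma> f \<le> ennreal v" for f v n
  proof -
    have fN: "Lp_norm M p f \<le> ennreal v" "variation_seminorm M F S p \<sigma> f \<le> ennreal v"
      using v(2) unfolding variation_norm_def
      by (auto intro: order_trans[of _ "Lp_norm M p f + variation_seminorm M F S p \<sigma> f"])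
    define e where "e n = enn2real (sigma_n M p D (2 ^ n) f)" for n
    have sv: "sigma_n M p D (2 ^ n) f \<le> ennreal v" for n
      using sigma_n_le_norm fN(1) by (rule order_trans)
    have efin: "ennreal (e n) = sigma_n M p D (2 ^ n) f" for n
    proof -
      have "sigma_n M p D (2 ^ n) f < \<top>" using sv[of n] by (rule le_less_trans) simp
      then show ?thesis by (simp add: e_def)
    qed
    have ev: "e n \<le> v" for n using sv[of n] v(1) by (simp add: efin[symmetric])
    have step: "e (n + r) \<le> (2 * K + 1) * v * 2 powr (- real n * \<alpha>) + 1 / 2 * 2 powr (- real r * \<alpha>) * e n" for n
    proof -
      let ?q = "CB * 2 powr (\<beta> * (real c + 1 - real r))" and ?A = "2 powr (- real n * \<alpha>)"
      have "?q = B * 2 powr (- (\<beta> - \<alpha>) * real r) * 2 powr (- real r * \<alpha>)"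
        by (simp add: B_def algebra_simps flip: powr_add)
      also have "\<dots> \<le> 1 / 2 * 2 powr (- real r * \<alpha>)" using r(1) by (intro mult_right_mono) auto
      finally have q: "?q \<le> 1 / 2 * 2 powr (- real r * \<alpha>)" .
      also have "\<dots> \<le> 1 / 2 * 2 powr 0" using \<alpha>(1) by (intro mult_left_mono powr_mono) auto
      finally have q1: "?q \<le> 1" by simp
      have "e (n + r) \<le> K * v * ?A + ?q * ((K + 1) * v * ?A + e n)"
        unfolding K_def e_def
        by (rule variation_Jackson_step[OF S Phi D_def p \<sigma>(1) CB(1) CB(2) \<sigma>(2) c r(2) f v(1) fN(2)])
      also have "\<dots> = K * v * ?A + ?q * ((K + 1) * v * ?A) + ?q * e n" by (simp add: algebra_simps)
      also have "\<dots> \<le> K * v * ?A + 1 * ((K + 1) * v * ?A) + (1 / 2 * 2 powr (- real r * \<alpha>)) * e n"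
        using K v(1) q q1 by (intro add_mono mult_right_mono order_refl) (auto simp: e_def)
      finally show ?thesis by (simp add: algebra_simps)
    qed
    have "e n \<le> L * v * 2 powr (- real n * \<alpha>)" for n
    proof (induction n rule: less_induct)
      case (less n)
      show ?case
      proof (cases "n < r")
        case True
        have "1 \<le> 2 powr (real r * \<alpha> - real n * \<alpha>)"
          using True \<alpha>(1) by (intro ge_one_powr_ge_zero) (simp_all add: mult_right_mono)
        also have "\<dots> \<le> 2 powr (real r * \<alpha> - real n * \<alpha>) * (2 * (2 * K + 1))"
          using K by simp
        also have "\<dots> = L * 2 powr (- real n * \<alpha>)"
          by (simp add: L_def powr_diff powr_minus field_simps)
        finally have "v * 1 \<le> v * (L * 2 powr (- real n * \<alpha>))" using v(1) by (intro mult_left_mono) auto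
        then show ?thesis using ev[of n] by (simp add: mult_ac)
      next
        case False
        then obtain m where n: "n = m + r" by (metis add.commute le_Suc_ex not_less)
        have "m < n" using r(2) n by simp
        have "e n \<le> (2 * K + 1) * v * 2 powr (- real m * \<alpha>) + 1 / 2 * 2 powr (- real r * \<alpha>) * e m"
          unfolding n by (rule step)
        also have "\<dots> \<le> (2 * K + 1) * v * 2 powr (- real m * \<alpha>) + 1 / 2 * 2 powr (- real r * \<alpha>) * (L * v * 2 powr (- real m * \<alpha>))"
          by (intro add_left_mono mult_left_mono less.IH[OF \<open>m < n\<close>]) auto
        also have "2 powr (- real m * \<alpha>) = 2 powr (real r * \<alpha>) * 2 powr (- real n * \<alpha>)"
          by (simp add: n algebra_simps flip: powr_add)
        also have "(2 * K + 1) * v * (2 powr (real r * \<alpha>) * 2 powr (- real n * \<alpha>))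
            + 1 / 2 * 2 powr (- real r * \<alpha>) * (L * v * (2 powr (real r * \<alpha>) * 2 powr (- real n * \<alpha>)))
            = L * v * 2 powr (- real n * \<alpha>)"
        proof -
          have 1: "2 powr (- real r * \<alpha>) * 2 powr (real r * \<alpha>) = 1" by (simp flip: powr_add)
          have 2: "1 / 2 * 2 powr (- real r * \<alpha>) * (L * v * (2 powr (real r * \<alpha>) * 2 powr (- real n * \<alpha>)))
              = (2 powr (- real r * \<alpha>) * 2 powr (real r * \<alpha>)) * (L * v * 2 powr (- real n * \<alpha>) / 2)"
            by (simp add: mult_ac)
          have 3: "(2 * K + 1) * v * (2 powr (real r * \<alpha>) * 2 powr (- real n * \<alpha>)) = L * v * 2 powr (- real n * \<alpha>) / 2"
            by (simp add: L_def mult_ac)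
          show ?thesis unfolding 2 3 1 by simp
        qed
        finally show ?thesis .
      qed
    qed
    then have "ennreal (e n) \<le> ennreal (L * v * 2 powr (- real n * \<alpha>))" by (rule ennreal_leI)
    also have "\<dots> = ennreal (L * 2 powr (- real n * \<alpha>)) * ennreal v"
      using L v(1) by (simp add: mult_ac flip: ennreal_mult)
    finally show ?thesis unfolding efin .
  qed
  have "sigma_n M p D (2 ^ n) f \<le> ennreal (L * 2 powr (- real n * \<alpha>)) * variation_norm M F S p \<sigma> f"
    if f: "f \<in> LpS M F S p" for f n
  proof (cases "variation_norm M F S p \<sigma> f")
    case top
    then show ?thesis using L by (simp add: ennreal_mult_top)
  next
    case (real w)
    define l where "l = L * 2 powr (- real n * \<alpha>)"
    have l: "0 < l" using L by (simp add: l_def)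
    have *: "sigma_n M p D (2 ^ n) f \<le> ennreal l * variation_norm M F S p \<sigma> f + ennreal \<epsilon>" if "0 < \<epsilon>" for \<epsilon>
    proof -
      have "sigma_n M p D (2 ^ n) f \<le> ennreal l * ennreal (w + \<epsilon> / l)"
        unfolding l_def
      proof (rule main[OF f])
        show "0 < w + \<epsilon> / (L * 2 powr (- real n * \<alpha>))"
          using real \<open>0 < \<epsilon>\<close> L by (intro add_nonneg_pos) simp_all
        show "variation_norm M F S p \<sigma> f \<le> ennreal (w + \<epsilon> / (L * 2 powr (- real n * \<alpha>)))"
          using real \<open>0 < \<epsilon>\<close> L by (simp add: ennreal_leI)
      qed
      also have "\<dots> = ennreal (l * w + \<epsilon>)"
        using l real \<open>0 < \<epsilon>\<close> by (simp add: distrib_left flip: ennreal_mult)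
      also have "\<dots> = ennreal l * variation_norm M F S p \<sigma> f + ennreal \<epsilon>"
        using l real \<open>0 < \<epsilon>\<close> by (simp add: ennreal_mult)
      finally show ?thesis .
    qed
    show ?thesis unfolding l_def[symmetric] by (rule ennreal_le_epsilon) (rule *)
  qed
  then show thesis using that[OF L] unfolding D_def by blast
qed

end

section \<open>Near-best approximation and K-functionals\<close>

text \<open>A sequence of near-best dyadic approximations, as produced by the greedy algorithm.\<close>

locale dyadic_near_best =
  fixes M :: "'a measure" and p :: real and D :: "('a \<Rightarrow> 'k::{real_normed_field, euclidean_space}) set"
    and f :: "'a \<Rightarrow> 'k" and G :: "nat \<Rightarrow> 'a \<Rightarrow> 'k" and c \<gamma> \<alpha> :: real
  assumes p: "1 \<le> p" and D: "D \<subseteq> borel_measurable M"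
    and f: "f \<in> borel_measurable M" "Lp_norm M p f < \<top>"
    and G: "\<And>n. G n \<in> Sigma_n D (2 ^ n)"
    and near_best: "\<And>n. Lp_norm M p (f - G n) \<le> ennreal c * sigma_n M p D (2 ^ n) f"
    and c: "0 \<le> c" and \<gamma>\<alpha>: "0 < \<gamma>" "\<gamma> < \<alpha>"
begin

abbreviation "err n \<equiv> sigma_n M p D (2 ^ n) f"

abbreviation "weighted_err n \<equiv> ennreal (2 powr (real n * \<gamma>)) * err n"

text \<open>The norm of \<open>f\<close> takes the place of an error with index \<open>- 1\<close>, so that the \<open>j\<close>-th entry
  controls the difference of the \<open>j\<close>-th approximation and its predecessor.\<close>

definition shifted_err :: "nat \<Rightarrow> ennreal" where
  "shifted_err = case_nat (Lp_norm M p f) weighted_err"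

text \<open>Half of the spare factor \<open>2\<^sup>-\<^sup>(\<^sup>\<alpha>\<^sup>-\<^sup>\<gamma>\<^sup>)\<close> forms the envelope; the other half is left for the
  geometric sums in the norms.\<close>

definition ratio :: real where
  "ratio = 2 powr (- (\<alpha> - \<gamma>) / 2)"

definition envelope :: "nat \<Rightarrow> ennreal" where
  "envelope = geometric_max ratio shifted_err"

lemma ratio: "0 < ratio" "ratio < 1"
  using \<gamma>\<alpha> by (auto simp: ratio_def intro!: powr_less_one)

definition scaled_envelope :: "nat \<Rightarrow> ennreal" where
  "scaled_envelope n = ennreal (2 powr (real n * (\<alpha> - \<gamma>))) * envelope n"

lemma in_lq_envelope:
  assumes "0 < q" "in_lq q weighted_err" shows "in_lq q envelope"
  unfolding envelope_def shifted_err_def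
  using assms ratio f(2) by (intro in_lq_geometric_max in_lq_case_nat) auto

lemma err_less_top: "err n < \<top>"
  using sigma_n_le_norm f(2) by (rule le_less_trans)

lemma envelope_less_top: "envelope n < \<top>"
  unfolding envelope_def
proof (rule geometric_max_less_top)
  fix j show "shifted_err j < \<top>"
    using err_less_top f(2) by (cases j) (auto simp: shifted_err_def ennreal_mult_less_top)
qed

lemma shifted_err_le_envelope:
  assumes "j \<le> n"
  shows "ennreal (2 powr (real j * (\<alpha> - \<gamma>))) * shifted_err j
    \<le> ennreal (ratio ^ (n - j)) * scaled_envelope n"
proof -
  have "2 powr (real j * (\<alpha> - \<gamma>)) = ratio ^ (n - j) * (2 powr (real n * (\<alpha> - \<gamma>)) * ratio ^ (n - j))"
  proof -
    define t where "t = - (\<alpha> - \<gamma>) / 2 * (real n - real j)"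
    have "ratio ^ (n - j) = ratio powr real (n - j)" using ratio by (simp add: powr_realpow)
    also have "\<dots> = 2 powr t" using assms by (simp add: ratio_def powr_powr t_def of_nat_diff)
    finally have "ratio ^ (n - j) = 2 powr t" .
    moreover have "real j * (\<alpha> - \<gamma>) = t + (real n * (\<alpha> - \<gamma>) + t)"
    proof -
      have "t + t = - (\<alpha> - \<gamma>) * (real n - real j)" by (simp add: t_def)
      then show ?thesis by (simp add: algebra_simps)
    qed
    ultimately show ?thesis by (simp only: powr_add)
  qed
  then have "ennreal (2 powr (real j * (\<alpha> - \<gamma>))) * shifted_err j
     = ennreal (ratio ^ (n - j)) * (ennreal (2 powr (real n * (\<alpha> - \<gamma>))) * (ennreal (ratio ^ (n - j)) * shifted_err j))"
    using ratio by (simp add: ennreal_mult mult.assoc)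
  also have "\<dots> \<le> ennreal (ratio ^ (n - j)) * scaled_envelope n"
    unfolding scaled_envelope_def envelope_def by (intro mult_left_mono geometric_max_ge assms) auto
  finally show ?thesis .
qed

lemma shifted_err_self_le: "shifted_err n \<le> envelope n"
  using geometric_max_ge[of n n ratio shifted_err] by (simp add: envelope_def)

lemma shifted_err_Suc:
  "ennreal (2 powr \<gamma> * 2 powr (- real (Suc m) * \<gamma>)) * shifted_err (Suc m) = err m"
proof -
  have "2 powr \<gamma> * 2 powr (- real (Suc m) * \<gamma>) * 2 powr (real m * \<gamma>) = 1"
    by (simp add: algebra_simps flip: powr_add)
  then show ?thesis by (simp add: shifted_err_def mult.assoc[symmetric] flip: ennreal_mult)
qed

lemma err_le_shifted_err:
  "err n \<le> ennreal (2 powr \<gamma> * 2 powr (- real n * \<gamma>)) * shifted_err n"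
proof (cases n)
  case 0
  have "err 0 \<le> 1 * Lp_norm M p f" using sigma_n_le_norm[of M p D "2 ^ 0" f] by simp
  also have "\<dots> \<le> ennreal (2 powr \<gamma>) * Lp_norm M p f"
  proof (rule mult_right_mono)
    have "1 \<le> 2 powr \<gamma>" using \<gamma>\<alpha> by (intro ge_one_powr_ge_zero) auto
    then show "1 \<le> ennreal (2 powr \<gamma>)" by simp
  qed simp
  finally show ?thesis using 0 by (simp add: shifted_err_def)
next
  case (Suc m)
  have "err n \<le> err m" by (rule sigma_n_antimono) (simp add: Suc)
  then show ?thesis unfolding Suc shifted_err_Suc .
qed

lemma G_measurable: "G n \<in> borel_measurable M"
  using Sigma_n_measurable[OF D G] .

lemma Lp_norm_G_diff: "m \<le> n \<Longrightarrow> Lp_norm M p (G n - G m) \<le> ennreal (2 * c) * err m"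
proof -
  assume mn: "m \<le> n"
  have p0: "0 < p" using p by simp
  have "Lp_norm M p (G n - G m) \<le> Lp_norm M p (G n - f) + Lp_norm M p (f - G m)"
    by (rule Lp_norm_triangle_diff[OF p G_measurable f(1) G_measurable])
  also have "Lp_norm M p (G n - f) = Lp_norm M p (f - G n)" by (rule Lp_norm_minus_commute[OF p0])
  also have "Lp_norm M p (f - G n) + Lp_norm M p (f - G m) \<le> ennreal c * err m + ennreal c * err m"
  proof (rule add_mono[OF order_trans[OF near_best] near_best])
    show "ennreal c * err n \<le> ennreal c * err m"
      using mn by (intro mult_left_mono sigma_n_antimono) (auto intro: power_increasing)
  qed
  also have "\<dots> = ennreal (2 * c) * err m"
    using c by (simp add: ennreal_plus[symmetric] distrib_right[symmetric] del: ennreal_plus)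
  finally show ?thesis .
qed

lemma Lp_norm_G_le: "Lp_norm M p (G n) \<le> ennreal (1 + c) * Lp_norm M p f"
proof -
  have p0: "0 < p" using p by simp
  have "Lp_norm M p (G n - 0) \<le> Lp_norm M p (G n - f) + Lp_norm M p (f - 0)"
    by (rule Lp_norm_triangle_diff[OF p G_measurable f(1)]) (simp add: zero_fun_def)
  then have "Lp_norm M p (G n) \<le> Lp_norm M p (f - G n) + Lp_norm M p f"
    by (simp add: Lp_norm_minus_commute[OF p0])
  also have "\<dots> \<le> ennreal c * Lp_norm M p f + Lp_norm M p f"
    by (intro add_right_mono order_trans[OF near_best] mult_left_mono sigma_n_le_norm) simp
  also have "\<dots> = ennreal (1 + c) * Lp_norm M p f"
    using c by (simp add: distrib_right add.commute)
  finally show ?thesis .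
qed

lemma Lp_norm_f_le_envelope: "Lp_norm M p f \<le> scaled_envelope n"
proof -
  have "ennreal (2 powr (real 0 * (\<alpha> - \<gamma>))) * shifted_err 0
     \<le> ennreal (ratio ^ (n - 0)) * scaled_envelope n"
    by (rule shifted_err_le_envelope) simp
  also have "\<dots> \<le> 1 * scaled_envelope n"
    using ratio by (intro mult_right_mono) (auto simp: power_le_one)
  finally show ?thesis by (simp add: shifted_err_def)
qed

definition increment :: "nat \<Rightarrow> 'a \<Rightarrow> 'k" where
  "increment j = (case j of 0 \<Rightarrow> G 0 | Suc i \<Rightarrow> G (Suc i) - G i)"

lemma sum_increment: "(\<Sum>j\<le>n. increment j) = G n"
  by (induction n) (simp_all add: increment_def)

lemma increment_Sigma: "increment j \<in> Sigma_n D (2 * 2 ^ j)"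
proof (cases j)
  case 0
  then show ?thesis using Sigma_n_mono[OF G[of 0], of 2] by (simp add: increment_def)
next
  case (Suc i)
  then show ?thesis
    using Sigma_n_mono[OF Sigma_n_diff[OF G[of "Suc i"] G[of i]], of "2 * 2 ^ Suc i"]
    by (simp add: increment_def)
qed

lemma Lp_norm_increment:
  "Lp_norm M p (increment j) \<le> ennreal ((1 + 2 * c) * 2 powr \<gamma> * 2 powr (- real j * \<gamma>)) * shifted_err j"
proof (cases j)
  case 0
  have "ennreal (1 + c) \<le> ennreal ((1 + 2 * c) * 2 powr \<gamma>)"
  proof (rule ennreal_leI)
    have "1 \<le> 2 powr \<gamma>" using \<gamma>\<alpha> by (intro ge_one_powr_ge_zero) auto
    then have "(1 + 2 * c) * 1 \<le> (1 + 2 * c) * 2 powr \<gamma>" using c by (intro mult_left_mono) auto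
    moreover have "1 + c \<le> (1 + 2 * c) * 1" using c by simp
    ultimately show "1 + c \<le> (1 + 2 * c) * 2 powr \<gamma>" by (rule order_trans[rotated])
  qed
  then have "ennreal (1 + c) * Lp_norm M p f \<le> ennreal ((1 + 2 * c) * 2 powr \<gamma>) * Lp_norm M p f"
    by (rule mult_right_mono) simp
  with Lp_norm_G_le[of 0] show ?thesis unfolding 0 increment_def shifted_err_def
    by simp
next
  case (Suc i)
  have "Lp_norm M p (increment j) \<le> ennreal (2 * c) * err i"
    unfolding Suc increment_def by (simp add: Lp_norm_G_diff)
  also have "\<dots> \<le> ennreal (1 + 2 * c) * err i"
    by (intro mult_right_mono ennreal_leI) auto
  also have "err i = ennreal (2 powr \<gamma> * 2 powr (- real j * \<gamma>)) * shifted_err j"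
    unfolding Suc shifted_err_Suc ..
  also have "ennreal (1 + 2 * c) * (ennreal (2 powr \<gamma> * 2 powr (- real j * \<gamma>)) * shifted_err j)
     = ennreal ((1 + 2 * c) * 2 powr \<gamma> * 2 powr (- real j * \<gamma>)) * shifted_err j"
  proof -
    have "ennreal (1 + 2 * c) * ennreal (2 powr \<gamma> * 2 powr (- real j * \<gamma>)) = ennreal ((1 + 2 * c) * 2 powr \<gamma> * 2 powr (- real j * \<gamma>))"
      using c by (subst ennreal_mult[symmetric]) (simp_all add: mult.assoc)
    then show ?thesis by (simp only: mult.assoc[symmetric])
  qed
  finally show ?thesis .
qed

text \<open>The bound that makes \<open>2\<^sup>n\<^sup>\<gamma> 2\<^sup>-\<^sup>n\<^sup>\<alpha> normY (G n)\<close> at most a multiple of the envelope.\<close>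

definition admissible_norm :: "(('a \<Rightarrow> 'k) \<Rightarrow> ennreal) \<Rightarrow> bool" where
  "admissible_norm normY \<longleftrightarrow>
     (\<exists>C::real. 0 \<le> C \<and> (\<forall>n. normY (G n) \<le> ennreal C * scaled_envelope n))"

lemma admissible_normI:
  assumes norm: "\<And>n. normY (G n) \<le> Lp_norm M p (G n) + semi n"
    and C: "0 \<le> C" and semi: "\<And>n. semi n \<le> ennreal C * scaled_envelope n"
  shows "admissible_norm normY"
  unfolding admissible_norm_def
proof (intro exI conjI allI)
  show "0 \<le> 1 + c + C" using c C by simp
  fix n
  have "normY (G n) \<le> Lp_norm M p (G n) + semi n" by (rule norm)
  also have "\<dots> \<le> ennreal (1 + c) * scaled_envelope n + ennreal C * scaled_envelope n"
    by (intro add_mono semi order_trans[OF Lp_norm_G_le] mult_left_mono Lp_norm_f_le_envelope) simp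
  also have "\<dots> = ennreal (1 + c + C) * scaled_envelope n"
    using c C by (simp only: distrib_right[symmetric] ennreal_plus add_nonneg_nonneg zero_le_one)
  finally show "normY (G n) \<le> ennreal (1 + c + C) * scaled_envelope n" .
qed

lemma admissible_approx_norm:
  assumes \<rho>: "0 < \<rho>" shows "admissible_norm (approx_norm M p D \<alpha> \<rho>)"
proof -
  obtain C :: real where C: "0 \<le> C"
    "\<And>n a s. (\<And>m. m < n \<Longrightarrow> a m \<le> ennreal (ratio ^ (n - m)) * s) \<Longrightarrow> (\<And>m. n \<le> m \<Longrightarrow> a m = 0) \<Longrightarrow>
      lq_norm \<rho> a \<le> ennreal C * s"
    using lq_norm_geometric_le[OF \<rho> ratio] by metis
  define L where "L = 2 * c * 2 powr \<gamma>"
  have L: "0 \<le> L" using c by (simp add: L_def)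
  show ?thesis
  proof (rule admissible_normI)
    fix n
    let ?a = "\<lambda>m. ennreal (2 powr (real m * \<alpha>)) * sigma_n M p D (2 ^ m) (G n)"
    show "approx_norm M p D \<alpha> \<rho> (G n) \<le> Lp_norm M p (G n) + lq_norm \<rho> ?a"
      by (simp add: approx_norm_def)
    have "lq_norm \<rho> ?a \<le> ennreal C * (ennreal L * scaled_envelope n)"
    proof (rule C(2))
      fix m assume m: "m < n"
      have "sigma_n M p D (2 ^ m) (G n) \<le> Lp_norm M p (G n - G m)" by (rule sigma_n_le[OF G])
      also have "\<dots> \<le> ennreal (2 * c) * err m" using m by (intro Lp_norm_G_diff) simp
      also have "\<dots> \<le> ennreal (2 * c) * (ennreal (2 powr \<gamma> * 2 powr (- real m * \<gamma>)) * shifted_err m)"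
        by (intro mult_left_mono err_le_shifted_err) simp
      finally have "?a m \<le> ennreal (2 powr (real m * \<alpha>)) * (ennreal (2 * c) * (ennreal (2 powr \<gamma> * 2 powr (- real m * \<gamma>)) * shifted_err m))"
        by (rule mult_left_mono) simp
      also have "\<dots> = ennreal L * (ennreal (2 powr (real m * (\<alpha> - \<gamma>))) * shifted_err m)"
      proof -
        have "2 powr (real m * \<alpha>) * (2 * c * (2 powr \<gamma> * 2 powr (- real m * \<gamma>))) = L * 2 powr (real m * (\<alpha> - \<gamma>))"
          by (simp add: L_def algebra_simps flip: powr_add)
        then have "ennreal (2 powr (real m * \<alpha>)) * (ennreal (2 * c) * ennreal (2 powr \<gamma> * 2 powr (- real m * \<gamma>)))
           = ennreal L * ennreal (2 powr (real m * (\<alpha> - \<gamma>)))"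
          using c L by (simp only: ennreal_mult[symmetric] powr_ge_zero mult_nonneg_nonneg zero_le_numeral)
        then show ?thesis by (simp only: mult.assoc[symmetric])
      qed
      also have "\<dots> \<le> ennreal L * (ennreal (ratio ^ (n - m)) * scaled_envelope n)"
        using m by (intro mult_left_mono shifted_err_le_envelope) auto
      also have "\<dots> = ennreal (ratio ^ (n - m)) * (ennreal L * scaled_envelope n)" by (rule mult.left_commute)
      finally show "?a m \<le> ennreal (ratio ^ (n - m)) * (ennreal L * scaled_envelope n)" .
    next
      fix m assume "n \<le> m"
      then have "G n \<in> Sigma_n D (2 ^ m)" by (intro Sigma_n_mono[OF G]) simp
      then show "?a m = 0" by (simp add: sigma_n_eq_0)
    qed
    also have "\<dots> = ennreal (C * L) * scaled_envelope n"
      unfolding ennreal_mult[OF C(1) L] by (rule mult.assoc[symmetric])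
    finally show "lq_norm \<rho> ?a \<le> ennreal (C * L) * scaled_envelope n" .
  qed (use C L in simp)
qed

lemma admissible_variation_norm:
  assumes filt: "nuary_filtration M F \<nu>" and S: "admissible_space M F S"
    and Phi: "local_orthonormal_system M F S \<Phi>" and D_def: "D = (\<Union>n. \<Phi> n)"
    and \<sigma>: "0 < \<sigma>" "\<alpha> = 1 / \<sigma> - 1 / p"
  shows "admissible_norm (variation_norm M F S p \<sigma>)"
proof -
  interpret nuary_filtration M F \<nu> by (rule filt)
  have sub: "fun_space.subspace S" "S \<subseteq> borel_measurable M"
    using S fun_space.subspace_span by (auto simp: admissible_space_def)
  have \<sigma>p: "\<sigma> < p"
  proof -
    have "1 / p < 1 / \<sigma>" using \<sigma>(2) \<gamma>\<alpha> by simp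
    then show ?thesis using p \<sigma>(1) by (simp add: field_simps)
  qed
  obtain C :: real where C: "0 \<le> C"
    "\<And>n d s. (\<And>j. j \<le> n \<Longrightarrow> d j \<in> borel_measurable M) \<Longrightarrow>
       (\<And>j. j \<le> n \<Longrightarrow> variation_seminorm M F S p \<sigma> (d j) \<le> ennreal (ratio ^ (n - j)) * s) \<Longrightarrow>
       variation_seminorm M F S p \<sigma> (\<Sum>j\<le>n. d j) \<le> ennreal C * s"
    using variation_seminorm_geometric_sum[OF sub \<sigma>(1) p ratio] by metis
  define B where "B = 2 powr (1 / \<sigma>) * real (2 * \<nu>) powr \<alpha>"
  define L where "L = B * ((1 + 2 * c) * 2 powr \<gamma>)"
  have B: "0 \<le> B" by (simp add: B_def)
  have L: "0 \<le> L" using c B by (simp add: L_def)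
  show ?thesis
  proof (rule admissible_normI)
    fix n
    let ?V = "variation_seminorm M F S p \<sigma>"
    show "variation_norm M F S p \<sigma> (G n) \<le> Lp_norm M p (G n) + ?V (G n)"
      by (simp add: variation_norm_def)
    have "?V (\<Sum>j\<le>n. increment j) \<le> ennreal C * (ennreal L * scaled_envelope n)"
    proof (rule C(2))
      fix j assume j: "j \<le> n"
      show "increment j \<in> borel_measurable M" by (rule Sigma_n_measurable[OF D increment_Sigma])
      have "?V (increment j) \<le> ennreal (2 powr (1 / \<sigma>) * real (\<nu> * (2 * 2 ^ j)) powr (1 / \<sigma> - 1 / p)) * Lp_norm M p (increment j)"
        using increment_Sigma[of j] unfolding D_def
        by (intro variation_Bernstein_system[OF S Phi \<sigma>(1) \<sigma>p]) auto
      also have "2 powr (1 / \<sigma>) * real (\<nu> * (2 * 2 ^ j)) powr (1 / \<sigma> - 1 / p) = B * 2 powr (real j * \<alpha>)"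
      proof -
        have "real (\<nu> * (2 * 2 ^ j)) = real (2 * \<nu>) * 2 powr real j" by (simp add: powr_realpow)
        then have "real (\<nu> * (2 * 2 ^ j)) powr \<alpha> = real (2 * \<nu>) powr \<alpha> * 2 powr (real j * \<alpha>)"
          by (simp only: powr_mult powr_powr)
        then show ?thesis unfolding \<sigma>(2)[symmetric] B_def by (simp only: mult.assoc)
      qed
      also have "ennreal (B * 2 powr (real j * \<alpha>)) * Lp_norm M p (increment j)
         \<le> ennreal (B * 2 powr (real j * \<alpha>)) * (ennreal ((1 + 2 * c) * 2 powr \<gamma> * 2 powr (- real j * \<gamma>)) * shifted_err j)"
        by (intro mult_left_mono Lp_norm_increment) simp
      also have "\<dots> = ennreal L * (ennreal (2 powr (real j * (\<alpha> - \<gamma>))) * shifted_err j)"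
      proof -
        have "B * 2 powr (real j * \<alpha>) * ((1 + 2 * c) * 2 powr \<gamma> * 2 powr (- real j * \<gamma>)) = L * (2 powr (real j * \<alpha>) * 2 powr (- real j * \<gamma>))"
          by (simp add: L_def mult_ac)
        also have "2 powr (real j * \<alpha>) * 2 powr (- real j * \<gamma>) = 2 powr (real j * (\<alpha> - \<gamma>))"
          by (simp add: algebra_simps flip: powr_add)
        finally have "ennreal (B * 2 powr (real j * \<alpha>)) * ennreal ((1 + 2 * c) * 2 powr \<gamma> * 2 powr (- real j * \<gamma>))
           = ennreal L * ennreal (2 powr (real j * (\<alpha> - \<gamma>)))"
          using c L B by (subst (1 2) ennreal_mult[symmetric]) simp_all
        then show ?thesis by (simp only: mult.assoc[symmetric])
      qed
      also have "\<dots> \<le> ennreal L * (ennreal (ratio ^ (n - j)) * scaled_envelope n)"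
        by (intro mult_left_mono shifted_err_le_envelope j) simp
      also have "\<dots> = ennreal (ratio ^ (n - j)) * (ennreal L * scaled_envelope n)" by (rule mult.left_commute)
      finally show "?V (increment j) \<le> ennreal (ratio ^ (n - j)) * (ennreal L * scaled_envelope n)" .
    qed
    also have "\<dots> = ennreal (C * L) * scaled_envelope n"
      unfolding ennreal_mult[OF C(1) L] by (rule mult.assoc[symmetric])
    finally show "?V (G n) \<le> ennreal (C * L) * scaled_envelope n" unfolding sum_increment .
  qed (use C L in simp)
qed

lemma admissible_norm_less_top: "admissible_norm normY \<Longrightarrow> normY (G n) < \<top>"
proof -
  assume "admissible_norm normY"
  then obtain C where "normY (G n) \<le> ennreal C * scaled_envelope n"
    unfolding admissible_norm_def by blast
  also have "\<dots> < \<top>" using envelope_less_top[of n] by (simp add: scaled_envelope_def ennreal_mult_less_top)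
  finally show ?thesis .
qed

text \<open>The common mechanism.  A Jackson inequality for \<open>Y\<close> bounds the approximation error by the
  K-functional, \<open>g = G n\<close> bounds the K-functional by the greedy expression, and the envelope of
  the errors bounds the greedy expression; on \<open>\<ell>\<^sup>\<kappa>\<close> the envelope is as good as the errors.\<close>

lemma K_functional_greedy_equivalence:
  assumes \<kappa>: "0 < \<kappa>" and Y: "Y \<subseteq> borel_measurable M" "\<And>n. G n \<in> Y" and adm: "admissible_norm normY"
    and CJ: "0 \<le> CJ"
    and Jackson: "\<And>g n. g \<in> Y \<Longrightarrow> sigma_n M p D (2 ^ n) g \<le> ennreal (CJ * 2 powr (- real n * \<alpha>)) * normY g"
  shows "in_lq \<kappa> (\<lambda>n. ennreal (2 powr (real n * \<gamma>)) * K_functional (Lp_norm M p) Y normY f (2 powr (- real n * \<alpha>)))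
      \<longleftrightarrow> in_lq \<kappa> weighted_err" (is "?K \<longleftrightarrow> ?E")
    and "in_lq \<kappa> (\<lambda>n. ennreal (2 powr (real n * \<gamma>)) *
             (Lp_norm M p (f - G n) + ennreal (2 powr (- real n * \<alpha>)) * normY (G n)))
      \<longleftrightarrow> in_lq \<kappa> weighted_err" (is "?G \<longleftrightarrow> ?E")
proof -
  let ?t = "\<lambda>n. 2 powr (- real n * \<alpha>)" and ?w = "\<lambda>n. ennreal (2 powr (real n * \<gamma>))"
  let ?KF = "\<lambda>n. K_functional (Lp_norm M p) Y normY f (?t n)"
  let ?GF = "\<lambda>n. Lp_norm M p (f - G n) + ennreal (?t n) * normY (G n)"
  have 1: "?K" if "?G"
  proof (rule in_lq_mono[OF \<kappa> that, of 1])
    fix n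
    have "?KF n \<le> ?GF n" unfolding K_functional_def by (rule INF_lower[OF Y(2)])
    then show "?w n * ?KF n \<le> 1 * (?w n * ?GF n)" by (simp add: mult_left_mono)
  qed simp
  have 2: "?E" if "?K"
  proof (rule in_lq_mono[OF \<kappa> that, of "ennreal (1 + CJ)"])
    fix n
    have *: "err n \<le> ennreal (1 + CJ) * (Lp_norm M p (f - g) + ennreal (?t n) * normY g)" if g: "g \<in> Y" for g
    proof -
      have "err n \<le> Lp_norm M p (f - g) + sigma_n M p D (2 ^ n) g"
        using Y(1) g by (intro sigma_n_triangle[OF p D f(1)]) auto
      also have "\<dots> \<le> 1 * Lp_norm M p (f - g) + ennreal CJ * (ennreal (?t n) * normY g)"
        using Jackson[OF g, of n] CJ by (simp add: ennreal_mult mult.assoc add_left_mono)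
      also have "\<dots> \<le> ennreal (1 + CJ) * Lp_norm M p (f - g) + ennreal (1 + CJ) * (ennreal (?t n) * normY g)"
        using CJ by (intro add_mono mult_right_mono) simp_all
      finally show ?thesis by (simp only: distrib_left)
    qed
    have inv: "ennreal (1 / (1 + CJ)) * ennreal (1 + CJ) = 1"
      using CJ by (subst ennreal_mult[symmetric]) simp_all
    have "ennreal (1 / (1 + CJ)) * err n \<le> ?KF n"
      unfolding K_functional_def
    proof (rule INF_greatest)
      fix g assume "g \<in> Y"
      from mult_left_mono[OF *[OF this], of "ennreal (1 / (1 + CJ))"]
      show "ennreal (1 / (1 + CJ)) * err n \<le> Lp_norm M p (f - g) + ennreal (?t n) * normY g"
        unfolding mult.assoc[symmetric] inv by simp
    qed
    then have "ennreal (1 + CJ) * (ennreal (1 / (1 + CJ)) * err n) \<le> ennreal (1 + CJ) * ?KF n"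
      by (rule mult_left_mono) simp
    then have "err n \<le> ennreal (1 + CJ) * ?KF n"
      unfolding mult.assoc[symmetric] mult.commute[of "ennreal (1 + CJ)" "ennreal (1 / (1 + CJ))"] inv by simp
    then have "?w n * err n \<le> ?w n * (ennreal (1 + CJ) * ?KF n)" by (rule mult_left_mono) simp
    then show "?w n * err n \<le> ennreal (1 + CJ) * (?w n * ?KF n)" by (simp only: mult.left_commute)
  qed simp
  have 3: "?G" if "?E"
  proof -
    obtain C where C: "0 \<le> C"
      "\<And>n. normY (G n) \<le> ennreal C * (ennreal (2 powr (real n * (\<alpha> - \<gamma>))) * envelope n)"
      using adm unfolding admissible_norm_def scaled_envelope_def by blast
    define L where "L = c * 2 powr \<gamma> + C"
    show ?thesis
    proof (rule in_lq_mono[OF \<kappa> in_lq_envelope[OF \<kappa> that], of "ennreal L"])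
      fix n
      have "?w n * Lp_norm M p (f - G n) \<le> ?w n * (ennreal c * (ennreal (2 powr \<gamma> * 2 powr (- real n * \<gamma>)) * envelope n))"
        by (intro mult_left_mono order_trans[OF near_best] order_trans[OF err_le_shifted_err] shifted_err_self_le) auto
      also have "\<dots> = ennreal (c * 2 powr \<gamma>) * envelope n"
      proof -
        have "2 powr (real n * \<gamma>) * (c * (2 powr \<gamma> * 2 powr (- real n * \<gamma>))) = c * 2 powr \<gamma> * (2 powr (real n * \<gamma>) * 2 powr (- real n * \<gamma>))"
          by (simp only: mult_ac)
        also have "2 powr (real n * \<gamma>) * 2 powr (- real n * \<gamma>) = 1" by (simp flip: powr_add)
        finally have "?w n * (ennreal c * ennreal (2 powr \<gamma> * 2 powr (- real n * \<gamma>))) = ennreal (c * 2 powr \<gamma>)"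
          using c by (simp only: ennreal_mult[symmetric] powr_ge_zero mult_nonneg_nonneg mult_1_right)
        then show ?thesis by (simp only: mult.assoc[symmetric])
      qed
      finally have i: "?w n * Lp_norm M p (f - G n) \<le> ennreal (c * 2 powr \<gamma>) * envelope n" .
      have "?w n * (ennreal (?t n) * normY (G n))
          \<le> ?w n * (ennreal (?t n) * (ennreal C * (ennreal (2 powr (real n * (\<alpha> - \<gamma>))) * envelope n)))"
        by (intro mult_left_mono C(2)) auto
      also have "\<dots> = ennreal C * envelope n"
      proof -
        have "2 powr (real n * \<gamma>) * (?t n * (C * 2 powr (real n * (\<alpha> - \<gamma>)))) = C * (2 powr (real n * \<gamma>) * ?t n * 2 powr (real n * (\<alpha> - \<gamma>)))"
          by (simp only: mult_ac)
        also have "2 powr (real n * \<gamma>) * ?t n * 2 powr (real n * (\<alpha> - \<gamma>)) = 1"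
          by (simp add: algebra_simps flip: powr_add)
        finally have "?w n * (ennreal (?t n) * (ennreal C * ennreal (2 powr (real n * (\<alpha> - \<gamma>))))) = ennreal C"
          using C(1) by (simp only: ennreal_mult[symmetric] powr_ge_zero mult_nonneg_nonneg mult_1_right)
        then show ?thesis by (simp only: mult.assoc[symmetric])
      qed
      finally have ii: "?w n * (ennreal (?t n) * normY (G n)) \<le> ennreal C * envelope n" .
      have "?w n * ?GF n \<le> ennreal (c * 2 powr \<gamma>) * envelope n + ennreal C * envelope n"
        unfolding distrib_left by (rule add_mono[OF i ii])
      also have "\<dots> = ennreal L * envelope n"
        using c C(1) unfolding L_def by (simp only: distrib_right[symmetric] ennreal_plus mult_nonneg_nonneg powr_ge_zero)
      finally show "?w n * ?GF n \<le> ennreal L * envelope n" .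
    qed simp
  qed
  show "?K \<longleftrightarrow> ?E" "?G \<longleftrightarrow> ?E" using 1 2 3 by blast+
qed

end

section \<open>The greedy algorithm and the theorem\<close>

context nuary_filtration
begin

lemma Sigma_system_LpS:
  fixes S :: "('a \<Rightarrow> 'k::{real_normed_field, euclidean_space}) set"
  assumes S: "admissible_space M F S" and Phi: "local_orthonormal_system M F S \<Phi>" and p: "1 \<le> p"
    and x: "x \<in> Sigma_n (\<Union>n. \<Phi> n) m"
  shows "x \<in> LpS M F S p"
proof -
  have p0: "0 < p" using p by simp
  obtain y where y: "y \<in> Sigma_n (C_dict F S) (\<nu> * m)" "AE \<omega> in M. x \<omega> = y \<omega>"
    using Sigma_local_system[OF S Phi x] by blast
  obtain T where T: "T \<subseteq> C_dict F S" "y \<in> fun_space.span T" using y(1) by (rule Sigma_nE)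
  then have span: "y \<in> fun_space.span (C_dict F S)" using fun_space.span_mono by blast
  have "AE \<omega> in M. norm (x \<omega>) = norm (y \<omega>)" using y(2) by eventually_elim simp
  then have "Lp_norm M p x = Lp_norm M p y" by (rule Lp_norm_cong_AE[OF p0])
  moreover have "y \<in> Lp M p" by (rule Lp_span[OF p C_dict_Lp[OF S p0] span])
  ultimately have "x \<in> Lp M p"
    using Sigma_n_measurable[OF local_system_measurable[OF Phi] x] by (simp add: Lp_def)
  moreover have "Lp_norm M p (x - y) = 0"
  proof -
    have "AE \<omega> in M. norm ((x - y) \<omega>) = norm (0 :: 'k)" using y(2) by eventually_elim simp
    then have "Lp_norm M p (x - y) = Lp_norm M p (0 :: 'a \<Rightarrow> 'k)"
      by (intro Lp_norm_cong_AE[OF p0]) simp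
    then show ?thesis by simp
  qed
  ultimately show ?thesis unfolding LpS_def using span by (auto intro!: bexI[of _ y])
qed

end

lemma greedy_approx_Sigma:
  assumes e: "enumerates e D" and k: "k f ` index_set D \<subseteq> index_set D"
  shows "greedy_approx M p (index_set D) (Lp_normalize M p e) k m f \<in> Sigma_n D m"
proof -
  have "greedy_approx M p (index_set D) (Lp_normalize M p e) k m f \<in> Sigma_n D (\<Sum>j \<in> index_set D \<inter> {..<m}. 1)"
    unfolding greedy_approx_def
  proof (rule Sigma_n_sum)
    fix j assume "j \<in> index_set D \<inter> {..<m}"
    then have "e (k f j) \<in> D" using e k unfolding enumerates_def bij_betw_def by blast
    then have "Lp_normalize M p e (k f j) \<in> Sigma_n D 1"
      unfolding Lp_normalize_def by (intro Sigma_n_scale Sigma_n_base)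
    then show "fscale (basis_coeffs M p (index_set D) (Lp_normalize M p e) f (k f j)) (Lp_normalize M p e (k f j)) \<in> Sigma_n D 1"
      by (rule Sigma_n_scale)
  qed simp
  moreover have "card (index_set D \<inter> {..<m}) \<le> m"
    using card_mono[of "{..<m}" "index_set D \<inter> {..<m}"] by simp
  ultimately show ?thesis by (auto intro: Sigma_n_mono)
qed

text \<open>The lower Temlyakov bound on singletons says that no normalized element vanishes, so that
  normalization does not change the sets of \<open>m\<close>-term sums.\<close>

lemma Sigma_n_normalize:
  fixes e :: "nat \<Rightarrow> 'a \<Rightarrow> 'k::{real_normed_field, euclidean_space}"
  assumes e: "enumerates e D" and tem: "temlyakov_property M p (index_set D) (Lp_normalize M p e)"
  shows "Sigma_n D m \<subseteq> Sigma_n (Lp_normalize M p e ` index_set D) m"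
proof
  let ?J = "index_set D" and ?\<psi> = "Lp_normalize M p e"
  fix x assume "x \<in> Sigma_n D m"
  then obtain T where T: "T \<subseteq> D" "finite T" "card T \<le> m" "x \<in> fun_space.span T" by (rule Sigma_nE)
  define I where "I = {j \<in> ?J. e j \<in> T}"
  have eI: "e ` I = T" "inj_on e I"
    using e T(1) unfolding enumerates_def bij_betw_def I_def inj_on_def by auto
  then have I: "finite I" "card I = card T" using T(2) card_image[OF eI(2)] finite_imageD[of e I] by auto
  have "e j \<in> fun_space.span (?\<psi> ` I)" if j: "j \<in> I" for j
  proof -
    define a :: 'k where "a = of_real (1 / enn2real (Lp_norm M p (e j)))"
    have \<psi>: "?\<psi> j = fscale a (e j)" by (simp add: Lp_normalize_def a_def)
    obtain c :: real where c: "0 < c" "\<And>\<Lambda>. \<Lambda> \<subseteq> ?J \<Longrightarrow> finite \<Lambda> \<Longrightarrow>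
        ennreal (c * real (card \<Lambda>) powr (1 / p)) \<le> Lp_norm M p (\<Sum>n\<in>\<Lambda>. ?\<psi> n)"
      using tem unfolding temlyakov_property_def by blast
    have "ennreal c \<le> Lp_norm M p (?\<psi> j)" using c(2)[of "{j}"] j by (simp add: I_def)
    then have "?\<psi> j \<noteq> 0" using c(1) by auto
    then have "a \<noteq> 0" unfolding \<psi> by (auto simp: fscale_def fun_eq_iff)
    then have "e j = fscale (1 / a) (?\<psi> j)" unfolding \<psi> by (simp add: fscale_def fun_eq_iff)
    then show ?thesis using j fun_space.span_scale[OF fun_space.span_base[of "?\<psi> j" "?\<psi> ` I"]] by auto
  qed
  then have "T \<subseteq> fun_space.span (?\<psi> ` I)" using eI(1) by blast
  then have "x \<in> fun_space.span (?\<psi> ` I)"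
    using T(4) fun_space.span_minimal[OF _ fun_space.subspace_span] by blast
  moreover have "card (?\<psi> ` I) \<le> m" using card_image_le[OF I(1), of ?\<psi>] I(2) T(3) by simp
  moreover have "?\<psi> ` I \<subseteq> ?\<psi> ` ?J" by (auto simp: I_def)
  ultimately show "x \<in> Sigma_n (?\<psi> ` ?J) m" using I(1) by (intro Sigma_nI[of "?\<psi> ` I"]) auto
qed

lemma approx_norm_Jackson:
  assumes "0 < \<rho>"
  shows "sigma_n M p D (2 ^ n) g \<le> ennreal (2 powr (- real n * \<alpha>)) * approx_norm M p D \<alpha> \<rho> g"
proof -
  let ?b = "\<lambda>n. ennreal (2 powr (real n * \<alpha>)) * sigma_n M p D (2 ^ n) g"
  have "?b n \<le> approx_norm M p D \<alpha> \<rho> g"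
    unfolding approx_norm_def using lq_norm_ge[OF assms, of ?b n] by (rule add_increasing[OF zero_le])
  then have "ennreal (2 powr (- real n * \<alpha>)) * ?b n \<le> ennreal (2 powr (- real n * \<alpha>)) * approx_norm M p D \<alpha> \<rho> g"
    by (rule mult_left_mono) simp
  moreover have "ennreal (2 powr (- real n * \<alpha>)) * ennreal (2 powr (real n * \<alpha>)) = 1"
    by (simp flip: ennreal_mult powr_add)
  then have "ennreal (2 powr (- real n * \<alpha>)) * ?b n = sigma_n M p D (2 ^ n) g"
    by (simp only: mult.assoc[symmetric] mult_1_left)
  ultimately show ?thesis by simp
qed

theorem theorem4p6:
  fixes M :: "'a measure" and F :: "nat \<Rightarrow> 'a measure" and \<nu> :: nat
    and S :: "('a \<Rightarrow> 'k::{real_normed_field, euclidean_space}) set"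
    and \<Phi> :: "nat \<Rightarrow> ('a \<Rightarrow> 'k) set"
    and e :: "nat \<Rightarrow> 'a \<Rightarrow> 'k"
    and k :: "real \<Rightarrow> ('a \<Rightarrow> 'k) \<Rightarrow> nat \<Rightarrow> nat"
    and p \<tau> \<beta> \<gamma> \<alpha> \<sigma> :: real and \<kappa> \<rho> :: ennreal
    and f :: "'a \<Rightarrow> 'k"
  defines "D \<equiv> (\<Union>n. \<Phi> n)"
  defines "J \<equiv> index_set D"
  defines "\<psi> \<equiv> \<lambda>r. Lp_normalize M r e"
  defines "G \<equiv> greedy_approx M p J (\<psi> p) (k p)"
  defines "A_norm \<equiv> approx_norm M p D \<alpha> \<rho>"
  defines "A_space \<equiv> approx_space M F S p D \<alpha> \<rho>"
  defines "V_norm \<equiv> variation_norm M F S p \<sigma>"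
  defines "V_space \<equiv> variation_space M F S p \<sigma>"
  assumes filt: "nuary_filtration M F \<nu>"
    and S: "admissible_space M F S"
    and Phi: "local_orthonormal_system M F S \<Phi>"
    and enum: "enumerates e D"
    and greedy: "\<And>r. 1 < r \<Longrightarrow> greedy_basis M r J (\<psi> r) (k r) (LpS M F S r)"
    and temlyakov: "\<And>r. 1 < r \<Longrightarrow> temlyakov_property M r J (\<psi> r)"
    and p: "1 < p" and tau: "0 < \<tau>" "\<tau> < p"
    and BI: "bernstein_inequality M F S D p \<tau>"
    and beta: "\<beta> = 1 / \<tau> - 1 / p"
    and gamma_alpha: "0 < \<gamma>" "\<gamma> < \<alpha>" "\<alpha> < \<beta>"
    and kappa: "0 < \<kappa>" and rho: "0 < \<rho>"
    and sigma: "\<alpha> = 1 / \<sigma> - 1 / p"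
    and f: "f \<in> LpS M F S p"
  defines "cond1 \<equiv> in_lq \<kappa> (\<lambda>n. ennreal (2 powr (real n * \<gamma>)) *
             K_functional (Lp_norm M p) A_space A_norm f (2 powr (- real n * \<alpha>)))"
  defines "cond2 \<equiv> in_lq \<kappa> (\<lambda>n. ennreal (2 powr (real n * \<gamma>)) *
             (Lp_norm M p (f - G (2 ^ n) f) + ennreal (2 powr (- real n * \<alpha>)) * A_norm (G (2 ^ n) f)))"
  defines "cond3 \<equiv> in_lq \<kappa> (\<lambda>n. ennreal (2 powr (real n * \<gamma>)) *
             K_functional (Lp_norm M p) V_space V_norm f (2 powr (- real n * \<alpha>)))"
  defines "cond4 \<equiv> in_lq \<kappa> (\<lambda>n. ennreal (2 powr (real n * \<gamma>)) *
             (Lp_norm M p (f - G (2 ^ n) f) + ennreal (2 powr (- real n * \<alpha>)) * V_norm (G (2 ^ n) f)))"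
  shows "(cond1 \<longleftrightarrow> cond2) \<and> (cond2 \<longleftrightarrow> cond3) \<and> (cond3 \<longleftrightarrow> cond4)"
proof -
  interpret nuary_filtration M F \<nu> by (rule filt)
  let ?X = "LpS M F S p" and ?N = "Lp_norm M p"
  have p1: "1 \<le> p" and p0: "0 < p" using p by simp_all
  have D_meas: "D \<subseteq> borel_measurable M" unfolding D_def by (rule local_system_measurable[OF Phi])
  have X_meas: "?X \<subseteq> borel_measurable M" by (auto simp: LpS_def Lp_def)
  have \<sigma>: "0 < \<sigma>"
  proof -
    have "0 < 1 / p" using p0 by simp
    then have "0 < 1 / \<sigma>" using sigma gamma_alpha by linarith
    then show ?thesis by simp
  qed
  have "greedy_ordering J (basis_coeffs M p J (\<psi> p) f) (k p f)"
    using greedy[OF p] f unfolding greedy_basis_def by blast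
  then have kJ: "k p f ` J \<subseteq> J" unfolding greedy_ordering_def by blast
  obtain c0 :: real where c0: "\<And>g m. g \<in> ?X \<Longrightarrow> ?N (g - G m g) \<le> ennreal c0 * sigma_n M p (\<psi> p ` J) m g"
    using greedy[OF p] unfolding greedy_basis_def G_def by blast
  define c where "c = max c0 0"
  have G_Sigma: "G m f \<in> Sigma_n D m" for m
    unfolding G_def \<psi>_def J_def using enum kJ[unfolded J_def] by (rule greedy_approx_Sigma)
  have G_near: "?N (f - G m f) \<le> ennreal c * sigma_n M p D m f" for m
  proof -
    have "?N (f - G m f) \<le> ennreal c0 * sigma_n M p (\<psi> p ` J) m f" by (rule c0[OF f])
    also have "\<dots> \<le> ennreal c * sigma_n M p (\<psi> p ` J) m f"
      by (intro mult_right_mono ennreal_leI) (auto simp: c_def)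
    also have "\<dots> \<le> ennreal c * sigma_n M p D m f"
      unfolding sigma_n_def \<psi>_def J_def
      using Sigma_n_normalize[OF enum temlyakov[OF p, unfolded \<psi>_def J_def]]
      by (intro mult_left_mono INF_superset_mono) auto
    finally show ?thesis .
  qed
  have G_X: "G m f \<in> ?X" for m
    using Sigma_system_LpS[OF S Phi p1] G_Sigma unfolding D_def by blast
  interpret dyadic_near_best M p D f "\<lambda>n. G (2 ^ n) f" c \<gamma> \<alpha>
  proof
    show "f \<in> borel_measurable M" "?N f < \<top>" using f by (auto simp: LpS_def Lp_def)
  qed (use p1 D_meas G_Sigma G_near gamma_alpha in \<open>auto simp: c_def\<close>)
  have A: "admissible_norm A_norm" unfolding A_norm_def by (rule admissible_approx_norm[OF rho])
  have V: "admissible_norm V_norm" unfolding V_norm_def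
    by (rule admissible_variation_norm[OF filt S Phi _ \<sigma> sigma]) (simp add: D_def)
  have GA: "G (2 ^ n) f \<in> A_space" for n
    using G_X admissible_norm_less_top[OF A, of n] by (simp add: A_space_def approx_space_def A_norm_def)
  have GV: "G (2 ^ n) f \<in> V_space" for n
    using G_X admissible_norm_less_top[OF V, of n] by (simp add: V_space_def variation_space_def V_norm_def)
  have A_meas: "A_space \<subseteq> borel_measurable M" using X_meas by (auto simp: A_space_def approx_space_def)
  have V_meas: "V_space \<subseteq> borel_measurable M" using X_meas by (auto simp: V_space_def variation_space_def)
  have A_Jackson: "sigma_n M p D (2 ^ n) g \<le> ennreal (1 * 2 powr (- real n * \<alpha>)) * A_norm g" for g n
    unfolding A_norm_def mult_1_left by (rule approx_norm_Jackson[OF rho])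
  have "\<alpha> < 1 / \<tau> - 1 / p" "0 < \<alpha>" using gamma_alpha beta by simp_all
  then obtain C where C: "0 < C" "\<And>g n. g \<in> ?X \<Longrightarrow> sigma_n M p D (2 ^ n) g
        \<le> ennreal (C * 2 powr (- real n * \<alpha>)) * V_norm g"
    using variation_Jackson[OF S Phi p1 BI[unfolded D_def] tau(1) _ _ \<sigma> sigma]
    unfolding D_def V_norm_def by metis
  have V_Jackson: "sigma_n M p D (2 ^ n) g \<le> ennreal (C * 2 powr (- real n * \<alpha>)) * V_norm g" if "g \<in> V_space" for g n
    using C(2)[of g n] that by (simp add: V_space_def variation_space_def)
  have "cond1 \<longleftrightarrow> in_lq \<kappa> weighted_err" "cond2 \<longleftrightarrow> in_lq \<kappa> weighted_err"
    unfolding cond1_def cond2_def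
    by (rule K_functional_greedy_equivalence[OF kappa A_meas GA A zero_le_one A_Jackson])+
  moreover have "cond3 \<longleftrightarrow> in_lq \<kappa> weighted_err" "cond4 \<longleftrightarrow> in_lq \<kappa> weighted_err"
    unfolding cond3_def cond4_def
    by (rule K_functional_greedy_equivalence[OF kappa V_meas GV V less_imp_le[OF C(1)] V_Jackson], assumption)+
  ultimately show ?thesis by blast
qed

end
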